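(* Suppose that (DV3+) holds with an unbounded function $W$, and let $W_0$ be as in the context. Then: (i) For any probability measure $\Gamma\in\mathcal M_{1,2}^{W_0}$, if $\Lambda^*(\Gamma)<\infty$ then the one-dimensional marginals $\{\Gamma_1,\Gamma_2\}$ of $\Gamma$ agree. Consequently, letting $\check\pi=\Gamma_1$ denote the first marginal of $\Gamma$, we can write, for some transition kernel $\check P$, $\Gamma(dx,dy)=\check\pi(dx)\check P(x,dy)$, where $\check\pi$ is an invariant measure for $\check P$. (ii) If $\Lambda^*(\Gamma)<\infty$ for some probability measure $\Gamma\in\mathcal M_{1,2}^{W_0}$, then $$\Lambda^*(\Gamma)=H(\Gamma\,\|\,\check\pi\odot P):=\int_{\mathsf X\times\mathsf X}\log\Big(\frac{d\Gamma}{d[\check\pi\odot P]}(x,y)\Big)\Gamma(dx,dy),$$ where $[\check\pi\odot P](dx,dy):=\check\pi(dx)P(x,dy)$ and $\check\pi$ is the first marginal of $\Gamma$. (iii) For any $c>0$, the set $\{\Gamma\in\mathcal M_{1,2}^{W_0}:\Lambda^*(\Gamma)\le c\}$ is a bounded subset of $\mathcal M_{1,2}^{W_0}$.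
   Context: $\mathsf X$ is a Polish space with Borel $\sigma$-field $\mathcal B$; $\Phi=\{\Phi(t):t=0,1,2,\dots\}$ is a time-homogeneous Markov chain on $\mathsf X$ with transition kernel $P$; $\mathsf P_x$ denotes probability given $\Phi(0)=x$. All functions and sets are measurable. $\Phi$ is $\psi$-irreducible and aperiodic if there is a $\sigma$-finite measure $\psi$ such that for every $A\in\mathcal B$ with $\psi(A)>0$ and every $x$, $P^t(x,A)>0$ for all $t$ sufficiently large; $\psi$ is taken maximal (any other such measure is absolutely continuous with respect to $\psi$). $\tau_A=\inf\{t\ge1:\Phi(t)\in A\}$. A set $C\in\mathcal B$ is small if there are $\epsilon>0$, a probability measure $\nu$ and a measure $m$ on $\{0,1,2,\dots\}$ with finite mean such that $\sum_{t\ge0}P^t(x,A)m(t)\ge\epsilon\mathbb 1_C(x)\nu(A)$ for all $x$, $A\in\mathcal B$. The nonlinear generator is $\mathcal H(G)=\log(e^{-G}Pe^G)$. $L_\infty^W=\{g:\|g\|_W:=\sup_x|g(x)|/W(x)<\infty\}$; $C_W(r)=\{y:W(y)\le r\}$. (DV3) with Lyapunov function $V$: for a function $W:\mathsf X\to[1,\infty)$, a small set $C$ and constants $\delta>0$, $b<\infty$, $\mathcal H(V)\le-\delta W+b\mathbb 1_C$ on $\{V<\infty\}$. (DV3+): (i) $\Phi$ is $\psi$-irreducible, aperiodic, and satisfies (DV3) with some $V:\mathsf X\to[1,\infty)$; (ii) there exists $T_0>0$ such that, for each $r<\sup_xW(x)$, there is a measure $\beta_r$ with $\beta_r(e^V)<\infty$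 and $\mathsf P_x\{\Phi(T_0)\in A,\ \tau_{C_W(r)^c}>T_0\}\le\beta_r(A)$ for all $x\in C_W(r)$, $A\in\mathcal B$. $W_0:\mathsf X\to[1,\infty)$ is a fixed function in $L_\infty^W$ with $\lim_{r\to\infty}\sup_x\big[\frac{W_0(x)}{W(x)}\mathbb 1_{\{W(x)>r\}}\big]=0$. $L_{\infty,2}^{W_0}$ is the space of real-valued $M$ on $\mathsf X\times\mathsf X$ with $\|M\|_{W_0}=\sup_{x,y}\frac{|M(x,y)|}{W_0(x)+W_0(y)}<\infty$; $\mathcal M_{1,2}^{W_0}$ is the space of real-valued (signed) measures $\Gamma$ on $\mathsf X\times\mathsf X$ with $\|\Gamma\|_{W_0}=\int[W_0(x)+W_0(y)]\,|\Gamma(dx,dy)|<\infty$. For $M\in L_{\infty,2}^{W_0}$, $\Lambda(M)$ is the logarithm of the generalized principal eigenvalue of the kernel $P_m(x,dy)=e^{M(x,y)}P(x,dy)$ (equivalently, of the correspondingly scaled transition kernel of the bivariate chain of consecutive pairs $(\Phi(k),\Phi(k+1))$). Generalized principal eigenvalue of a positive $\psi$-irreducible kernel $K$: a function $s\ge0$ with $\int s\,d\psi>0$ is small for $K$ if for some $\lambda>0$ and some nonzero positive measure $\nu$, $\sum_{k\ge0}\lambda^{-k-1}K^k(x,A)\ge s(x)\nu(A)$ for all $x,A$; the generalized principal eigenvalue is the $\hat\lambda\in(0,\infty]$ such that for every such small $s$, $\sum_{k\ge0}\lambda^{-k-1}K^ks(x)=\infty$ for all $x$ if $\lambda<\hat\lambda$,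 and is finite for $\psi$-a.e. $x$ if $\lambda>\hat\lambda$. The convex dual is $\Lambda^*(\Gamma)=\sup_{M\in L_{\infty,2}^{W_0}}(\langle\Gamma,M\rangle-\Lambda(M))$ for $\Gamma\in\mathcal M_{1,2}^{W_0}$, with $\langle\Gamma,M\rangle=\int M\,d\Gamma$.
   Formalization: In the definition of a small function s for K, the series of λ^{-k-1}K^k(x,·) is also required to be a σ-finite measure for ψ-a.e. x; without this every s ≥ 0 with positive ψ-integral can be small and no number need satisfy the definition of the generalized principal eigenvalue. *)

theory Defs
  imports "HOL-Probability.Probability"
begin

section \<open>Positive kernels and their powers\<close>

text \<open>
  A positive kernel on \<open>'a\<close> is a function \<open>K :: 'a \<Rightarrow> 'a measure\<close> with \<open>K x\<close> a Borel measure.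
  The kernels \<open>e\<^sup>M P\<close> considered below need not be sub-probability kernels, so the Giry monad is
  not available for their powers; \<open>K\<^sup>n\<close> is taken as an operator on \<open>[0,\<infinity>]\<close>-valued functions, and
  \<open>K\<^sup>n(x, A)\<close> is \<open>kpow K n (indicator A) x\<close>.
\<close>

definition kapply :: "('a \<Rightarrow> 'a measure) \<Rightarrow> ('a \<Rightarrow> ennreal) \<Rightarrow> 'a \<Rightarrow> ennreal" where
  "kapply K f x = (\<integral>\<^sup>+ y. f y \<partial>K x)"

definition kpow :: "('a \<Rightarrow> 'a measure) \<Rightarrow> nat \<Rightarrow> ('a \<Rightarrow> ennreal) \<Rightarrow> 'a \<Rightarrow> ennreal" where
  "kpow K n f = (kapply K ^^ n) f"

definition resolvent :: "('a \<Rightarrow> 'a measure) \<Rightarrow> real \<Rightarrow> ('a \<Rightarrow> ennreal) \<Rightarrow> 'a \<Rightarrow> ennreal" where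
  "resolvent K l f x = (\<Sum>k. ennreal (1 / l ^ (k + 1)) * kpow K k f x)"

definition ln_ennreal :: "ennreal \<Rightarrow> ereal" where
  "ln_ennreal z = (if z = 0 then -\<infinity> else if z = \<infinity> then \<infinity> else ereal (ln (enn2real z)))"


section \<open>The Markov chain\<close>

definition transition_kernel :: "('a::polish_space \<Rightarrow> 'a measure) \<Rightarrow> bool" where
  "transition_kernel P \<longleftrightarrow> P \<in> borel \<rightarrow>\<^sub>M prob_algebra borel"

text \<open>
  The law on path space of the chain with transition kernel \<open>P\<close> and \<open>\<Phi>(0) = x\<close>, given by the
  Ionescu-Tulcea theorem; \<open>\<Phi>(t)\<close> is the coordinate map \<open>\<omega> \<mapsto> \<omega> t\<close>.
\<close>

definition chain_step :: "('a::polish_space \<Rightarrow> 'a measure) \<Rightarrow> 'a \<Rightarrow> nat \<Rightarrow> (nat \<Rightarrow> 'a) \<Rightarrow> 'a measure" where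
  "chain_step P x i \<omega> = (case i of 0 \<Rightarrow> return borel x | Suc j \<Rightarrow> P (\<omega> j))"

definition path_law :: "('a::polish_space \<Rightarrow> 'a measure) \<Rightarrow> 'a \<Rightarrow> (nat \<Rightarrow> 'a) measure" where
  "path_law P x =
     projective_family.lim UNIV (Ionescu_Tulcea.CI (chain_step P x) (\<lambda>_. borel)) (\<lambda>_. borel)"

lemma Ionescu_Tulcea_chain_step:
  assumes P: "transition_kernel P"
  shows "Ionescu_Tulcea (chain_step P x) (\<lambda>_. borel)"
proof (rule Ionescu_Tulcea.intro)
  have Pm: "P \<in> borel \<rightarrow>\<^sub>M subprob_algebra borel"
    using P unfolding transition_kernel_def by (rule measurable_prob_algebraD)
  show "chain_step P x i \<in> Pi\<^sub>M {0..<i} (\<lambda>_. borel) \<rightarrow>\<^sub>M subprob_algebra borel" for i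
  proof (cases i)
    case 0
    have "return borel x \<in> space (subprob_algebra borel)"
      using measurable_space[OF return_measurable, of x borel] by simp
    then show ?thesis using 0 by (auto simp: chain_step_def[abs_def])
  next
    case (Suc j)
    have "(\<lambda>\<omega>. \<omega> j) \<in> Pi\<^sub>M {0..<i} (\<lambda>_. borel) \<rightarrow>\<^sub>M (borel :: 'a measure)"
      using Suc by (intro measurable_component_singleton) auto
    from measurable_compose[OF this Pm] show ?thesis
      using Suc by (simp add: chain_step_def[abs_def])
  qed
  show "prob_space (chain_step P x i \<omega>)" for i \<omega>
    using P measurable_space[of P borel "prob_algebra borel"]
    by (auto simp: chain_step_def transition_kernel_def space_prob_algebra prob_space_return split: nat.split)
qed

definition return_time :: "'a set \<Rightarrow> (nat \<Rightarrow> 'a) \<Rightarrow> enat" where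
  "return_time A \<omega> = Inf (enat ` {t. 1 \<le> t \<and> \<omega> t \<in> A})"

text \<open>
  Nontriviality of \<open>\<psi>\<close> is part of the usual convention; without it \<open>\<psi> = 0\<close> would qualify.
\<close>

definition irreducible_aperiodic :: "('a::polish_space \<Rightarrow> 'a measure) \<Rightarrow> 'a measure \<Rightarrow> bool" where
  "irreducible_aperiodic P \<psi> \<longleftrightarrow>
     sets \<psi> = sets borel \<and> sigma_finite_measure \<psi> \<and> emeasure \<psi> UNIV \<noteq> 0 \<and>
     (\<forall>A\<in>sets borel. 0 < emeasure \<psi> A \<longrightarrow>
        (\<forall>x. \<exists>t0. \<forall>t\<ge>t0. 0 < kpow P t (indicator A) x))"

definition maximal_irreducibility_measure ::
    "('a::polish_space \<Rightarrow> 'a measure) \<Rightarrow> 'a measure \<Rightarrow> bool" where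
  "maximal_irreducibility_measure P \<psi> \<longleftrightarrow>
     irreducible_aperiodic P \<psi> \<and>
     (\<forall>\<phi>. irreducible_aperiodic P \<phi> \<longrightarrow> absolutely_continuous \<psi> \<phi>)"

text \<open>The measure \<open>m\<close> on \<open>{0,1,2,\<dots>}\<close> is given by its (finite) point masses.\<close>

definition small_set :: "('a::polish_space \<Rightarrow> 'a measure) \<Rightarrow> 'a set \<Rightarrow> bool" where
  "small_set P C \<longleftrightarrow> C \<in> sets borel \<and>
     (\<exists>\<epsilon>>0. \<exists>\<nu>\<in>space (prob_algebra borel). \<exists>m::nat \<Rightarrow> real.
        (\<forall>t. 0 \<le> m t) \<and> summable (\<lambda>t. real t * m t) \<and>
        (\<forall>x. \<forall>A\<in>sets borel.
           ennreal \<epsilon> * indicator C x * emeasure \<nu> A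
             \<le> (\<Sum>t. kpow P t (indicator A) x * ennreal (m t))))"

definition nonlinear_generator :: "('a \<Rightarrow> 'a measure) \<Rightarrow> ('a \<Rightarrow> real) \<Rightarrow> 'a \<Rightarrow> ereal" where
  "nonlinear_generator P G x =
     ln_ennreal (ennreal (exp (- G x)) * kapply P (\<lambda>y. ennreal (exp (G y))) x)"

text \<open>Here \<open>V\<close> is everywhere finite, so that \<open>{V < \<infinity>}\<close> is the whole space.\<close>

definition DV3 :: "('a::polish_space \<Rightarrow> 'a measure) \<Rightarrow> ('a \<Rightarrow> real) \<Rightarrow> ('a \<Rightarrow> real) \<Rightarrow> bool" where
  "DV3 P V W \<longleftrightarrow>
     W \<in> borel_measurable borel \<and> (\<forall>x. 1 \<le> W x) \<and>
     (\<exists>C \<delta> b. small_set P C \<and> 0 < \<delta> \<and>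
        (\<forall>x. nonlinear_generator P V x \<le> ereal (- \<delta> * W x + b * indicator C x)))"

definition sublevel :: "('a \<Rightarrow> real) \<Rightarrow> real \<Rightarrow> 'a set" where
  "sublevel W r = {y. W y \<le> r}"

definition DV3_plus ::
    "('a::polish_space \<Rightarrow> 'a measure) \<Rightarrow> 'a measure \<Rightarrow> ('a \<Rightarrow> real) \<Rightarrow> ('a \<Rightarrow> real) \<Rightarrow> bool" where
  "DV3_plus P \<psi> V W \<longleftrightarrow>
     maximal_irreducibility_measure P \<psi> \<and>
     V \<in> borel_measurable borel \<and> (\<forall>x. 1 \<le> V x) \<and> DV3 P V W \<and>
     (\<exists>T0::nat. 0 < T0 \<and>
        (\<forall>r::real. ereal r < (SUP x. ereal (W x)) \<longrightarrow>
           (\<exists>\<beta>::'a measure. sets \<beta> = sets borel \<and>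
              (\<integral>\<^sup>+ y. ennreal (exp (V y)) \<partial>\<beta>) < \<infinity> \<and>
              (\<forall>x\<in>sublevel W r. \<forall>A\<in>sets borel.
                 emeasure (path_law P x)
                   {\<omega>. \<omega> T0 \<in> A \<and> enat T0 < return_time (- sublevel W r) \<omega>}
                 \<le> emeasure \<beta> A))))"


section \<open>Generalized principal eigenvalue\<close>

text \<open>
  The condition that the resolvent \<open>\<Sum>\<^sub>k l\<^sup>-\<^sup>k\<^sup>-\<^sup>1 K\<^sup>k(x,\<cdot>)\<close> be \<open>\<sigma>\<close>-finite for \<open>\<psi>\<close>-almost every \<open>x\<close> is the
  requirement that the series define a proper kernel.  It cannot be dropped: for \<open>l\<close> below the
  principal eigenvalue the series is \<open>\<infinity>\<close> on every set of positive \<open>\<psi>\<close>-measure, so every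
  \<open>s \<ge> 0\<close> would be small (with \<open>\<nu>\<close> equivalent to \<open>\<psi>\<close>), including functions whose resolvent is
  infinite for all \<open>l\<close>, and no number would have the property defining the eigenvalue.
\<close>

definition small_function ::
    "'a::polish_space measure \<Rightarrow> ('a \<Rightarrow> 'a measure) \<Rightarrow> ('a \<Rightarrow> real) \<Rightarrow> bool" where
  "small_function \<psi> K s \<longleftrightarrow>
     s \<in> borel_measurable borel \<and> (\<forall>x. 0 \<le> s x) \<and> 0 < (\<integral>\<^sup>+ x. ennreal (s x) \<partial>\<psi>) \<and>
     (\<exists>l>0. \<exists>\<nu>. sets \<nu> = sets borel \<and> emeasure \<nu> UNIV \<noteq> 0 \<and>
        (AE x in \<psi>. \<exists>B::nat \<Rightarrow> 'a set. (\<forall>n. B n \<in> sets borel) \<and> (\<Union>n. B n) = UNIV \<and>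
           (\<forall>n. resolvent K l (indicator (B n)) x < \<infinity>)) \<and>
        (\<forall>x. \<forall>A\<in>sets borel.
           ennreal (s x) * emeasure \<nu> A \<le> resolvent K l (indicator A) x))"

definition principal_eigenvalue ::
    "'a::polish_space measure \<Rightarrow> ('a \<Rightarrow> 'a measure) \<Rightarrow> ennreal" where
  "principal_eigenvalue \<psi> K = (THE L. 0 < L \<and>
     (\<forall>s. small_function \<psi> K s \<longrightarrow>
        (\<forall>l>0. ennreal l < L \<longrightarrow> (\<forall>x. resolvent K l (\<lambda>y. ennreal (s y)) x = \<infinity>)) \<and>
        (\<forall>l. L < ennreal l \<longrightarrow> (AE x in \<psi>. resolvent K l (\<lambda>y. ennreal (s y)) x < \<infinity>))))"

definition scaled_kernel ::
    "('a::polish_space \<Rightarrow> 'a measure) \<Rightarrow> ('a \<times> 'a \<Rightarrow> real) \<Rightarrow> 'a \<Rightarrow> 'a measure" where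
  "scaled_kernel P M x = density (P x) (\<lambda>y. ennreal (exp (M (x, y))))"

definition Lam ::
    "('a::polish_space \<Rightarrow> 'a measure) \<Rightarrow> 'a measure \<Rightarrow> ('a \<times> 'a \<Rightarrow> real) \<Rightarrow> ereal" where
  "Lam P \<psi> M = ln_ennreal (principal_eigenvalue \<psi> (scaled_kernel P M))"


section \<open>Weighted spaces of functions and of signed measures\<close>

definition weighted_Linf :: "('a::polish_space \<Rightarrow> real) \<Rightarrow> ('a \<Rightarrow> real) set" where
  "weighted_Linf W = {g \<in> borel_measurable borel. (SUP x. ennreal (\<bar>g x\<bar> / W x)) < \<infinity>}"

definition admissible_weight :: "('a::polish_space \<Rightarrow> real) \<Rightarrow> ('a \<Rightarrow> real) \<Rightarrow> bool" where
  "admissible_weight W W0 \<longleftrightarrow>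
     (\<forall>x. 1 \<le> W0 x) \<and> W0 \<in> weighted_Linf W \<and>
     ((\<lambda>r::real. SUP x. ennreal (W0 x / W x * indicator {x. r < W x} x)) \<longlongrightarrow> 0) at_top"

definition weighted_Linf2 :: "('a::polish_space \<Rightarrow> real) \<Rightarrow> ('a \<times> 'a \<Rightarrow> real) set" where
  "weighted_Linf2 W0 = {M \<in> borel_measurable borel.
     (SUP (x, y). ennreal (\<bar>M (x, y)\<bar> / (W0 x + W0 y))) < \<infinity>}"

text \<open>
  Real-valued signed measures on \<open>(space N, sets N)\<close>, as set functions that vanish by convention
  outside \<open>sets N\<close>.  A finite measure \<open>\<mu>\<close> is regarded as the signed measure \<open>measure \<mu>\<close>.
\<close>

definition signed_measure :: "'b measure \<Rightarrow> ('b set \<Rightarrow> real) \<Rightarrow> bool" where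
  "signed_measure N \<gamma> \<longleftrightarrow>
     (\<forall>A. A \<notin> sets N \<longrightarrow> \<gamma> A = 0) \<and> \<gamma> {} = 0 \<and>
     (\<forall>A::nat \<Rightarrow> 'b set. range A \<subseteq> sets N \<longrightarrow> disjoint_family A \<longrightarrow>
        (\<lambda>i. \<gamma> (A i)) sums \<gamma> (\<Union>i. A i))"

text \<open>
  The positive part of the Jordan decomposition; the negative part is \<open>upper_variation N (- \<gamma>)\<close>.
\<close>

definition upper_variation :: "'b measure \<Rightarrow> ('b set \<Rightarrow> real) \<Rightarrow> 'b measure" where
  "upper_variation N \<gamma> =
     measure_of (space N) (sets N) (\<lambda>A. SUP B\<in>{B \<in> sets N. B \<subseteq> A}. ennreal (\<gamma> B))"

definition signed_integral :: "'b measure \<Rightarrow> ('b set \<Rightarrow> real) \<Rightarrow> ('b \<Rightarrow> real) \<Rightarrow> real" where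
  "signed_integral N \<gamma> f =
     (\<integral>z. f z \<partial>upper_variation N \<gamma>) - (\<integral>z. f z \<partial>upper_variation N (\<lambda>A. - \<gamma> A))"

text \<open>\<open>\<integral> [W\<^sub>0(x) + W\<^sub>0(y)] |\<Gamma>|(dx,dy)\<close>, with \<open>|\<Gamma>|\<close> the sum of the positive and negative parts.\<close>

definition weighted_norm ::
    "('a::polish_space \<Rightarrow> real) \<Rightarrow> (('a \<times> 'a) set \<Rightarrow> real) \<Rightarrow> ennreal" where
  "weighted_norm W0 \<gamma> =
     (\<integral>\<^sup>+ (x, y). ennreal (W0 x + W0 y) \<partial>upper_variation borel \<gamma>) +
     (\<integral>\<^sup>+ (x, y). ennreal (W0 x + W0 y) \<partial>upper_variation borel (\<lambda>A. - \<gamma> A))"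

definition weighted_measures ::
    "('a::polish_space \<Rightarrow> real) \<Rightarrow> (('a \<times> 'a) set \<Rightarrow> real) set" where
  "weighted_measures W0 = {\<gamma>. signed_measure borel \<gamma> \<and> weighted_norm W0 \<gamma> < \<infinity>}"

definition Lam_star ::
    "('a::polish_space \<Rightarrow> 'a measure) \<Rightarrow> 'a measure \<Rightarrow> ('a \<Rightarrow> real) \<Rightarrow>
     (('a \<times> 'a) set \<Rightarrow> real) \<Rightarrow> ereal" where
  "Lam_star P \<psi> W0 \<gamma> =
     (SUP M\<in>weighted_Linf2 W0. ereal (signed_integral borel \<gamma> M) - Lam P \<psi> M)"


section \<open>Marginals, composition and relative entropy\<close>

definition marginal1 :: "('a::polish_space \<times> 'a) measure \<Rightarrow> 'a measure" where
  "marginal1 \<Gamma> = distr \<Gamma> borel fst"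

definition marginal2 :: "('a::polish_space \<times> 'a) measure \<Rightarrow> 'a measure" where
  "marginal2 \<Gamma> = distr \<Gamma> borel snd"

text \<open>\<open>[\<mu> \<odot> K](dx,dy) = \<mu>(dx) K(x,dy)\<close>.\<close>

definition odot ::
    "'a::polish_space measure \<Rightarrow> ('a \<Rightarrow> 'a measure) \<Rightarrow> ('a \<times> 'a) measure" where
  "odot \<mu> K = \<mu> \<bind> (\<lambda>x. K x \<bind> (\<lambda>y. return borel (x, y)))"

text \<open>
  For probability measures the negative part of \<open>log (d\<Gamma>/d\<mu>)\<close> is always \<open>\<Gamma>\<close>-integrable when
  \<open>\<Gamma> \<lless> \<mu>\<close>, so non-integrability means that the integral is \<open>+\<infinity>\<close>.
\<close>

definition relative_entropy :: "'b measure \<Rightarrow> 'b measure \<Rightarrow> ereal" where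
  "relative_entropy \<Gamma> \<mu> =
     (if absolutely_continuous \<mu> \<Gamma> \<and> integrable \<Gamma> (entropy_density (exp 1) \<mu> \<Gamma>)
      then ereal (KL_divergence (exp 1) \<mu> \<Gamma>) else \<infinity>)"

end

theory Submission
  imports Defs
begin

text \<open>
  Every estimate goes through one-sided bounds for \<open>\<Lambda>\<close>.  Write \<open>P\<^sub>m = e\<^sup>M P\<close>.  If a function
  \<open>g \<ge> \<eta> > 0\<close>, finite at one point, satisfies \<open>P\<^sub>m g \<le> \<rho> g\<close>, then for \<open>\<lambda> > \<rho>\<close> the resolvent of \<open>P\<^sub>m\<close> is
  finite on bounded functions at that point, so \<open>\<Lambda>(M) \<le> log \<rho>\<close> (\<open>Lam_le\<close>).  Conversely, for
  \<open>\<lambda> > exp \<Lambda>(M)\<close> the resolvent \<open>u\<close> of a small function is a strictly positive solution of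
  \<open>P\<^sub>m u \<le> \<lambda> u\<close> that is finite somewhere (\<open>Lam_supersolution\<close>); for \<open>\<lambda>\<close> close to the eigenvalue such
  supersolutions play the part of an eigenfunction.

  Both facts presuppose that the eigenvalue is well defined, and this is where most of the work lies.
  Uniqueness of the number in its definition, and the independence of the small function that is
  behind its existence, follow from resolvent inequalities (\<open>principal_eigenvalue\<close>), but only once
  at least one small function is known to exist.  The drift inequality with \<open>g = exp (V - c W\<^sub>0)\<close>
  makes the resolvent of \<open>P\<^sub>m\<close> finite for large \<open>\<lambda>\<close>.  The small set \<open>C\<close> of the drift condition
  gives a minorization for a combination of powers of \<open>P\<close>; since \<open>e\<^sup>M\<close> is not bounded away from \<open>0\<close>,
  this passes to \<open>P\<^sub>m\<close> only after confining paths to a sublevel set of \<open>W\<^sub>0\<close> and to finitely many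
  steps, which costs a small error in total variation.  Two consecutive steps of the truncated kernel absorb this error
  (\<open>two_step_minorization\<close>) and give a small function of \<open>P\<^sub>m\<close>
  (\<open>ex_small_function_scaled_kernel\<close>).

  Let now \<open>\<Gamma>\<close> be a probability measure with \<open>\<Lambda>\<^sup>*(\<Gamma>) = S < \<infinity>\<close> and first marginal \<open>\<pi>\<close>, so that
  \<open>\<langle>\<Gamma>, M\<rangle> \<le> S\<close> whenever \<open>\<Lambda>(M) \<le> 0\<close>.  Three families of \<open>M\<close> are used.  For
  \<open>M(x,y) = n (1\<^sub>A(y) - 1\<^sub>A(x))\<close> take \<open>g = exp (- n 1\<^sub>A)\<close>; as \<open>n\<close> is arbitrary, the marginals agree.
  For bounded \<open>f\<close> and \<open>M(x,y) = f(x,y) - log \<integral>exp f(x,z) P(x,dz)\<close> the kernel \<open>P\<^sub>m\<close> is stochastic and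
  \<open>g = 1\<close>; by Jensen \<open>\<langle>\<Gamma>, f\<rangle> \<le> S + log \<integral>exp f d(\<pi> \<odot> P)\<close>, and the Donsker-Varadhan formula gives
  \<open>\<Gamma> \<lless> \<pi> \<odot> P\<close> and \<open>H(\<Gamma> \<parallel> \<pi> \<odot> P) \<le> S\<close>.  The density of \<open>\<Gamma>\<close> then also yields the kernel \<open>Q\<close>.
  Finally, if \<open>F\<close> is absorbing and nonempty, then \<open>M(x,y) = n\<close> for \<open>x \<notin> F\<close> and \<open>M(x,y) = 0\<close> for
  \<open>x \<in> F\<close>, with \<open>g = 1\<close> on \<open>F\<close> and \<open>g = \<infinity>\<close> off \<open>F\<close>, show that \<open>\<pi>\<close> is carried by \<open>F\<close>.

  For the inequality \<open>S \<le> H\<close> take \<open>u\<close> as above.  The set \<open>{u < \<infinity>}\<close> is absorbing, hence carries \<open>\<pi>\<close>,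
  and \<open>exp (M(x,y) + log u(y) - log u(x) - log \<lambda>)\<close> has \<open>\<pi> \<odot> P\<close>-integral at most \<open>1\<close>, so the
  \<open>\<Gamma>\<close>-integral of the exponent is at most \<open>H\<close>.  The difference \<open>log u(y) - log u(x)\<close> integrates to
  \<open>0\<close> because the marginals agree, even when \<open>log u\<close> is not integrable
  (\<open>integral_diff_same_distribution\<close>).

  For the boundedness of the level sets, the weighted norm of a signed measure is its pairing with
  \<open>\<plusminus>(W\<^sub>0(x) + W\<^sub>0(y))\<close>, with signs given by a Hahn decomposition, and the drift bounds \<open>\<Lambda>\<close> on all
  such functions by one constant.
\<close>

section \<open>Normal functionals and operators\<close>

text \<open>
  Normal functionals are the integrals against arbitrary, not necessarily \<open>\<sigma>\<close>-finite, Borel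
  measures, described by additivity, homogeneity and monotone continuity. In this form they
  are visibly stable under composition with kernels and under countable sums, which is what
  powers and resolvents need.
\<close>

definition normal_functional :: "(('b::topological_space \<Rightarrow> ennreal) \<Rightarrow> ennreal) \<Rightarrow> bool" where
  "normal_functional F \<longleftrightarrow>
     (\<forall>f\<in>borel_measurable borel. \<forall>g\<in>borel_measurable borel. F (\<lambda>x. f x + g x) = F f + F g) \<and>
     (\<forall>f\<in>borel_measurable borel. \<forall>c. F (\<lambda>x. c * f x) = c * F f) \<and>
     (\<forall>f. (\<forall>i::nat. f i \<in> borel_measurable borel) \<longrightarrow> incseq f \<longrightarrow>
        F (\<lambda>x. SUP i. f i x) = (SUP i. F (f i)))"

lemma normal_functional_add:
  "normal_functional F \<Longrightarrow> f \<in> borel_measurable borel \<Longrightarrow> g \<in> borel_measurable borel \<Longrightarrow>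
     F (\<lambda>x. f x + g x) = F f + F g"
  by (simp add: normal_functional_def)

lemma normal_functional_cmult:
  "normal_functional F \<Longrightarrow> f \<in> borel_measurable borel \<Longrightarrow> F (\<lambda>x. c * f x) = c * F f"
  by (simp add: normal_functional_def)

lemma normal_functional_SUP:
  "normal_functional F \<Longrightarrow> (\<And>i::nat. f i \<in> borel_measurable borel) \<Longrightarrow> incseq f \<Longrightarrow>
     F (\<lambda>x. SUP i. f i x) = (SUP i. F (f i))"
  by (simp add: normal_functional_def)

lemma normal_functional_zero:
  assumes "normal_functional F"
  shows "F (\<lambda>x. 0) = 0"
  using normal_functional_cmult[OF assms, of "\<lambda>_. 0" 0] by simp

lemma normal_functional_mono:
  assumes F: "normal_functional F"
    and [measurable]: "f \<in> borel_measurable borel" "g \<in> borel_measurable borel"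
    and le: "\<And>x. f x \<le> g x"
  shows "F f \<le> F g"
proof -
  have "g = (\<lambda>x. f x + (g x - f x))"
    using le by (auto simp: add_diff_inverse_ennreal)
  then have "F g = F f + F (\<lambda>x. g x - f x)"
    using normal_functional_add[OF F, of f "\<lambda>x. g x - f x"] by simp
  then show ?thesis by simp
qed

lemma normal_functional_sum:
  fixes f :: "nat \<Rightarrow> 'b::topological_space \<Rightarrow> ennreal"
  assumes F: "normal_functional F"
    and [measurable]: "\<And>i. f i \<in> borel_measurable borel"
  shows "F (\<lambda>x. \<Sum>i<n. f i x) = (\<Sum>i<n. F (f i))"
proof (induction n)
  case 0
  show ?case using normal_functional_zero[OF F] by simp
next
  case (Suc n)
  then show ?case using normal_functional_add[OF F, of "\<lambda>x. \<Sum>i<n. f i x" "f n"] by simp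
qed

lemma normal_functional_suminf:
  fixes f :: "nat \<Rightarrow> 'b::topological_space \<Rightarrow> ennreal"
  assumes F: "normal_functional F"
    and [measurable]: "\<And>i. f i \<in> borel_measurable borel"
  shows "F (\<lambda>x. \<Sum>i. f i x) = (\<Sum>i. F (f i))"
proof -
  have inc: "incseq (\<lambda>n x. \<Sum>i<n. f i x)"
    by (intro incseq_SucI le_funI) simp
  have "F (\<lambda>x. \<Sum>i. f i x) = F (\<lambda>x. SUP n. \<Sum>i<n. f i x)"
    by (simp add: suminf_eq_SUP)
  also have "\<dots> = (SUP n. F (\<lambda>x. \<Sum>i<n. f i x))"
    by (intro normal_functional_SUP[OF F] inc) measurable
  also have "\<dots> = (\<Sum>i. F (f i))"
    by (simp add: normal_functional_sum[OF F] suminf_eq_SUP)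
  finally show ?thesis .
qed

lemma indicator_empty: "indicator {} = (\<lambda>x. 0)"
  by auto

text \<open>
  The set function \<open>F(1\<^sub>A)\<close> is countably additive, and both sides are determined by their
  values on indicators through monotone limits of simple functions.
\<close>

lemma normal_functional_measure:
  fixes F :: "('b::topological_space \<Rightarrow> ennreal) \<Rightarrow> ennreal"
  assumes F: "normal_functional F"
  obtains \<mu> where "sets \<mu> = sets borel"
    "\<And>f. f \<in> borel_measurable borel \<Longrightarrow> (\<integral>\<^sup>+ x. f x \<partial>\<mu>) = F f"
proof -
  define \<mu> where "\<mu> = measure_of UNIV (sets (borel :: 'b measure)) (\<lambda>A. F (indicator A))"
  have sets [measurable_cong]: "sets \<mu> = sets borel"
    unfolding \<mu>_def using sets.sigma_sets_eq[of borel] by (simp add: sets_measure_of)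
  have em: "emeasure \<mu> A = F (indicator A)" if A: "A \<in> sets borel" for A
  proof (rule emeasure_measure_of[OF \<mu>_def])
    show "A \<in> sets \<mu>" using A sets by simp
    show "positive (sets \<mu>) (\<lambda>A. F (indicator A))"
      using normal_functional_zero[OF F] by (simp add: positive_def indicator_empty)
    show "countably_additive (sets \<mu>) (\<lambda>A. F (indicator A))"
    proof (rule countably_additiveI)
      fix B :: "nat \<Rightarrow> 'b set"
      assume "range B \<subseteq> sets \<mu>" and disj: "disjoint_family B"
      then have [measurable]: "B i \<in> sets borel" for i using sets by auto
      have "(\<lambda>x. \<Sum>i. indicator (B i) x :: ennreal) = indicator (\<Union>i. B i)"
        using suminf_indicator[OF disj] by auto
      then show "(\<Sum>i. F (indicator (B i))) = F (indicator (\<Union>i. B i))"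
        using normal_functional_suminf[OF F, of "\<lambda>i. indicator (B i)"] by simp
    qed
  qed auto
  have "(\<integral>\<^sup>+ x. f x \<partial>\<mu>) = F f" if "f \<in> borel_measurable borel" for f
    using that
  proof (induction rule: borel_measurable_induct)
    case (cong f g)
    then have "f = g" by auto
    with cong show ?case by simp
  next
    case (set A)
    then show ?case using em[of A] sets by simp
  next
    case (mult u c)
    then have [measurable]: "u \<in> borel_measurable borel" by simp
    show ?case using mult normal_functional_cmult[OF F, of u c] by (simp add: nn_integral_cmult)
  next
    case (add u v)
    then have [measurable]: "u \<in> borel_measurable borel" "v \<in> borel_measurable borel" by simp_all
    show ?case using add normal_functional_add[OF F, of v u] by (simp add: nn_integral_add)
  next
    case (seq U)
    then have [measurable]: "U i \<in> borel_measurable borel" for i by simp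
    have eq: "(SUP i. U i) = (\<lambda>x. SUP i. U i x)" by (auto simp: fun_eq_iff image_comp)
    show ?case unfolding eq
      using seq normal_functional_SUP[OF F, of U]
      by (simp add: nn_integral_monotone_convergence_SUP)
  qed
  with sets show ?thesis by (rule that)
qed

lemma normal_functional_nn_integral:
  assumes [measurable_cong]: "sets \<mu> = sets borel"
  shows "normal_functional (\<lambda>f. \<integral>\<^sup>+ x. f x \<partial>\<mu>)"
  unfolding normal_functional_def
  by (auto simp: nn_integral_add nn_integral_cmult measurable_cong_sets[OF assms refl]
      intro!: nn_integral_monotone_convergence_SUP)

text \<open>
  A minorization on sets, such as the one in the definition of small functions, is turned
  here into a minorization on functions.
\<close>

lemma normal_functional_le_nn_integral:
  assumes F: "normal_functional F" and \<mu>: "sets \<mu> = sets borel"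
    and le: "\<And>A. A \<in> sets borel \<Longrightarrow> c * emeasure \<mu> A \<le> F (indicator A)"
    and f: "f \<in> borel_measurable borel"
  shows "c * (\<integral>\<^sup>+ x. f x \<partial>\<mu>) \<le> F f"
proof -
  obtain \<kappa> where \<kappa>: "sets \<kappa> = sets borel"
      "\<And>f. f \<in> borel_measurable borel \<Longrightarrow> (\<integral>\<^sup>+ x. f x \<partial>\<kappa>) = F f"
    using normal_functional_measure[OF F] by blast
  have "scale_measure c \<mu> \<le> \<kappa>"
  proof (subst le_measure)
    show "sets (scale_measure c \<mu>) = sets \<kappa>" using \<kappa> \<mu> by simp
    show "\<forall>A\<in>sets (scale_measure c \<mu>). emeasure (scale_measure c \<mu>) A \<le> emeasure \<kappa> A"
    proof
      fix A assume "A \<in> sets (scale_measure c \<mu>)"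
      then have A: "A \<in> sets borel" using \<mu> by simp
      then have "emeasure \<kappa> A = F (indicator A)"
        using \<kappa>(1) \<kappa>(2)[of "indicator A"] by (simp add: nn_integral_indicator)
      with le[OF A] show "emeasure (scale_measure c \<mu>) A \<le> emeasure \<kappa> A" by simp
    qed
  qed
  then have "(\<integral>\<^sup>+ x. f x \<partial>scale_measure c \<mu>) \<le> (\<integral>\<^sup>+ x. f x \<partial>\<kappa>)"
    using \<kappa> \<mu> by (intro nn_integral_mono_measure) auto
  moreover have "f \<in> borel_measurable \<mu>"
    using f by (simp add: measurable_cong_sets[OF \<mu> refl])
  ultimately show ?thesis using \<kappa>(2)[OF f] by (simp add: nn_integral_scale_measure)
qed

definition normal_operator ::
    "(('b::topological_space \<Rightarrow> ennreal) \<Rightarrow> 'b \<Rightarrow> ennreal) \<Rightarrow> bool" where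
  "normal_operator T \<longleftrightarrow>
     (\<forall>f\<in>borel_measurable borel. T f \<in> borel_measurable borel) \<and>
     (\<forall>x. normal_functional (\<lambda>f. T f x))"

lemma normal_operatorD:
  assumes "normal_operator T"
  shows normal_operator_measurable: "f \<in> borel_measurable borel \<Longrightarrow> T f \<in> borel_measurable borel"
    and normal_operator_functional: "normal_functional (\<lambda>f. T f x)"
  using assms by (auto simp: normal_operator_def)

lemma normal_operator_cmult:
  assumes "normal_operator T" "f \<in> borel_measurable borel"
  shows "T (\<lambda>x. c * f x) = (\<lambda>x. c * T f x)"
  using normal_functional_cmult[OF normal_operator_functional[OF assms(1)] assms(2)] by auto

lemma normal_functional_operator:
  assumes F: "normal_functional F" and T: "normal_operator T"
  shows "normal_functional (\<lambda>f. F (T f))"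
proof -
  note [measurable] = normal_operator_measurable[OF T]
  have add: "T (\<lambda>x. f x + g x) = (\<lambda>x. T f x + T g x)"
    if "f \<in> borel_measurable borel" "g \<in> borel_measurable borel" for f g
    using normal_functional_add[OF normal_operator_functional[OF T]] that by auto
  have cmult: "T (\<lambda>x. c * f x) = (\<lambda>x. c * T f x)"
    if "f \<in> borel_measurable borel" for f c
    using normal_functional_cmult[OF normal_operator_functional[OF T]] that by auto
  have SUP: "T (\<lambda>x. SUP i. f i x) = (\<lambda>x. SUP i. T (f i) x)"
    if "\<And>i::nat. f i \<in> borel_measurable borel" "incseq f" for f
    using normal_functional_SUP[OF normal_operator_functional[OF T]] that by auto
  have inc: "incseq (\<lambda>i. T (f i))" if "\<And>i::nat. f i \<in> borel_measurable borel" "incseq f" for f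
  proof (intro incseq_SucI le_funI)
    show "T (f i) x \<le> T (f (Suc i)) x" for i x
      using that by (intro normal_functional_mono[OF normal_operator_functional[OF T]])
        (auto simp: incseq_Suc_iff le_fun_def)
  qed
  show ?thesis
    unfolding normal_functional_def
  proof (intro conjI ballI allI impI)
    fix f :: "nat \<Rightarrow> 'a \<Rightarrow> ennreal"
    assume "\<forall>i. f i \<in> borel_measurable borel" "incseq f"
    then show "F (T (\<lambda>x. SUP i. f i x)) = (SUP i. F (T (f i)))"
      using normal_functional_SUP[OF F, of "\<lambda>i. T (f i)"] SUP[of f] inc[of f]
        normal_operator_measurable[OF T] by simp
  qed (simp_all add: add cmult normal_functional_add[OF F] normal_functional_cmult[OF F]
      normal_operator_measurable[OF T])
qed

lemma normal_operator_id: "normal_operator (\<lambda>f. f)"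
  by (auto simp: normal_operator_def normal_functional_def)

lemma normal_operator_comp:
  assumes S: "normal_operator S" and T: "normal_operator T"
  shows "normal_operator (\<lambda>f. S (T f))"
  using normal_functional_operator[OF normal_operator_functional[OF S] T] S T
  by (auto simp: normal_operator_def)

lemma normal_operator_kpow:
  assumes K: "normal_operator (kapply K)"
  shows "normal_operator (kpow K n)"
proof (induction n)
  case 0
  show ?case using normal_operator_id by (simp add: kpow_def[abs_def])
next
  case (Suc n)
  have "kpow K (Suc n) = (\<lambda>f. kapply K (kpow K n f))"
    by (auto simp: kpow_def)
  with normal_operator_comp[OF K Suc] show ?case by simp
qed

lemma normal_functional_weighted_suminf:
  fixes F :: "nat \<Rightarrow> ('b::topological_space \<Rightarrow> ennreal) \<Rightarrow> ennreal"
  assumes F: "\<And>k. normal_functional (F k)"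
  shows "normal_functional (\<lambda>f. \<Sum>k. c k * F k f)"
  unfolding normal_functional_def
proof (intro conjI ballI allI impI)
  fix f g :: "'b \<Rightarrow> ennreal" and a
  assume "f \<in> borel_measurable borel"
  then show "(\<Sum>k. c k * F k (\<lambda>x. a * f x)) = a * (\<Sum>k. c k * F k f)"
    by (simp add: normal_functional_cmult[OF F] mult.left_commute[of _ a] ennreal_suminf_cmult)
  assume "g \<in> borel_measurable borel"
  with \<open>f \<in> _\<close> show "(\<Sum>k. c k * F k (\<lambda>x. f x + g x)) = (\<Sum>k. c k * F k f) + (\<Sum>k. c k * F k g)"
    by (simp add: normal_functional_add[OF F] distrib_left suminf_add[OF summableI summableI])
next
  fix f :: "nat \<Rightarrow> 'b \<Rightarrow> ennreal"
  assume f: "\<forall>i. f i \<in> borel_measurable borel" "incseq f"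
  have "incseq (\<lambda>i. c k * F k (f i))" for k
  proof (rule incseq_SucI)
    show "c k * F k (f i) \<le> c k * F k (f (Suc i))" for i
      using f by (intro mult_left_mono normal_functional_mono[OF F])
        (auto simp: incseq_Suc_iff le_fun_def)
  qed
  then show "(\<Sum>k. c k * F k (\<lambda>x. SUP i. f i x)) = (SUP i. \<Sum>k. c k * F k (f i))"
    using f by (simp add: normal_functional_SUP[OF F] SUP_mult_left_ennreal ennreal_suminf_SUP_eq)
qed

lemma normal_operator_resolvent:
  assumes K: "normal_operator (kapply K)"
  shows "normal_operator (resolvent K l)"
  unfolding normal_operator_def
proof (intro conjI ballI allI)
  note [measurable] = normal_operator_measurable[OF normal_operator_kpow[OF K]]
  fix f :: "'a \<Rightarrow> ennreal" assume [measurable]: "f \<in> borel_measurable borel"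
  show "resolvent K l f \<in> borel_measurable borel"
    unfolding resolvent_def[abs_def] by measurable
next
  show "normal_functional (\<lambda>f. resolvent K l f x)" for x
    unfolding resolvent_def
    by (intro normal_functional_weighted_suminf normal_operator_functional normal_operator_kpow K)
qed

section \<open>Resolvents\<close>

lemma kpow_0 [simp]: "kpow K 0 f = f"
  by (simp add: kpow_def)

lemma kpow_Suc: "kpow K (Suc n) f x = kapply K (kpow K n f) x"
  by (simp add: kpow_def)

lemma kpow_Suc': "kpow K (Suc n) f = kpow K n (kapply K f)"
  by (simp add: kpow_def funpow_swap1)

lemma kpow_add: "kpow K (m + n) f = kpow K m (kpow K n f)"
  by (simp add: kpow_def funpow_add)

context
  fixes K :: "'a::topological_space \<Rightarrow> 'a measure"
  assumes K: "normal_operator (kapply K)"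
begin

lemma measurable_kapply: "f \<in> borel_measurable borel \<Longrightarrow> kapply K f \<in> borel_measurable borel"
  by (rule normal_operator_measurable[OF K])

lemma measurable_kpow: "f \<in> borel_measurable borel \<Longrightarrow> kpow K n f \<in> borel_measurable borel"
  by (rule normal_operator_measurable[OF normal_operator_kpow[OF K]])

lemma measurable_resolvent: "f \<in> borel_measurable borel \<Longrightarrow> resolvent K l f \<in> borel_measurable borel"
  by (rule normal_operator_measurable[OF normal_operator_resolvent[OF K]])

lemmas normal_kapply = normal_operator_functional[OF K]
lemmas normal_kpow = normal_operator_functional[OF normal_operator_kpow[OF K]]
lemmas normal_resolvent = normal_operator_functional[OF normal_operator_resolvent[OF K]]

lemma kapply_resolvent:
  assumes f [measurable]: "f \<in> borel_measurable borel"
  shows "kapply K (resolvent K l f) x = (\<Sum>k. ennreal (1 / l ^ (k + 1)) * kpow K (Suc k) f x)"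
proof -
  note [measurable] = measurable_kpow
  have "kapply K (resolvent K l f) x = (\<Sum>k. kapply K (\<lambda>x. ennreal (1 / l ^ (k + 1)) * kpow K k f x) x)"
    unfolding resolvent_def[abs_def] by (rule normal_functional_suminf[OF normal_kapply]) measurable
  also have "\<dots> = (\<Sum>k. ennreal (1 / l ^ (k + 1)) * kpow K (Suc k) f x)"
    by (simp add: normal_functional_cmult[OF normal_kapply] kpow_Suc measurable_kpow)
  finally show ?thesis .
qed

lemma resolvent_eq:
  assumes f [measurable]: "f \<in> borel_measurable borel" and l: "0 < l"
  shows "ennreal l * resolvent K l f x = f x + kapply K (resolvent K l f) x"
proof -
  have c: "ennreal l * ennreal (1 / l ^ (k + 1)) = ennreal (1 / l ^ k)" for k
    using l by (subst ennreal_mult[symmetric]) (auto simp: field_simps)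
  have "ennreal l * resolvent K l f x = (\<Sum>k. ennreal (1 / l ^ k) * kpow K k f x)"
    unfolding resolvent_def ennreal_suminf_cmult[symmetric] mult.assoc[symmetric] c ..
  also have "\<dots> = f x + (\<Sum>k. ennreal (1 / l ^ (k + 1)) * kpow K (Suc k) f x)"
    using sums_unique[OF sums_Suc[OF summable_sums[OF summableI]],
        of "\<lambda>k. ennreal (1 / l ^ k) * kpow K k f x"]
    by (simp add: add.commute)
  finally show ?thesis by (simp add: kapply_resolvent)
qed

lemma kapply_resolvent_le:
  assumes f [measurable]: "f \<in> borel_measurable borel" and l: "0 < l"
  shows "kapply K (resolvent K l f) x \<le> ennreal l * resolvent K l f x"
  unfolding resolvent_eq[OF f l] by simp

lemma resolvent_ge:
  assumes f [measurable]: "f \<in> borel_measurable borel"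
  shows "ennreal (1 / l ^ (k + 1)) * kpow K k f x \<le> resolvent K l f x"
  unfolding resolvent_def
  using sum_le_suminf[OF summableI, of "{k}" "\<lambda>k. ennreal (1 / l ^ (k + 1)) * kpow K k f x"] by simp

text \<open>
  By induction every partial sum of the resolvent series lies below \<open>v\<close>. The resolvent
  inequalities below are obtained by exhibiting such a supersolution \<open>v\<close>.
\<close>

lemma resolvent_minimal:
  assumes f [measurable]: "f \<in> borel_measurable borel" and l: "0 < l"
    and v [measurable]: "v \<in> borel_measurable borel"
    and super: "\<And>x. f x + kapply K v x \<le> ennreal l * v x"
  shows "resolvent K l f x \<le> v x"
proof -
  note [measurable] = measurable_kpow measurable_kapply
  have step: "ennreal (1 / l) * (f x + kapply K v x) \<le> v x" for x
  proof -
    have "ennreal (1 / l) * (f x + kapply K v x) \<le> ennreal (1 / l) * (ennreal l * v x)"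
      by (intro mult_left_mono super) simp
    also have "\<dots> = v x" using l by (simp add: mult.assoc[symmetric] ennreal_mult[symmetric])
    finally show ?thesis .
  qed
  have part: "(\<Sum>k<n. ennreal (1 / l ^ (k + 1)) * kpow K k f x) \<le> v x" for n x
  proof (induction n arbitrary: x)
    case 0 show ?case by simp
  next
    case (Suc n)
    let ?g = "\<lambda>x. \<Sum>k<n. ennreal (1 / l ^ (k + 1)) * kpow K k f x"
    have c: "ennreal (1 / l ^ (Suc k + 1)) = ennreal (1 / l) * ennreal (1 / l ^ (k + 1))" for k
      using l by (subst ennreal_mult[symmetric]) (auto simp: field_simps)
    have g: "kapply K ?g x = (\<Sum>k<n. ennreal (1 / l ^ (k + 1)) * kpow K (Suc k) f x)"
      using normal_functional_sum[OF normal_kapply, where n = n and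
          f = "\<lambda>k x. ennreal (1 / l ^ (k + 1)) * kpow K k f x"]
      by (simp add: normal_functional_cmult[OF normal_kapply] kpow_Suc)
    have "(\<Sum>k<Suc n. ennreal (1 / l ^ (k + 1)) * kpow K k f x) =
        ennreal (1 / l) * f x + (\<Sum>k<n. ennreal (1 / l ^ (Suc k + 1)) * kpow K (Suc k) f x)"
      by (subst sum.lessThan_Suc_shift) simp
    also have "\<dots> = ennreal (1 / l) * (f x + kapply K ?g x)"
      unfolding c g by (simp add: distrib_left sum_distrib_left mult.assoc)
    also have "\<dots> \<le> ennreal (1 / l) * (f x + kapply K v x)"
      by (intro mult_left_mono add_left_mono normal_functional_mono[OF normal_kapply] Suc) auto
    also note step
    finally show ?case .
  qed
  show ?thesis unfolding resolvent_def suminf_eq_SUP by (intro SUP_least part)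
qed

lemma kapply_resolvent_commute:
  assumes f [measurable]: "f \<in> borel_measurable borel"
  shows "kapply K (resolvent K l f) = resolvent K l (kapply K f)"
  by (rule ext) (simp add: kapply_resolvent resolvent_def kpow_Suc' f)

text \<open>
  One half of the resolvent identity \<open>(l' - l) R\<^sub>l\<^sub>' R\<^sub>l = R\<^sub>l - R\<^sub>l\<^sub>'\<close>: the function
  \<open>R\<^sub>l f / (l' - l)\<close> is a supersolution at level \<open>l'\<close> with right-hand side \<open>R\<^sub>l f\<close>.
\<close>

lemma resolvent_resolvent_le:
  assumes f [measurable]: "f \<in> borel_measurable borel" and l: "0 < l" "l < l'"
  shows "ennreal (l' - l) * resolvent K l' (resolvent K l f) x \<le> resolvent K l f x"
proof -
  note [measurable] = measurable_resolvent measurable_kapply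
  let ?u = "resolvent K l f"
  define v where "v x = ennreal (1 / (l' - l)) * ?u x" for x
  have [measurable]: "v \<in> borel_measurable borel" unfolding v_def[abs_def] by measurable
  have "?u x + kapply K v x \<le> ennreal l' * v x" for x
  proof -
    have "?u x + kapply K v x = ?u x + ennreal (1 / (l' - l)) * kapply K ?u x"
      unfolding v_def[abs_def] by (simp add: normal_functional_cmult[OF normal_kapply])
    also have "\<dots> \<le> ?u x + ennreal (1 / (l' - l)) * (ennreal l * ?u x)"
      by (intro add_left_mono mult_left_mono kapply_resolvent_le l f) simp
    also have "\<dots> = (1 + ennreal (1 / (l' - l)) * ennreal l) * ?u x"
      by (simp add: distrib_right mult.assoc)
    also have "1 + ennreal (1 / (l' - l)) * ennreal l = ennreal l' * ennreal (1 / (l' - l))"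
      using l by (simp add: ennreal_mult[symmetric] ennreal_1[symmetric] ennreal_plus[symmetric] field_simps
          del: ennreal_1 ennreal_plus)
    finally show ?thesis unfolding v_def[of x] mult.assoc .
  qed
  then have "resolvent K l' ?u x \<le> v x"
    using l by (intro resolvent_minimal) auto
  then have "ennreal (l' - l) * resolvent K l' ?u x \<le> ennreal (l' - l) * v x"
    by (intro mult_left_mono) auto
  also have "\<dots> = ?u x"
    using l by (simp add: v_def mult.assoc[symmetric] ennreal_mult[symmetric])
  finally show ?thesis .
qed

text \<open>
  The other order of the two resolvents. Here \<open>R\<^sub>l f / (l' - l)\<close> need not be a supersolution,
  but \<open>R\<^sub>l\<^sub>' R\<^sub>l f\<close> is one, since \<open>K\<close> commutes with its resolvents.
\<close>

lemma resolvent_resolvent_le':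
  assumes f [measurable]: "f \<in> borel_measurable borel" and l: "0 < l" "l < l'"
  shows "ennreal (l' - l) * resolvent K l (resolvent K l' f) x \<le> resolvent K l f x"
proof -
  note [measurable] = measurable_resolvent measurable_kapply
  let ?v = "resolvent K l' (resolvent K l f)"
  have "resolvent K l' f x + kapply K ?v x \<le> ennreal l * ?v x" for x
  proof -
    have "ennreal l * ?v x = resolvent K l' (\<lambda>x. ennreal l * resolvent K l f x) x"
      by (simp add: normal_functional_cmult[OF normal_resolvent])
    also have "\<dots> = resolvent K l' (\<lambda>x. f x + kapply K (resolvent K l f) x) x"
      using l by (simp add: resolvent_eq)
    also have "\<dots> = resolvent K l' f x + resolvent K l' (kapply K (resolvent K l f)) x"
      by (simp add: normal_functional_add[OF normal_resolvent])
    also have "\<dots> = resolvent K l' f x + kapply K ?v x"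
      by (simp add: kapply_resolvent_commute)
    finally show ?thesis by simp
  qed
  then have "resolvent K l (resolvent K l' f) x \<le> ?v x"
    using l by (intro resolvent_minimal) auto
  then have "ennreal (l' - l) * resolvent K l (resolvent K l' f) x \<le> ennreal (l' - l) * ?v x"
    by (intro mult_left_mono) auto
  also have "\<dots> \<le> resolvent K l f x" by (intro resolvent_resolvent_le f l)
  finally show ?thesis .
qed

text \<open>
  A drift inequality with a function bounded away from \<open>0\<close> controls the resolvent of
  constants.
\<close>

lemma resolvent_1_le:
  assumes g [measurable]: "g \<in> borel_measurable borel" and \<eta>: "0 < \<eta>" "\<And>x. ennreal \<eta> \<le> g x"
    and \<rho>: "0 < \<rho>" "\<And>x. kapply K g x \<le> ennreal \<rho> * g x" and l\<rho>: "\<rho> < l"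
  shows "resolvent K l (\<lambda>x. 1) x \<le> ennreal (1 / (\<eta> * (l - \<rho>))) * g x"
proof (rule resolvent_minimal)
  show "0 < l" using \<rho> l\<rho> by simp
  fix x
  let ?c = "ennreal (1 / (\<eta> * (l - \<rho>)))"
  have "1 = ?c * (ennreal (l - \<rho>) * ennreal \<eta>)"
    using \<eta> l\<rho> by (simp add: ennreal_mult[symmetric])
  also have "\<dots> \<le> ?c * (ennreal (l - \<rho>) * g x)" by (intro mult_left_mono \<eta>) auto
  finally have "1 + kapply K (\<lambda>x. ?c * g x) x \<le> ?c * (ennreal (l - \<rho>) * g x) + ?c * (ennreal \<rho> * g x)"
    by (intro add_mono) (auto simp: normal_functional_cmult[OF normal_kapply] intro!: mult_left_mono \<rho>)
  also have "\<dots> = ?c * ((ennreal (l - \<rho>) + ennreal \<rho>) * g x)" by (simp add: distrib_left distrib_right)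
  also have "ennreal (l - \<rho>) + ennreal \<rho> = ennreal l" using \<rho> l\<rho> by (simp add: ennreal_plus[symmetric] del: ennreal_plus)
  finally show "1 + kapply K (\<lambda>x. ?c * g x) x \<le> ennreal l * (?c * g x)" by (simp add: mult.left_commute)
qed measurable

lemma resolvent_antimono:
  assumes l: "0 < l" "l \<le> l'"
  shows "resolvent K l' f x \<le> resolvent K l f x"
  unfolding resolvent_def using l
  by (intro suminf_le mult_right_mono ennreal_leI divide_left_mono power_mono) auto

end

section \<open>The generalized principal eigenvalue\<close>

text \<open>
  A normal functional that vanishes on \<open>f\<close> vanishes on \<open>\<infinity> \<cdot> f\<close>, the limit of the multiples of \<open>f\<close>.
\<close>

lemma normal_functional_eq_0:
  assumes F: "normal_functional F"
    and [measurable]: "f \<in> borel_measurable borel" "g \<in> borel_measurable borel"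
    and F0: "F f = 0" and supp: "\<And>x. 0 < g x \<Longrightarrow> 0 < f x"
  shows "F g = 0"
proof -
  let ?h = "\<lambda>(n::nat) x. of_nat n * f x"
  have inc: "incseq ?h" by (auto simp: incseq_def le_fun_def intro!: mult_right_mono)
  have "F (\<lambda>x. SUP n. ?h n x) = (SUP n. F (?h n))"
    by (intro normal_functional_SUP[OF F] inc) measurable
  also have "\<dots> = 0" by (simp add: normal_functional_cmult[OF F] F0)
  finally have 0: "F (\<lambda>x. SUP n. ?h n x) = 0" .
  have "g x \<le> (SUP n. ?h n x)" for x
  proof (cases "f x = 0")
    case True
    then show ?thesis using supp[of x] by (cases "g x = 0") (auto simp: zero_less_iff_neq_zero)
  next
    case False
    have "(SUP n. ?h n x) = (SUP n. of_nat n) * f x" by (rule SUP_mult_right_ennreal[symmetric])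
    also have "\<dots> = \<infinity>" using False by (simp add: ennreal_SUP_of_nat_eq_top ennreal_top_mult)
    finally show ?thesis by (simp only: infinity_ennreal_def top_greatest)
  qed
  then have "F g \<le> F (\<lambda>x. SUP n. ?h n x)"
    by (intro normal_functional_mono[OF F]) measurable
  then show ?thesis using 0 by simp
qed

text \<open>
  The part of the theory of \<open>\<psi>\<close>-irreducible kernels that makes the generalized principal
  eigenvalue a well-defined number. Powers and resolvents of \<open>K\<close> may take the value \<open>\<infinity>\<close>.
\<close>

locale irreducible_kernel =
  fixes \<psi> :: "'a::polish_space measure" and K :: "'a \<Rightarrow> 'a measure"
  assumes normal: "normal_operator (kapply K)"
    and sets_psi [measurable_cong]: "sets \<psi> = sets borel"
    and psi_nonzero: "emeasure \<psi> UNIV \<noteq> 0"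
    and irreducible: "\<And>A x. A \<in> sets borel \<Longrightarrow> 0 < emeasure \<psi> A \<Longrightarrow> \<exists>k. 0 < kpow K k (indicator A) x"
    and nondegenerate: "\<And>f x. f \<in> borel_measurable borel \<Longrightarrow> (\<And>y. 0 < f y) \<Longrightarrow> 0 < kapply K f x"
begin

lemmas measurable_K = measurable_kapply[OF normal]
lemmas measurable_R = measurable_resolvent[OF normal]

lemma space_psi: "space \<psi> = UNIV"
  using sets_eq_imp_space_eq[OF sets_psi] by simp

lemma ex_of_AE:
  assumes "AE x in \<psi>. Q x"
  shows "\<exists>x. Q x"
proof (rule ccontr)
  assume "\<nexists>x. Q x"
  with assms have "AE x in \<psi>. False" by simp
  then have "emeasure \<psi> UNIV = 0" using space_psi by (simp add: ae_filter_eq_bot_iff flip: trivial_limit_def)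
  with psi_nonzero show False by simp
qed

lemma resolvent_pos:
  assumes f [measurable]: "f \<in> borel_measurable borel" and pos: "0 < (\<integral>\<^sup>+ x. f x \<partial>\<psi>)" and l: "0 < l"
  shows "0 < resolvent K l f x"
proof -
  let ?A = "{x. 0 < f x}"
  have A [measurable]: "?A \<in> sets borel" by measurable
  have "emeasure \<psi> ?A \<noteq> 0"
  proof
    assume "emeasure \<psi> ?A = 0"
    moreover have "{x \<in> space \<psi>. f x \<noteq> 0} = ?A" by (auto simp: space_psi zero_less_iff_neq_zero)
    ultimately have "(\<integral>\<^sup>+ x. f x \<partial>\<psi>) = 0" by (subst nn_integral_0_iff) simp_all
    with pos show False by simp
  qed
  then obtain k where k: "0 < kpow K k (indicator ?A) x"
    using irreducible[OF A, of x] by (auto simp: zero_less_iff_neq_zero)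
  have "kpow K k f x \<noteq> 0"
  proof
    assume 0: "kpow K k f x = 0"
    have supp: "0 < f y" if "0 < (indicator ?A y :: ennreal)" for y
      using that by (cases "y \<in> ?A") auto
    have "kpow K k (indicator ?A) x = 0"
      by (rule normal_functional_eq_0[OF normal_kpow[OF normal, of k x] f _ 0 supp]) measurable
    with k show False by simp
  qed
  then have "0 < ennreal (1 / l ^ (k + 1)) * kpow K k f x"
    using l by (simp add: zero_less_iff_neq_zero ennreal_eq_0_iff not_le del: power_Suc)
  also have "\<dots> \<le> resolvent K l f x" by (rule resolvent_ge[OF normal f])
  finally show ?thesis .
qed

text \<open>
  The dichotomy behind the eigenvalue: the set where \<open>R\<^sub>l f = \<infinity>\<close> cannot be reached from a point
  where \<open>R\<^sub>l f\<close> is finite, since \<open>K\<^sup>k R\<^sub>l f \<le> l\<^sup>k R\<^sub>l f\<close>; by irreducibility it is \<open>\<psi>\<close>-null.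
\<close>

lemma resolvent_finite_AE:
  assumes f [measurable]: "f \<in> borel_measurable borel" and l: "0 < l"
    and fin: "resolvent K l f x0 < \<infinity>"
  shows "AE x in \<psi>. resolvent K l f x < \<infinity>"
proof -
  note [measurable] = measurable_R
  let ?A = "{x. resolvent K l f x = \<infinity>}"
  have A [measurable]: "?A \<in> sets borel" by measurable
  have le: "kpow K k (resolvent K l f) x0 \<le> ennreal (l ^ k) * resolvent K l f x0" for k
  proof (induction k)
    case (Suc k)
    have "kpow K (Suc k) (resolvent K l f) x0 \<le> kpow K k (\<lambda>x. ennreal l * resolvent K l f x) x0"
      unfolding kpow_Suc' using kapply_resolvent_le[OF normal f l]
      by (intro normal_functional_mono[OF normal_kpow[OF normal]] measurable_K) auto
    also have "\<dots> = ennreal l * kpow K k (resolvent K l f) x0"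
      by (simp add: normal_functional_cmult[OF normal_kpow[OF normal]])
    also have "\<dots> \<le> ennreal l * (ennreal (l ^ k) * resolvent K l f x0)"
      by (intro mult_left_mono Suc) simp
    also have "\<dots> = ennreal (l ^ Suc k) * resolvent K l f x0"
      using l by (simp add: ennreal_mult mult.assoc)
    finally show ?case .
  qed simp
  have "emeasure \<psi> ?A = 0"
  proof (rule ccontr)
    assume "emeasure \<psi> ?A \<noteq> 0"
    then obtain k where k: "0 < kpow K k (indicator ?A) x0"
      using irreducible[OF A, of x0] by (auto simp: zero_less_iff_neq_zero)
    have "\<infinity> = \<infinity> * kpow K k (indicator ?A) x0"
      using k by (simp add: ennreal_top_mult)
    also have "\<dots> = kpow K k (\<lambda>x. \<infinity> * indicator ?A x) x0"
      by (simp add: normal_functional_cmult[OF normal_kpow[OF normal]])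
    also have "\<dots> \<le> kpow K k (resolvent K l f) x0"
      by (intro normal_functional_mono[OF normal_kpow[OF normal]]) (auto simp: indicator_def)
    also have "\<dots> < \<infinity>"
      using le_less_trans[OF le, of k] fin by (simp add: ennreal_mult_less_top)
    finally show False by simp
  qed
  then show ?thesis
    by (intro AE_I[of _ _ ?A]) (auto simp: space_psi less_top[symmetric] sets_psi)
qed

lemma small_functionE:
  assumes "small_function \<psi> K s"
  obtains l \<nu> where "s \<in> borel_measurable borel" "\<And>x. 0 \<le> s x" "0 < (\<integral>\<^sup>+ x. ennreal (s x) \<partial>\<psi>)"
    "0 < l" "sets \<nu> = sets borel" "emeasure \<nu> UNIV \<noteq> 0"
    "\<And>f x. f \<in> borel_measurable borel \<Longrightarrow> ennreal (s x) * (\<integral>\<^sup>+ y. f y \<partial>\<nu>) \<le> resolvent K l f x"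
    "\<exists>x B. (\<forall>n::nat. B n \<in> sets borel) \<and> (\<Union>n. B n) = UNIV \<and> (\<forall>n. resolvent K l (indicator (B n)) x < \<infinity>)"
proof -
  from assms obtain l \<nu> where *: "0 < l" "sets \<nu> = sets borel" "emeasure \<nu> UNIV \<noteq> 0"
    "AE x in \<psi>. \<exists>B::nat \<Rightarrow> 'a set. (\<forall>n. B n \<in> sets borel) \<and> (\<Union>n. B n) = UNIV \<and>
       (\<forall>n. resolvent K l (indicator (B n)) x < \<infinity>)"
    "\<And>x A. A \<in> sets borel \<Longrightarrow> ennreal (s x) * emeasure \<nu> A \<le> resolvent K l (indicator A) x"
    by (auto simp: small_function_def)
  have "ennreal (s x) * (\<integral>\<^sup>+ y. f y \<partial>\<nu>) \<le> resolvent K l f x" if "f \<in> borel_measurable borel" for f x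
    by (intro normal_functional_le_nn_integral normal_resolvent[OF normal] * that)
  then show ?thesis
    using that[of l \<nu>] * ex_of_AE[OF *(4)] assms by (auto simp: small_function_def)
qed

lemma nn_integral_pos:
  assumes "sets \<nu> = sets borel" "emeasure \<nu> UNIV \<noteq> 0" "f \<in> borel_measurable borel" "\<And>x. 0 < f x"
  shows "(\<integral>\<^sup>+ x. f x \<partial>\<nu>) \<noteq> (0::ennreal)"
proof
  assume 0: "(\<integral>\<^sup>+ x. f x \<partial>\<nu>) = 0"
  have "space \<nu> = UNIV" using sets_eq_imp_space_eq[OF assms(1)] by simp
  moreover have "f \<in> borel_measurable \<nu>" using assms by (simp add: measurable_cong_sets[OF assms(1) refl])
  moreover have "{x. f x \<noteq> 0} = UNIV" using assms(4) by (auto simp: zero_less_iff_neq_zero)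
  ultimately show False using 0 assms(2) by (simp add: nn_integral_0_iff)
qed

text \<open>
  All small functions have the same convergence parameter. The minorization of \<open>s\<close> comes with
  its own level \<open>k\<close>. If \<open>k > l\<close>, then a multiple of \<open>R\<^sub>k R\<^sub>k f\<close> dominates \<open>s\<close>, and its resolvent at \<open>l\<close>
  is controlled by \<open>R\<^sub>l f\<close>. If \<open>k \<le> l\<close>, then a multiple of \<open>R\<^sub>k 1\<^sub>B\<close> dominates \<open>s\<close>, for a set \<open>B\<close> that is
  charged by the minorizing measure and has \<open>R\<^sub>k 1\<^sub>B\<close> finite somewhere; such a \<open>B\<close> exists by the
  \<open>\<sigma>\<close>-finiteness in the definition of small functions.
\<close>

lemma small_function_comparison:
  assumes s: "small_function \<psi> K s"
    and f [measurable]: "f \<in> borel_measurable borel" and pos: "0 < (\<integral>\<^sup>+ x. f x \<partial>\<psi>)"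
    and l: "0 < l" "l < l'" and fin: "resolvent K l f x0 < \<infinity>"
  shows "\<exists>x. resolvent K l' (\<lambda>x. ennreal (s x)) x < \<infinity>"
proof -
  from s obtain k \<nu> where sm [measurable]: "s \<in> borel_measurable borel"
    and s0: "\<And>x. 0 \<le> s x" and k: "0 < k"
    and \<nu> [measurable_cong]: "sets \<nu> = sets borel" and \<nu>0: "emeasure \<nu> UNIV \<noteq> 0"
    and le: "\<And>f x. f \<in> borel_measurable borel \<Longrightarrow> ennreal (s x) * (\<integral>\<^sup>+ y. f y \<partial>\<nu>) \<le> resolvent K k f x"
    and ex: "\<exists>x B. (\<forall>n::nat. B n \<in> sets borel) \<and> (\<Union>n. B n) = UNIV \<and> (\<forall>n. resolvent K k (indicator (B n)) x < \<infinity>)"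
    by (rule small_functionE) blast
  note [measurable] = measurable_R
  have bound: "ennreal c * ((\<integral>\<^sup>+ y. g y \<partial>\<nu>) * resolvent K l'' (\<lambda>x. ennreal (s x)) x) \<le>
      ennreal c * resolvent K l'' (resolvent K k g) x"
    if [measurable]: "g \<in> borel_measurable borel" for c g l'' x
  proof (intro mult_left_mono)
    have "(\<integral>\<^sup>+ y. g y \<partial>\<nu>) * resolvent K l'' (\<lambda>x. ennreal (s x)) x =
        resolvent K l'' (\<lambda>x. (\<integral>\<^sup>+ y. g y \<partial>\<nu>) * ennreal (s x)) x"
      by (simp add: normal_functional_cmult[OF normal_resolvent[OF normal]])
    also have "\<dots> \<le> resolvent K l'' (resolvent K k g) x"
      using le[of g]
      by (intro normal_functional_mono[OF normal_resolvent[OF normal]]) (auto simp: mult.commute)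
    finally show "(\<integral>\<^sup>+ y. g y \<partial>\<nu>) * resolvent K l'' (\<lambda>x. ennreal (s x)) x \<le> resolvent K l'' (resolvent K k g) x" .
  qed simp
  have cancel: "b < \<infinity>" if "ennreal c * (a * b) < \<infinity>" "a \<noteq> 0" "0 < c" for a b :: ennreal and c
    using that by (auto simp: ennreal_mult_less_top less_top ennreal_mult_eq_top_iff)
  show ?thesis
  proof (cases "k \<le> l")
    case True
    obtain x B where B: "\<And>n::nat. B n \<in> sets borel" "(\<Union>n. B n) = UNIV"
        "\<And>n. resolvent K k (indicator (B n)) x < \<infinity>"
      using ex by blast
    have "\<exists>n. emeasure \<nu> (B n) \<noteq> 0"
    proof (rule ccontr)
      assume "\<nexists>n. emeasure \<nu> (B n) \<noteq> 0"
      then have "emeasure \<nu> (\<Union>n. B n) = 0"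
        using B(1) \<nu> by (intro emeasure_UN_eq_0) auto
      with B(2) \<nu>0 show False by simp
    qed
    then obtain n where n: "emeasure \<nu> (B n) \<noteq> 0" by blast
    note B(1)[measurable]
    let ?g = "indicator (B n) :: 'a \<Rightarrow> ennreal"
    have "ennreal (l' - k) * ((\<integral>\<^sup>+ y. ?g y \<partial>\<nu>) * resolvent K l' (\<lambda>x. ennreal (s x)) x) \<le>
        ennreal (l' - k) * resolvent K l' (resolvent K k ?g) x"
      by (rule bound) measurable
    also have "\<dots> \<le> resolvent K k ?g x"
      using True l k by (intro resolvent_resolvent_le normal) auto
    also note B(3)
    finally show ?thesis
      using n True l by (intro exI[of _ x]) (rule cancel[of "l' - k"], auto)
  next
    case False
    let ?g = "resolvent K k f"
    have g: "0 < ?g x" for x using pos k by (intro resolvent_pos) auto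
    have "ennreal ((k - l) * (k - l)) * ((\<integral>\<^sup>+ y. ?g y \<partial>\<nu>) * resolvent K l (\<lambda>x. ennreal (s x)) x0) \<le>
        ennreal ((k - l) * (k - l)) * resolvent K l (resolvent K k ?g) x0"
      by (rule bound) measurable
    also have "\<dots> = ennreal (k - l) * (ennreal (k - l) * resolvent K l (resolvent K k ?g) x0)"
      using False by (simp add: ennreal_mult mult.assoc)
    also have "\<dots> \<le> ennreal (k - l) * resolvent K l ?g x0"
      using False l by (intro mult_left_mono resolvent_resolvent_le' normal) auto
    also have "\<dots> \<le> resolvent K l f x0"
      using False l by (intro resolvent_resolvent_le' normal) auto
    also note fin
    finally have "resolvent K l (\<lambda>x. ennreal (s x)) x0 < \<infinity>"
      by (rule cancel) (use False nn_integral_pos[OF \<nu> \<nu>0 _ g] in auto)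
    with resolvent_antimono[OF normal, of l l' "\<lambda>x. ennreal (s x)" x0] l
    show ?thesis by (intro exI[of _ x0]) (auto elim: le_less_trans)
  qed
qed

text \<open>
  The eigenvalue is not \<open>0\<close>. Lowering the level from \<open>k\<close> to \<open>l\<close> multiplies all terms of positive
  order of the resolvent series by at least \<open>(k/l)\<^sup>2\<close>, hence also the minorization, once it is
  rewritten so that it uses only those terms. For \<open>l\<close> small the resolvent \<open>u\<close> of \<open>s\<close> at level \<open>l/2\<close>
  then satisfies \<open>\<nu>(u) \<ge> 2 \<nu>(u)\<close>, although \<open>\<nu>(u) > 0\<close>; so \<open>\<nu>(u) = \<infinity>\<close>.
\<close>

lemma small_function_resolvent_infinite:
  assumes s: "small_function \<psi> K s"
  obtains l where "0 < l" "\<And>x. resolvent K l (\<lambda>x. ennreal (s x)) x = \<infinity>"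
proof -
  from s obtain k \<nu> where sm [measurable]: "s \<in> borel_measurable borel"
    and s0: "\<And>x. 0 \<le> s x" and pos: "0 < (\<integral>\<^sup>+ x. ennreal (s x) \<partial>\<psi>)" and k: "0 < k"
    and \<nu> [measurable_cong]: "sets \<nu> = sets borel" and \<nu>0: "emeasure \<nu> UNIV \<noteq> 0"
    and le: "\<And>f x. f \<in> borel_measurable borel \<Longrightarrow> ennreal (s x) * (\<integral>\<^sup>+ y. f y \<partial>\<nu>) \<le> resolvent K k f x"
    by (rule small_functionE) blast
  note [measurable] = measurable_R measurable_K
  let ?s = "\<lambda>x. ennreal (s x)"
  define t where "t = kapply K (resolvent K (2 * k) ?s)"
  have t [measurable]: "t \<in> borel_measurable borel" unfolding t_def by measurable
  have t_pos: "0 < t x" for x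
    unfolding t_def using k pos by (intro nondegenerate resolvent_pos) auto
  have 1: "ennreal k * (t x * (\<integral>\<^sup>+ y. f y \<partial>\<nu>)) \<le> kapply K (resolvent K k f) x"
    if f [measurable]: "f \<in> borel_measurable borel" for f x
  proof -
    have "ennreal k * (t x * (\<integral>\<^sup>+ y. f y \<partial>\<nu>)) =
        ennreal (2 * k - k) * kapply K (\<lambda>x. (\<integral>\<^sup>+ y. f y \<partial>\<nu>) * resolvent K (2 * k) ?s x) x"
      by (simp add: t_def normal_functional_cmult[OF normal_kapply[OF normal]] mult.commute)
    also have "\<dots> = ennreal (2 * k - k) * kapply K (resolvent K (2 * k) (\<lambda>x. (\<integral>\<^sup>+ y. f y \<partial>\<nu>) * ?s x)) x"
      by (simp add: normal_operator_cmult[OF normal_operator_resolvent[OF normal]])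
    also have "\<dots> \<le> ennreal (2 * k - k) * kapply K (resolvent K (2 * k) (resolvent K k f)) x"
      using le[OF f] by (intro mult_left_mono normal_functional_mono[OF normal_kapply[OF normal]]
          normal_functional_mono[OF normal_resolvent[OF normal]]) (auto simp: mult.commute)
    also have "\<dots> = kapply K (\<lambda>x. ennreal (2 * k - k) * resolvent K (2 * k) (resolvent K k f) x) x"
      by (simp add: normal_functional_cmult[OF normal_kapply[OF normal]])
    also have "\<dots> \<le> kapply K (resolvent K k f) x"
      using k resolvent_resolvent_le[OF normal f, of k "2 * k"]
      by (intro normal_functional_mono[OF normal_kapply[OF normal]]) auto
    finally show ?thesis .
  qed
  have 2: "ennreal (k / l) * kapply K (resolvent K k f) x \<le> ennreal l * resolvent K l f x"
    if f [measurable]: "f \<in> borel_measurable borel" and l: "0 < l" "l \<le> k" for f x l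
  proof -
    have "ennreal (k / l) * kapply K (resolvent K k f) x =
       (\<Sum>n. ennreal (k / l) * (ennreal (1 / k ^ (n + 1)) * kpow K (Suc n) f x))"
      by (simp add: kapply_resolvent[OF normal] )
    also have "\<dots> \<le> (\<Sum>n. ennreal (1 / l ^ (n + 1)) * kpow K (Suc n) f x)"
    proof (intro suminf_le summableI)
      fix n
      have "l ^ n \<le> k ^ n" using l by (intro power_mono) auto
      then have "k / l * (1 / k ^ (n + 1)) \<le> 1 / l ^ (n + 1)"
        using l k by (simp add: divide_simps)
      then have "ennreal (k / l) * ennreal (1 / k ^ (n + 1)) \<le> ennreal (1 / l ^ (n + 1))"
        using l k by (subst ennreal_mult[symmetric]) (auto intro!: ennreal_leI)
      then show "ennreal (k / l) * (ennreal (1 / k ^ (n + 1)) * kpow K (Suc n) f x)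
          \<le> ennreal (1 / l ^ (n + 1)) * kpow K (Suc n) f x"
        unfolding mult.assoc[symmetric] by (rule mult_right_mono) simp
    qed
    also have "\<dots> = kapply K (resolvent K l f) x" by (simp add: kapply_resolvent[OF normal])
    also have "\<dots> \<le> ennreal l * resolvent K l f x" by (rule kapply_resolvent_le[OF normal f l(1)])
    finally show ?thesis .
  qed
  define \<theta> where "\<theta> = (if (\<integral>\<^sup>+ y. t y \<partial>\<nu>) = \<infinity> then 1 else enn2real (\<integral>\<^sup>+ y. t y \<partial>\<nu>))"
  have nt: "(\<integral>\<^sup>+ y. t y \<partial>\<nu>) \<noteq> 0" using nn_integral_pos[OF \<nu> \<nu>0 t t_pos] .
  have \<theta>: "0 < \<theta>" "ennreal \<theta> \<le> (\<integral>\<^sup>+ y. t y \<partial>\<nu>)"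
    using nt by (auto simp: \<theta>_def enn2real_positive_iff less_top zero_less_iff_neq_zero top.not_eq_extremum)
  \<comment> \<open>With this \<open>l\<close>, one application of the minorization multiplies \<open>\<nu>(u)\<close> by at least \<open>2\<close>.\<close>
  define l where "l = min k (k * k * \<theta> / 4)"
  have l: "0 < l" "l \<le> k" using k \<theta> by (auto simp: l_def)
  define u where "u = resolvent K (l / 2) ?s"
  have u [measurable]: "u \<in> borel_measurable borel" unfolding u_def by measurable
  have u_pos: "0 < u x" for x unfolding u_def using l pos by (intro resolvent_pos) auto
  have 3: "ennreal (k * k / (2 * l)) * (t x * (\<integral>\<^sup>+ y. u y \<partial>\<nu>)) \<le> u x" for x
  proof -
    have c1: "ennreal (k * k / (2 * l)) = ennreal (1 / 2) * (ennreal (k / l) * ennreal k)"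
      using k l by (simp only: ennreal_mult[symmetric] less_imp_le divide_nonneg_nonneg mult_nonneg_nonneg
          zero_le_one zero_le_numeral) (simp add: field_simps)
    have c2: "ennreal (l - l / 2) = ennreal (1 / 2) * ennreal l"
      using l by (simp only: ennreal_mult[symmetric] less_imp_le divide_nonneg_nonneg mult_nonneg_nonneg
          zero_le_one zero_le_numeral) (simp add: field_simps)
    have "ennreal (k * k / (2 * l)) * (t x * (\<integral>\<^sup>+ y. u y \<partial>\<nu>)) =
        ennreal (1 / 2) * (ennreal (k / l) * (ennreal k * (t x * (\<integral>\<^sup>+ y. u y \<partial>\<nu>))))"
      by (simp only: c1 mult.assoc)
    also have "\<dots> \<le> ennreal (1 / 2) * (ennreal (k / l) * kapply K (resolvent K k u) x)"
      by (intro mult_left_mono 1 u) auto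
    also have "\<dots> \<le> ennreal (1 / 2) * (ennreal l * resolvent K l u x)"
      by (intro mult_left_mono 2 u l) auto
    also have "\<dots> = ennreal (l - l / 2) * resolvent K l u x"
      by (simp only: c2 mult.assoc)
    also have "\<dots> \<le> u x"
      unfolding u_def using l by (intro resolvent_resolvent_le[OF normal]) auto
    finally show ?thesis .
  qed
  have "(\<integral>\<^sup>+ y. u y \<partial>\<nu>) = \<infinity>"
  proof (rule ccontr)
    assume fin: "(\<integral>\<^sup>+ y. u y \<partial>\<nu>) \<noteq> \<infinity>"
    define c where "c = enn2real (\<integral>\<^sup>+ y. u y \<partial>\<nu>)"
    have c: "(\<integral>\<^sup>+ y. u y \<partial>\<nu>) = ennreal c" using fin by (simp add: c_def less_top)
    have "0 < c"
      using nn_integral_pos[OF \<nu> \<nu>0 u u_pos] c by (metis ennreal_0 ennreal_neg linorder_not_le order_le_less)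
    have kl: "2 \<le> k * k / (2 * l) * \<theta>"
    proof -
      have "l \<le> k * k * \<theta> / 4" by (simp add: l_def)
      then show ?thesis using l by (simp add: field_simps)
    qed
    have "ennreal (k * k / (2 * l) * \<theta> * c) = ennreal (k * k / (2 * l)) * (ennreal \<theta> * ennreal c)"
      using k l \<theta> \<open>0 < c\<close> by (simp add: ennreal_mult[symmetric] mult.assoc)
    also have "\<dots> \<le> ennreal (k * k / (2 * l)) * ((\<integral>\<^sup>+ y. t y \<partial>\<nu>) * (\<integral>\<^sup>+ y. u y \<partial>\<nu>))"
      unfolding c by (intro mult_left_mono mult_right_mono \<theta>) auto
    also have "\<dots> = (\<integral>\<^sup>+ x. ennreal (k * k / (2 * l)) * (t x * (\<integral>\<^sup>+ y. u y \<partial>\<nu>)) \<partial>\<nu>)"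
      by (simp add: nn_integral_cmult nn_integral_multc)
    also have "\<dots> \<le> (\<integral>\<^sup>+ x. u x \<partial>\<nu>)" by (intro nn_integral_mono 3)
    also have "\<dots> = ennreal c" by (rule c)
    finally have "k * k / (2 * l) * \<theta> * c \<le> c" using \<open>0 < c\<close> by (simp add: ennreal_le_iff)
    moreover have "2 * c \<le> k * k / (2 * l) * \<theta> * c"
      using kl \<open>0 < c\<close> by (intro mult_right_mono) auto
    ultimately show False using \<open>0 < c\<close> by linarith
  qed
  then have "u x = \<infinity>" for x
  proof -
    have "ennreal (k * k / (2 * l)) \<noteq> 0" using k l by (simp add: ennreal_eq_0_iff not_le)
    then show ?thesis
      using 3[of x] t_pos[of x] \<open>(\<integral>\<^sup>+ y. u y \<partial>\<nu>) = \<infinity>\<close>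
      by (simp only: infinity_ennreal_def ennreal_mult_top zero_less_iff_neq_zero top_unique if_False simp_thms)
  qed
  with l show ?thesis by (intro that[of "l / 2"]) (auto simp: u_def)
qed

text \<open>
  The eigenvalue is the infimum of the levels at which the resolvent of one small function
  is finite somewhere. The number is unique because \<open>\<psi>\<close> is not \<open>0\<close> and a small function exists.
\<close>

lemma principal_eigenvalue:
  assumes ex: "small_function \<psi> K s0"
  shows principal_eigenvalue_infinite:
      "\<And>s l x. small_function \<psi> K s \<Longrightarrow> 0 < l \<Longrightarrow> ennreal l < principal_eigenvalue \<psi> K \<Longrightarrow>
         resolvent K l (\<lambda>y. ennreal (s y)) x = \<infinity>"
    and principal_eigenvalue_finite:
      "\<And>s l. small_function \<psi> K s \<Longrightarrow> principal_eigenvalue \<psi> K < ennreal l \<Longrightarrow>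
         AE x in \<psi>. resolvent K l (\<lambda>y. ennreal (s y)) x < \<infinity>"
    and principal_eigenvalue_pos: "0 < principal_eigenvalue \<psi> K"
proof -
  let ?R = "\<lambda>s l. resolvent K l (\<lambda>y. ennreal (s y))"
  define PE where "PE L \<longleftrightarrow> 0 < L \<and>
     (\<forall>s. small_function \<psi> K s \<longrightarrow>
        (\<forall>l>0. ennreal l < L \<longrightarrow> (\<forall>x. ?R s l x = \<infinity>)) \<and>
        (\<forall>l. L < ennreal l \<longrightarrow> (AE x in \<psi>. ?R s l x < \<infinity>)))" for L
  have pe: "principal_eigenvalue \<psi> K = (THE L. PE L)"
    unfolding principal_eigenvalue_def PE_def ..
  have between: "\<exists>c. 0 < c \<and> a < ennreal c \<and> ennreal c < b" if ab: "a < b" for a b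
  proof -
    obtain c where "a < c" "c < b" using dense[OF ab] by blast
    then show ?thesis using less_trans[of c b top]
      by (cases c) (auto intro!: exI[of _ "enn2real c"] simp: ennreal_less_zero_iff[symmetric] top_unique
          simp del: ennreal_less_zero_iff intro: le_less_trans[of 0 a])
  qed
  have sm: "(\<lambda>x. ennreal (s x)) \<in> borel_measurable borel" "0 < (\<integral>\<^sup>+ x. ennreal (s x) \<partial>\<psi>)"
    if "small_function \<psi> K s" for s
    using that by (auto simp: small_function_def)
  define S where "S = {l. 0 < l \<and> (\<exists>x. ?R s0 l x < \<infinity>)}"
  define L where "L = (INF l\<in>S. ennreal l)"
  have "PE L"
    unfolding PE_def
  proof (intro conjI allI impI)
    obtain k where k: "0 < k" "\<And>x. ?R s0 k x = \<infinity>"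
      using small_function_resolvent_infinite[OF ex] by blast
    have "ennreal k \<le> ennreal l" if "l \<in> S" for l
    proof (rule ccontr)
      assume "\<not> ennreal k \<le> ennreal l"
      then have "l \<le> k" using that by (simp add: not_le S_def ennreal_less_iff)
      with that k resolvent_antimono[OF normal, of l k] show False
        by (auto simp: S_def) (metis top.not_eq_extremum top_unique)
    qed
    then have "ennreal k \<le> L" unfolding L_def by (rule INF_greatest)
    with k show "0 < L" by (metis ennreal_less_zero_iff less_le_trans)
  next
    fix s l x assume s: "small_function \<psi> K s" and l: "0 < l" "ennreal l < L"
    obtain c where c: "0 < c" "ennreal l < ennreal c" "ennreal c < L" using between[OF l(2)] by blast
    show "?R s l x = \<infinity>"
    proof (rule ccontr)
      assume "?R s l x \<noteq> \<infinity>"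
      then have "\<exists>x. ?R s0 c x < \<infinity>"
        using sm[OF s] l c by (intro small_function_comparison[OF ex, of "\<lambda>x. ennreal (s x)" l])
          (auto simp: less_top ennreal_less_iff)
      then have "c \<in> S" using c by (simp add: S_def)
      then have "L \<le> ennreal c" unfolding L_def by (rule INF_lower)
      with c show False by simp
    qed
  next
    fix s l assume s: "small_function \<psi> K s" and l: "L < ennreal l"
    then obtain c where c: "c \<in> S" "ennreal c < ennreal l" by (auto simp: L_def INF_less_iff)
    then obtain x0 where x0: "0 < c" "c < l" "?R s0 c x0 < \<infinity>" by (auto simp: S_def ennreal_less_iff)
    then have "\<exists>x. ?R s l x < \<infinity>"
      by (intro small_function_comparison[OF s sm[OF ex]])
    moreover have "0 < l" using l by (metis ennreal_less_zero_iff not_gr_zero not_less_zero)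
    ultimately show "AE x in \<psi>. ?R s l x < \<infinity>"
      using resolvent_finite_AE[OF sm(1)[OF s]] by blast
  qed
  moreover have "L' = L" if "PE L'" for L'
  proof -
    have *: "\<not> a < b" if a: "PE a" and b: "PE b" for a b
    proof
      assume "a < b"
      then obtain c where c: "0 < c" "a < ennreal c" "ennreal c < b" using between by blast
      with a b ex have "AE x in \<psi>. ?R s0 c x < \<infinity>" "\<forall>x. ?R s0 c x = \<infinity>"
        unfolding PE_def by blast+
      then have "AE x in \<psi>. False" by simp
      then show False using ex_of_AE by blast
    qed
    from *[OF that \<open>PE L\<close>] *[OF \<open>PE L\<close> that] show ?thesis by simp
  qed
  ultimately have "PE (principal_eigenvalue \<psi> K)" unfolding pe by (rule theI)
  then show "\<And>s l x. small_function \<psi> K s \<Longrightarrow> 0 < l \<Longrightarrow> ennreal l < principal_eigenvalue \<psi> K \<Longrightarrow> ?R s l x = \<infinity>"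
    "\<And>s l. small_function \<psi> K s \<Longrightarrow> principal_eigenvalue \<psi> K < ennreal l \<Longrightarrow> AE x in \<psi>. ?R s l x < \<infinity>"
    "0 < principal_eigenvalue \<psi> K"
    unfolding PE_def by blast+
qed

text \<open>
  Small functions may be unbounded, so the estimate of \<open>R\<^sub>l 1\<close> is applied to the truncation
  \<open>min s 1\<close>, which is small as well.
\<close>

lemma principal_eigenvalue_le:
  assumes ex: "small_function \<psi> K s"
    and g [measurable]: "g \<in> borel_measurable borel" and \<eta>: "0 < \<eta>" "\<And>x. ennreal \<eta> \<le> g x"
    and \<rho>: "0 < \<rho>" "\<And>x. kapply K g x \<le> ennreal \<rho> * g x" and fin: "g x0 < \<infinity>"
  shows "principal_eigenvalue \<psi> K \<le> ennreal \<rho>"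
proof (rule ccontr)
  assume "\<not> principal_eigenvalue \<psi> K \<le> ennreal \<rho>"
  then have "ennreal \<rho> < principal_eigenvalue \<psi> K" by simp
  then obtain c where "ennreal \<rho> < c" "c < principal_eigenvalue \<psi> K" using dense by blast
  then obtain l where l: "ennreal \<rho> < ennreal l" "ennreal l < principal_eigenvalue \<psi> K" "0 \<le> l"
    by (cases c) auto
  then have l\<rho>: "\<rho> < l" using \<rho> by (simp add: ennreal_less_iff)
  let ?s = "\<lambda>x. min (s x) 1"
  have "small_function \<psi> K ?s"
  proof -
    have [measurable]: "s \<in> borel_measurable borel" and "\<And>x. 0 \<le> s x" and s: "0 < (\<integral>\<^sup>+ x. ennreal (s x) \<partial>\<psi>)"
      using ex by (auto simp: small_function_def)
    have "0 < (\<integral>\<^sup>+ x. ennreal (?s x) \<partial>\<psi>)"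
    proof (rule ccontr)
      assume "\<not> 0 < (\<integral>\<^sup>+ x. ennreal (?s x) \<partial>\<psi>)"
      then have "AE x in \<psi>. ennreal (?s x) = 0" by (simp add: nn_integral_0_iff_AE)
      then have "AE x in \<psi>. ennreal (s x) = 0" by eventually_elim (auto simp: min_def split: if_splits)
      then have "(\<integral>\<^sup>+ x. ennreal (s x) \<partial>\<psi>) = 0" by (simp add: nn_integral_0_iff_AE)
      with s show False by simp
    qed
    moreover have "ennreal (?s x) * a \<le> b" if "ennreal (s x) * a \<le> b" for x a b
      by (rule order_trans[OF mult_right_mono that]) (auto intro!: ennreal_leI)
    ultimately show ?thesis
      using ex unfolding small_function_def by (auto 4 4)
  qed
  then have "resolvent K l (\<lambda>x. ennreal (?s x)) x0 = \<infinity>"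
    using l \<rho> l\<rho> by (intro principal_eigenvalue_infinite[OF ex]) auto
  moreover have "resolvent K l (\<lambda>x. ennreal (?s x)) x0 \<le> resolvent K l (\<lambda>x. 1) x0"
    using ex by (intro normal_functional_mono[OF normal_resolvent[OF normal]])
      (auto simp: small_function_def ennreal_le_1 intro!: measurable_compose[OF _ measurable_ennreal])
  moreover have "resolvent K l (\<lambda>x. 1) x0 \<le> ennreal (1 / (\<eta> * (l - \<rho>))) * g x0"
    by (rule resolvent_1_le[OF normal g \<eta> \<rho> l\<rho>])
  ultimately show False using fin by (simp add: ennreal_mult_less_top top_unique ennreal_mult_eq_top_iff)
qed

end

section \<open>Kernels with a density with respect to a transition kernel\<close>

definition weighted_kernel ::
    "('a::polish_space \<Rightarrow> 'a measure) \<Rightarrow> ('a \<times> 'a \<Rightarrow> ennreal) \<Rightarrow> 'a \<Rightarrow> 'a measure" where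
  "weighted_kernel P k x = density (P x) (\<lambda>y. k (x, y))"

lemma scaled_kernel_eq: "scaled_kernel P M = weighted_kernel P (\<lambda>z. ennreal (exp (M z)))"
  by (auto simp: scaled_kernel_def weighted_kernel_def)

lemma measurable_borel_Pair:
  fixes f :: "'a::second_countable_topology \<times> 'b::second_countable_topology \<Rightarrow> 'c::topological_space"
  assumes "f \<in> borel_measurable borel"
  shows "(\<lambda>y. f (x, y)) \<in> borel_measurable borel"
    and "(\<lambda>(x, y). f (x, y)) \<in> borel_measurable (borel \<Otimes>\<^sub>M borel)"
proof -
  have "f \<in> borel_measurable (borel \<Otimes>\<^sub>M borel)" using assms by (simp add: borel_prod)
  then show "(\<lambda>y. f (x, y)) \<in> borel_measurable borel" by measurable
  show "(\<lambda>(x, y). f (x, y)) \<in> borel_measurable (borel \<Otimes>\<^sub>M borel)"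
    using \<open>f \<in> borel_measurable (borel \<Otimes>\<^sub>M borel)\<close> by simp
qed

lemma transition_kernelD:
  assumes "transition_kernel P"
  shows "P \<in> borel \<rightarrow>\<^sub>M subprob_algebra borel" "sets (P x) = sets borel" "prob_space (P x)"
    "space (P x) = UNIV"
proof -
  show "P \<in> borel \<rightarrow>\<^sub>M subprob_algebra borel"
    using assms unfolding transition_kernel_def by (rule measurable_prob_algebraD)
  show *: "sets (P x) = sets borel" "prob_space (P x)"
    using measurable_space[OF assms[unfolded transition_kernel_def], of x]
    by (auto simp: space_prob_algebra)
  show "space (P x) = UNIV" using sets_eq_imp_space_eq[OF *(1)] by simp
qed

lemma borel_measurable_nn_integral_kernel:
  fixes f :: "'a::second_countable_topology \<times> 'b::second_countable_topology \<Rightarrow> ennreal"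
  assumes "f \<in> borel_measurable borel" and "L \<in> borel \<rightarrow>\<^sub>M subprob_algebra borel"
  shows "(\<lambda>x. \<integral>\<^sup>+ y. f (x, y) \<partial>L x) \<in> borel_measurable borel"
  by (rule nn_integral_measurable_subprob_algebra2[OF measurable_borel_Pair(2)[OF assms(1)] assms(2)])

lemma measurable_section_product:
  fixes k :: "'a::second_countable_topology \<times> 'b::second_countable_topology \<Rightarrow> ennreal"
  assumes [measurable]: "k \<in> borel_measurable borel" "f \<in> borel_measurable borel"
  shows "(\<lambda>z. k z * f (snd z)) \<in> borel_measurable borel"
proof -
  have "snd \<in> borel_measurable (borel :: ('a \<times> 'b) measure)"
    by (intro borel_measurable_continuous_onI continuous_intros)
  then show ?thesis by measurable
qed

lemma kapply_weighted_kernel: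
  assumes P: "transition_kernel P" and k: "k \<in> borel_measurable borel"
    and f: "f \<in> borel_measurable borel"
  shows "kapply (weighted_kernel P k) f x = (\<integral>\<^sup>+ y. k (x, y) * f y \<partial>P x)"
  unfolding kapply_def weighted_kernel_def
  using f measurable_borel_Pair(1)[OF k, of x]
  by (intro nn_integral_density)
    (simp_all add: measurable_cong_sets[OF transition_kernelD(2)[OF P] refl])

lemma normal_operator_weighted_kernel:
  assumes P: "transition_kernel P" and k: "k \<in> borel_measurable borel"
  shows "normal_operator (kapply (weighted_kernel P k))"
  unfolding normal_operator_def
proof (intro conjI ballI allI)
  fix f :: "'a \<Rightarrow> ennreal" assume f: "f \<in> borel_measurable borel"
  have "(\<lambda>x. \<integral>\<^sup>+ y. k (x, y) * f y \<partial>P x) \<in> borel_measurable borel"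
    using borel_measurable_nn_integral_kernel[OF measurable_section_product[OF k f] transition_kernelD(1)[OF P]]
    by simp
  then show "kapply (weighted_kernel P k) f \<in> borel_measurable borel"
    using kapply_weighted_kernel[OF P k f] by (simp add: fun_eq_iff cong: measurable_cong)
next
  fix x
  show "normal_functional (\<lambda>f. kapply (weighted_kernel P k) f x)"
    unfolding kapply_def
    by (intro normal_functional_nn_integral) (simp add: weighted_kernel_def transition_kernelD[OF P])
qed

lemma weighted_kernel_1: "transition_kernel P \<Longrightarrow> weighted_kernel P (\<lambda>_. 1) = P"
  by (auto simp: weighted_kernel_def density_1)

lemma normal_operator_kernel:
  assumes P: "transition_kernel P"
  shows "normal_operator (kapply P)"
  using normal_operator_weighted_kernel[OF P, of "\<lambda>_. 1"] weighted_kernel_1[OF P] by simp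

lemma kpow_transition_kernel_1:
  assumes P: "transition_kernel P"
  shows "kpow P n (\<lambda>_. c) = (\<lambda>_. c)"
proof (induction n)
  case (Suc n)
  have "kapply P (\<lambda>_. c) x = c" for x
    using prob_space.emeasure_space_1[OF transition_kernelD(3)[OF P, of x]] by (simp add: kapply_def)
  then show ?case using Suc by (auto simp: kpow_Suc)
qed simp

text \<open>
  Because \<open>e\<^sup>M > 0\<close>, the scaled kernel reaches the same sets as the chain.
\<close>

lemma kpow_scaled_kernel_eq_0_iff:
  assumes P: "transition_kernel P" and M: "M \<in> borel_measurable borel"
    and f: "f \<in> borel_measurable borel"
  shows "kpow (scaled_kernel P M) n f x = 0 \<longleftrightarrow> kpow P n f x = 0"
proof (induction n arbitrary: x)
  case (Suc n)
  let ?k = "\<lambda>z. ennreal (exp (M z))"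
  have k: "?k \<in> borel_measurable borel" using M by measurable
  note K = normal_operator_weighted_kernel[OF P k]
  let ?K = "weighted_kernel P ?k"
  note mc = measurable_cong_sets[OF transition_kernelD(2)[OF P] refl]
  have m1: "kpow ?K n f \<in> borel_measurable borel" by (rule measurable_kpow[OF K f])
  have m2: "kpow P n f \<in> borel_measurable borel" by (rule measurable_kpow[OF normal_operator_kernel[OF P] f])
  have "kpow ?K (Suc n) f x = 0 \<longleftrightarrow> (\<integral>\<^sup>+ y. ?k (x, y) * kpow ?K n f y \<partial>P x) = 0"
    by (simp add: kpow_Suc kapply_weighted_kernel[OF P k m1])
  also have "\<dots> \<longleftrightarrow> (AE y in P x. ?k (x, y) * kpow ?K n f y = 0)"
    using m1 measurable_borel_Pair(1)[OF k, of x]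
    by (intro nn_integral_0_iff_AE borel_measurable_times_ennreal) (simp_all add: mc)
  also have "\<dots> \<longleftrightarrow> (AE y in P x. kpow P n f y = 0)"
    using Suc by (simp add: scaled_kernel_eq)
  also have "\<dots> \<longleftrightarrow> kpow P (Suc n) f x = 0"
    using m2 by (subst nn_integral_0_iff_AE[symmetric]) (simp_all add: mc kpow_Suc kapply_def)
  finally show ?case by (simp add: scaled_kernel_eq)
qed simp

lemma irreducible_kernel_scaled:
  assumes P: "transition_kernel P" and \<psi>: "irreducible_aperiodic P \<psi>"
    and M: "M \<in> borel_measurable borel"
  shows "irreducible_kernel \<psi> (scaled_kernel P M)"
proof
  let ?k = "\<lambda>z. ennreal (exp (M z))"
  have k: "?k \<in> borel_measurable borel" using M by measurable
  show "normal_operator (kapply (scaled_kernel P M))"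
    unfolding scaled_kernel_eq by (rule normal_operator_weighted_kernel[OF P k])
  show "sets \<psi> = sets borel" "emeasure \<psi> UNIV \<noteq> 0"
    using \<psi> by (auto simp: irreducible_aperiodic_def)
  fix x
  show "\<exists>n. 0 < kpow (scaled_kernel P M) n (indicator A) x"
    if "A \<in> sets borel" "0 < emeasure \<psi> A" for A
  proof -
    have "\<exists>t0. \<forall>t\<ge>t0. 0 < kpow P t (indicator A) x"
      using \<psi> that unfolding irreducible_aperiodic_def by blast
    then obtain t0 where "\<forall>t\<ge>t0. 0 < kpow P t (indicator A) x" ..
    then have "kpow P t0 (indicator A) x \<noteq> 0" by (auto simp: zero_less_iff_neq_zero)
    then show ?thesis
      using kpow_scaled_kernel_eq_0_iff[OF P M, of "indicator A" t0 x] that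
      by (auto simp: zero_less_iff_neq_zero)
  qed
  show "0 < kapply (scaled_kernel P M) f x"
    if f: "f \<in> borel_measurable borel" and pos: "\<And>y. 0 < f y" for f
  proof -
    interpret prob_space "P x" by (rule transition_kernelD(3)[OF P])
    have "f y \<noteq> 0" for y using pos[of y] by simp
    then have "kpow P 1 f x \<noteq> 0"
      using f by (simp add: kpow_def kapply_def nn_integral_0_iff_AE
          measurable_cong_sets[OF transition_kernelD(2)[OF P] refl])
    then show ?thesis
      using kpow_scaled_kernel_eq_0_iff[OF P M f, of 1 x] by (simp add: kpow_def zero_less_iff_neq_zero)
  qed
qed

section \<open>A two-step minorization\<close>

text \<open>
  A minorization of \<open>\<beta>\<close> by \<open>\<epsilon> \<alpha>\<close> up to an additive error becomes an exact minorization by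
  \<open>(\<epsilon>/2) \<alpha>\<close> outside a set of small \<open>\<alpha>\<close>-measure, namely the set where \<open>\<beta> \<le> (\<epsilon>/2) \<alpha>\<close>.
\<close>

lemma Hahn_minorant:
  assumes \<alpha>: "finite_measure \<alpha>" and \<beta>: "finite_measure \<beta>" and sets: "sets \<alpha> = sets \<beta>"
    and \<epsilon>: "0 < \<epsilon>"
    and le: "\<And>A. A \<in> sets \<alpha> \<Longrightarrow> ennreal \<epsilon> * emeasure \<alpha> A \<le> emeasure \<beta> A + ennreal (\<epsilon> / 8)"
  obtains G where "G \<in> sets \<alpha>" "emeasure \<alpha> (space \<alpha> - G) \<le> ennreal (1 / 4)"
    "\<And>A. A \<in> sets \<alpha> \<Longrightarrow> A \<subseteq> G \<Longrightarrow> ennreal (\<epsilon> / 2) * emeasure \<alpha> A \<le> emeasure \<beta> A"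
proof -
  interpret \<alpha>: finite_measure \<alpha> by fact
  have "finite_measure (scale_measure (ennreal (\<epsilon> / 2)) \<alpha>)"
    by (rule finite_measureI) (simp add: space_scale_measure ennreal_mult_eq_top_iff)
  from finite_unsigned_Hahn_decomposition[OF \<beta> this] sets
  obtain G where G: "G \<in> sets \<alpha>"
    "\<And>A. A \<in> sets \<alpha> \<Longrightarrow> A \<subseteq> G \<Longrightarrow> ennreal (\<epsilon> / 2) * emeasure \<alpha> A \<le> emeasure \<beta> A"
    "\<And>A. A \<in> sets \<alpha> \<Longrightarrow> A \<inter> G = {} \<Longrightarrow> emeasure \<beta> A \<le> ennreal (\<epsilon> / 2) * emeasure \<alpha> A"
    by auto
  let ?N = "space \<alpha> - G"
  have N: "?N \<in> sets \<alpha>" using G by auto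
  have "ennreal \<epsilon> * emeasure \<alpha> ?N \<le> ennreal (\<epsilon> / 2) * emeasure \<alpha> ?N + ennreal (\<epsilon> / 8)"
    using order_trans[OF le[OF N] add_right_mono[OF G(3)[OF N]]] by auto
  then have "ennreal (\<epsilon> * measure \<alpha> ?N) \<le> ennreal (\<epsilon> / 2 * measure \<alpha> ?N + \<epsilon> / 8)"
    using \<epsilon> by (simp add: \<alpha>.emeasure_eq_measure ennreal_mult[symmetric] ennreal_plus[symmetric]
        del: ennreal_plus)
  then have "\<epsilon> * measure \<alpha> ?N \<le> \<epsilon> / 2 * measure \<alpha> ?N + \<epsilon> / 8"
    using \<epsilon> by (subst (asm) ennreal_le_iff) (auto intro!: add_nonneg_nonneg)
  then have "\<epsilon> * (measure \<alpha> ?N) \<le> \<epsilon> * (1 / 4)" by simp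
  then have "measure \<alpha> ?N \<le> 1 / 4" using \<epsilon> by (subst (asm) mult_le_cancel_left_pos)
  then show ?thesis using G by (intro that[of G]) (auto simp: \<alpha>.emeasure_eq_measure intro!: ennreal_leI)
qed

lemma kernel_product_measure:
  fixes \<nu> :: "'a::second_countable_topology measure" and \<kappa> :: "'a \<Rightarrow> 'a measure"
  assumes \<nu>: "sets \<nu> = sets borel" and \<kappa>: "\<kappa> \<in> borel \<rightarrow>\<^sub>M subprob_algebra borel"
    and D: "D \<in> sets borel"
  obtains Q where "sets Q = sets borel"
    "\<And>f. f \<in> borel_measurable borel \<Longrightarrow>
       (\<integral>\<^sup>+ z. f z \<partial>Q) = (\<integral>\<^sup>+ y. indicator D y * (\<integral>\<^sup>+ z. f (y, z) \<partial>\<kappa> y) \<partial>\<nu>)"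
proof -
  have sets: "sets (\<kappa> y) = sets borel" for y
    using measurable_space[OF \<kappa>, of y] by (simp add: space_subprob_algebra)
  note mc = measurable_cong_sets[OF sets refl]
  have m1: "(\<lambda>z. f (y, z)) \<in> borel_measurable (\<kappa> y)" if "f \<in> borel_measurable borel" for f :: "_ \<Rightarrow> ennreal" and y
    using measurable_borel_Pair(1)[OF that] by (simp add: mc)
  have m2: "(\<lambda>y. indicator D y * (\<integral>\<^sup>+ z. f (y, z) \<partial>\<kappa> y)) \<in> borel_measurable \<nu>"
    if "f \<in> borel_measurable borel" for f :: "_ \<Rightarrow> ennreal"
    using borel_measurable_nn_integral_kernel[OF that \<kappa>] D
    by (intro borel_measurable_times_ennreal) (auto simp: measurable_cong_sets[OF \<nu> refl])
  have "normal_functional (\<lambda>f. \<integral>\<^sup>+ y. indicator D y * (\<integral>\<^sup>+ z. f (y, z) \<partial>\<kappa> y) \<partial>\<nu>)"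
    unfolding normal_functional_def
  proof (intro conjI ballI allI impI)
    fix f g :: "'a \<times> 'a \<Rightarrow> ennreal" and c
    assume f: "f \<in> borel_measurable borel"
    show "(\<integral>\<^sup>+ y. indicator D y * (\<integral>\<^sup>+ z. c * f (y, z) \<partial>\<kappa> y) \<partial>\<nu>) =
        c * (\<integral>\<^sup>+ y. indicator D y * (\<integral>\<^sup>+ z. f (y, z) \<partial>\<kappa> y) \<partial>\<nu>)"
      by (simp add: nn_integral_cmult m1 m2 f mult.left_commute[of _ c])
    assume g: "g \<in> borel_measurable borel"
    show "(\<integral>\<^sup>+ y. indicator D y * (\<integral>\<^sup>+ z. f (y, z) + g (y, z) \<partial>\<kappa> y) \<partial>\<nu>) =
        (\<integral>\<^sup>+ y. indicator D y * (\<integral>\<^sup>+ z. f (y, z) \<partial>\<kappa> y) \<partial>\<nu>) +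
        (\<integral>\<^sup>+ y. indicator D y * (\<integral>\<^sup>+ z. g (y, z) \<partial>\<kappa> y) \<partial>\<nu>)"
      by (simp add: nn_integral_add m1 m2 f g distrib_left)
  next
    fix f :: "nat \<Rightarrow> 'a \<times> 'a \<Rightarrow> ennreal"
    assume f: "\<forall>i. f i \<in> borel_measurable borel" "incseq f"
    have inc1: "incseq (\<lambda>i z. f i (y, z))" for y
      using f(2) by (auto simp: incseq_def le_fun_def)
    have inc2: "incseq (\<lambda>i y. indicator D y * (\<integral>\<^sup>+ z. f i (y, z) \<partial>\<kappa> y))"
      using f(2) by (auto simp: incseq_def le_fun_def intro!: mult_left_mono nn_integral_mono)
    show "(\<integral>\<^sup>+ y. indicator D y * (\<integral>\<^sup>+ z. (SUP i. f i (y, z)) \<partial>\<kappa> y) \<partial>\<nu>) =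
        (SUP i. \<integral>\<^sup>+ y. indicator D y * (\<integral>\<^sup>+ z. f i (y, z) \<partial>\<kappa> y) \<partial>\<nu>)"
      using f by (simp add: nn_integral_monotone_convergence_SUP[OF inc1] m1
          SUP_mult_left_ennreal nn_integral_monotone_convergence_SUP[OF inc2] m2)
  qed
  then show ?thesis by (rule normal_functional_measure) (rule that)
qed

lemma ennreal_le_diff_add: "a \<le> a - b + (b :: ennreal)"
proof (cases "b \<le> a")
  case True
  then show ?thesis by (simp add: diff_add_cancel_ennreal)
next
  case False
  then have "a \<le> b" by simp
  then show ?thesis by (simp add: add_increasing)
qed

text \<open>
  A single step of \<open>U\<close> from \<open>x \<in> D\<close> dominates \<open>(\<epsilon>/2) \<nu>\<close> only on a set \<open>G\<^sub>x\<close> that depends on \<open>x\<close>, with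
  \<open>\<nu>(G\<^sub>x\<^sup>c) \<le> 1/4\<close>. For the second step, the same argument is applied to the measure
  \<open>1\<^sub>D(y) \<nu>(dy) U(y,dz)\<close> on the product space, which yields a measurable set \<open>G\<close> of pairs and
  avoids choosing densities of \<open>U(y,\<cdot>)\<close> measurably in \<open>y\<close>. A point \<open>z\<close> is good if the \<open>y \<in> D\<close> with
  \<open>(y,z) \<in> G\<close> have \<open>\<nu>\<close>-measure \<open>g(z) > 1/4\<close>: then \<open>G\<^sub>x\<close> cannot miss them all, and the two-step kernel
  has density at least \<open>(\<epsilon>/2)\<^sup>2 (g(z) - 1/4)\<close>, whatever \<open>x\<close>. The constants leave room:
  \<open>\<nu>(g) \<ge> 7/8 - 1/4\<close>.
\<close>

lemma two_step_minorization:
  fixes U :: "'a::second_countable_topology \<Rightarrow> 'a measure"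
  assumes U: "U \<in> borel \<rightarrow>\<^sub>M subprob_algebra borel"
    and \<nu>: "sets \<nu> = sets borel" "prob_space \<nu>"
    and D: "D \<in> sets borel" "ennreal (7 / 8) \<le> emeasure \<nu> D" and \<epsilon>: "0 < \<epsilon>"
    and le: "\<And>x A. x \<in> D \<Longrightarrow> A \<in> sets borel \<Longrightarrow>
               ennreal \<epsilon> * emeasure \<nu> A \<le> emeasure (U x) A + ennreal (\<epsilon> / 8)"
  obtains \<mu> where "sets \<mu> = sets borel" "emeasure \<mu> UNIV \<noteq> 0"
    "\<And>x A. x \<in> D \<Longrightarrow> A \<in> sets borel \<Longrightarrow> emeasure \<mu> A \<le> (\<integral>\<^sup>+ y. emeasure (U y) A \<partial>U x)"
proof -
  interpret \<nu>: prob_space \<nu> by fact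
  note [measurable_cong] = \<nu>(1) and [measurable] = D(1)
  have space_\<nu>: "space \<nu> = UNIV" using sets_eq_imp_space_eq[OF \<nu>(1)] by simp
  have sets_U: "sets (U y) = sets borel" and sub_U: "subprob_space (U y)" for y
    using measurable_space[OF U, of y] by (auto simp: space_subprob_algebra)
  note [measurable_cong] = sets_U
  have const: "(\<lambda>_. \<nu>) \<in> borel \<rightarrow>\<^sub>M subprob_algebra borel"
    using \<nu> by (auto simp: space_subprob_algebra intro!: measurable_const prob_space_imp_subprob_space)
  obtain Q where Q: "sets Q = sets borel"
    "\<And>f. f \<in> borel_measurable borel \<Longrightarrow>
       (\<integral>\<^sup>+ z. f z \<partial>Q) = (\<integral>\<^sup>+ y. indicator D y * (\<integral>\<^sup>+ z. f (y, z) \<partial>U y) \<partial>\<nu>)"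
    using kernel_product_measure[OF \<nu>(1) U D(1)] by blast
  obtain N where N: "sets N = sets borel"
    "\<And>f. f \<in> borel_measurable borel \<Longrightarrow>
       (\<integral>\<^sup>+ z. f z \<partial>N) = (\<integral>\<^sup>+ y. indicator D y * (\<integral>\<^sup>+ z. f (y, z) \<partial>\<nu>) \<partial>\<nu>)"
    using kernel_product_measure[OF \<nu>(1) const D(1)] by blast
  have slice: "(\<integral>\<^sup>+ z. indicator H (y, z) \<partial>m) = emeasure m (Pair y -` H)" and
    slice_sets: "Pair y -` H \<in> sets borel"
    if H: "H \<in> sets borel" and m: "sets m = sets borel" for H :: "('a \<times> 'a) set" and y m
  proof -
    have "H \<in> sets (borel \<Otimes>\<^sub>M borel)" using H by (simp only: borel_prod)
    then show "Pair y -` H \<in> sets borel" by (rule sets_Pair1)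
    then have "Pair y -` H \<in> sets m" using m by simp
    moreover have "(\<lambda>z. indicator H (y, z)) = (indicator (Pair y -` H) :: _ \<Rightarrow> ennreal)"
      by (auto simp: indicator_def)
    ultimately show "(\<integral>\<^sup>+ z. indicator H (y, z) \<partial>m) = emeasure m (Pair y -` H)" by simp
  qed
  have emQ: "emeasure Q H = (\<integral>\<^sup>+ y. indicator D y * emeasure (U y) (Pair y -` H) \<partial>\<nu>)"
    and emN: "emeasure N H = (\<integral>\<^sup>+ y. indicator D y * emeasure \<nu> (Pair y -` H) \<partial>\<nu>)"
    if H: "H \<in> sets borel" for H
    using Q(2)[of "indicator H"] N(2)[of "indicator H"] Q(1) N(1) \<nu>(1) that slice[OF H]
    by (simp_all add: sets_U)
  have le1: "indicator D y * m \<le> (1::ennreal)" if "m \<le> 1" for y m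
    using that by (auto simp: indicator_def)
  have spaceQN: "space Q = UNIV" "space N = UNIV"
    using sets_eq_imp_space_eq[OF Q(1)] sets_eq_imp_space_eq[OF N(1)] by auto
  have int1: "(\<integral>\<^sup>+ y. f y \<partial>\<nu>) \<le> 1" if "\<And>y. f y \<le> 1" for f :: "'a \<Rightarrow> ennreal"
    using nn_integral_mono[of \<nu> f "\<lambda>_. 1"] that \<nu>.emeasure_space_1 by simp
  have borel_UNIV: "UNIV \<in> sets (borel :: ('a \<times> 'a) measure)" by simp
  have "emeasure Q UNIV \<le> 1" "emeasure N UNIV \<le> 1"
    unfolding emQ[OF borel_UNIV] emN[OF borel_UNIV]
    using subprob_space.subprob_emeasure_le_1[OF sub_U]
    by (auto intro!: int1 le1 \<nu>.measure_le_1 simp: \<nu>.emeasure_eq_measure)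
  then have fin: "finite_measure Q" "finite_measure N"
    by (auto intro!: finite_measureI simp: spaceQN top_unique)
  have "ennreal \<epsilon> * emeasure N H \<le> emeasure Q H + ennreal (\<epsilon> / 8)" if "H \<in> sets N" for H
  proof -
    have H: "H \<in> sets borel" using that N by simp
    have mU: "(\<lambda>y. emeasure (U y) (Pair y -` H)) \<in> borel_measurable borel"
      using borel_measurable_nn_integral_kernel[OF _ U, of "indicator H"] H
      by (simp add: slice sets_U)
    have mN: "(\<lambda>y. emeasure \<nu> (Pair y -` H)) \<in> borel_measurable borel"
      using borel_measurable_nn_integral_kernel[OF _ const, of "indicator H"] H
      by (simp add: slice \<nu>)
    note [measurable] = mU mN
    have "ennreal \<epsilon> * emeasure N H = (\<integral>\<^sup>+ y. indicator D y * (ennreal \<epsilon> * emeasure \<nu> (Pair y -` H)) \<partial>\<nu>)"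
      unfolding emN[OF H] by (simp add: nn_integral_cmult[symmetric] mult.left_commute)
    also have "\<dots> \<le> (\<integral>\<^sup>+ y. indicator D y * emeasure (U y) (Pair y -` H) + ennreal (\<epsilon> / 8) \<partial>\<nu>)"
      using le slice_sets[OF H \<nu>(1)] by (intro nn_integral_mono) (auto simp: indicator_def)
    also have "\<dots> = emeasure Q H + ennreal (\<epsilon> / 8)"
      unfolding emQ[OF H] by (subst nn_integral_add) (auto simp: \<nu>.emeasure_space_1)
    finally show ?thesis .
  qed
  from Hahn_minorant[OF fin(2,1) _ \<epsilon> this] Q(1) N(1) obtain G where
    G [measurable]: "G \<in> sets borel" and G_compl: "emeasure N (UNIV - G) \<le> ennreal (1 / 4)" and
    G_le: "\<And>A. A \<in> sets borel \<Longrightarrow> A \<subseteq> G \<Longrightarrow> ennreal (\<epsilon> / 2) * emeasure N A \<le> emeasure Q A"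
    by (auto simp: spaceQN)
  have G2: "G \<in> sets (borel \<Otimes>\<^sub>M borel)" using G by (simp only: borel_prod)
  note G2[measurable]
  interpret pair_sigma_finite \<nu> \<nu> ..
  define g where "g z = (\<integral>\<^sup>+ y. indicator D y * indicator G (y, z) \<partial>\<nu>)" for z
  have g_meas [measurable]: "g \<in> borel_measurable borel"
    unfolding g_def by measurable
  have "(\<integral>\<^sup>+ z. g z \<partial>\<nu>) = emeasure N G"
  proof -
    have "(\<integral>\<^sup>+ z. g z \<partial>\<nu>) = (\<integral>\<^sup>+ y. \<integral>\<^sup>+ z. indicator D y * indicator G (y, z) \<partial>\<nu> \<partial>\<nu>)"
      unfolding g_def by (rule Fubini') measurable
    also have "\<dots> = emeasure N G"
      using N(2)[of "indicator G"] N(1) by (simp add: nn_integral_cmult)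
    finally show ?thesis .
  qed
  moreover have "ennreal (7 / 8) \<le> emeasure N G + ennreal (1 / 4)"
  proof -
    have "ennreal (7 / 8) \<le> emeasure N UNIV"
      using D(2) by (simp add: emN \<nu>.emeasure_space_1 space_\<nu>[symmetric])
    also have "\<dots> = emeasure N G + emeasure N (UNIV - G)"
      using N(1) by (subst plus_emeasure) (auto simp: Un_Diff_cancel)
    finally show ?thesis using G_compl by (metis add_left_mono order_trans)
  qed
  ultimately have g_int: "ennreal (7 / 8) \<le> (\<integral>\<^sup>+ z. g z \<partial>\<nu>) + ennreal (1 / 4)" by simp
  let ?h = "\<lambda>z. g z - ennreal (1 / 4)"
  have h_nz: "(\<integral>\<^sup>+ z. ?h z \<partial>\<nu>) \<noteq> 0"
  proof
    assume 0: "(\<integral>\<^sup>+ z. ?h z \<partial>\<nu>) = 0"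
    have "(\<integral>\<^sup>+ z. g z \<partial>\<nu>) \<le> (\<integral>\<^sup>+ z. ?h z + ennreal (1 / 4) \<partial>\<nu>)"
      by (intro nn_integral_mono ennreal_le_diff_add)
    also have "\<dots> = ennreal (1 / 4)"
      using 0 by (subst nn_integral_add) (auto simp: \<nu>.emeasure_space_1)
    finally have "ennreal (7 / 8) \<le> ennreal (1 / 4) + ennreal (1 / 4)"
      using g_int by (metis add_right_mono order_trans)
    also have "\<dots> = ennreal (1 / 2)" by (subst ennreal_plus[symmetric]) auto
    finally show False by (subst (asm) ennreal_le_iff) auto
  qed
  define \<mu> where "\<mu> = density \<nu> (\<lambda>z. ennreal (\<epsilon> / 2) * (ennreal (\<epsilon> / 2) * ?h z))"
  show ?thesis
  proof (rule that[of \<mu>])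
    show "sets \<mu> = sets borel" by (simp add: \<mu>_def \<nu>)
    have "emeasure \<mu> UNIV = ennreal (\<epsilon> / 2) * (ennreal (\<epsilon> / 2) * (\<integral>\<^sup>+ z. ?h z \<partial>\<nu>))"
      unfolding \<mu>_def using \<nu>(1) by (subst emeasure_density) (auto simp: nn_integral_cmult space_\<nu>)
    then show "emeasure \<mu> UNIV \<noteq> 0" using h_nz \<epsilon> by (simp add: ennreal_eq_0_iff)
  next
    fix x :: 'a and A :: "'a set" assume x: "x \<in> D" and A [measurable]: "A \<in> sets borel"
    have finU: "finite_measure (U x)" using sub_U[of x] by (rule subprob_space.axioms)
    from Hahn_minorant[OF _ finU _ \<epsilon>, of \<nu>] le[OF x] obtain Gx where
      Gx [measurable]: "Gx \<in> sets borel" and Gx_compl: "emeasure \<nu> (UNIV - Gx) \<le> ennreal (1 / 4)" and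
      Gx_le: "\<And>A. A \<in> sets borel \<Longrightarrow> A \<subseteq> Gx \<Longrightarrow> ennreal (\<epsilon> / 2) * emeasure \<nu> A \<le> emeasure (U x) A"
      using \<nu>.finite_measure_axioms by (auto simp: space_\<nu> \<nu>(1) sets_U)
    have UA [measurable]: "(\<lambda>y. emeasure (U y) A) \<in> borel_measurable borel"
      using U A by (rule measurable_emeasure_kernel)
    have "ennreal (\<epsilon> / 2) * (\<integral>\<^sup>+ y. emeasure (U y) A \<partial>density \<nu> (indicator Gx)) \<le>
        (\<integral>\<^sup>+ y. emeasure (U y) A \<partial>U x)"
    proof (rule normal_functional_le_nn_integral[OF normal_functional_nn_integral])
      fix B :: "'a set" assume [measurable]: "B \<in> sets borel"
      have "ennreal (\<epsilon> / 2) * emeasure (density \<nu> (indicator Gx)) B = ennreal (\<epsilon> / 2) * emeasure \<nu> (Gx \<inter> B)"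
        by (simp add: emeasure_density nn_integral_indicator indicator_inter_arith[symmetric])
      also have "\<dots> \<le> emeasure (U x) (Gx \<inter> B)" by (rule Gx_le) auto
      also have "\<dots> \<le> emeasure (U x) B" by (intro emeasure_mono) auto
      finally show "ennreal (\<epsilon> / 2) * emeasure (density \<nu> (indicator Gx)) B \<le> (\<integral>\<^sup>+ y. indicator B y \<partial>U x)"
        by simp
    qed (simp_all add: \<nu> sets_U UA)
    also have "(\<integral>\<^sup>+ y. emeasure (U y) A \<partial>density \<nu> (indicator Gx)) =
        (\<integral>\<^sup>+ y. indicator Gx y * emeasure (U y) A \<partial>\<nu>)"
      by (simp add: nn_integral_density)
    finally have 1: "ennreal (\<epsilon> / 2) * (\<integral>\<^sup>+ y. indicator Gx y * emeasure (U y) A \<partial>\<nu>) \<le>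
        (\<integral>\<^sup>+ y. emeasure (U y) A \<partial>U x)" .
    let ?H = "(Gx \<times> A) \<inter> G"
    have "Gx \<times> A \<in> sets (borel \<Otimes>\<^sub>M borel)" by measurable
    then have H [measurable]: "?H \<in> sets borel" using G by (intro sets.Int) (simp_all only: borel_prod)
    have "emeasure Q ?H \<le> (\<integral>\<^sup>+ y. indicator Gx y * emeasure (U y) A \<partial>\<nu>)"
      unfolding emQ[OF H]
      by (intro nn_integral_mono) (auto simp: indicator_def sets_U intro!: emeasure_mono)
    then have 2: "ennreal (\<epsilon> / 2) * emeasure N ?H \<le> (\<integral>\<^sup>+ y. indicator Gx y * emeasure (U y) A \<partial>\<nu>)"
      using G_le[OF H] by auto
    have "emeasure N ?H = (\<integral>\<^sup>+ z. \<integral>\<^sup>+ y. indicator D y * indicator ?H (y, z) \<partial>\<nu> \<partial>\<nu>)"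
    proof -
      have "?H \<in> sets (borel \<Otimes>\<^sub>M borel)" using H by (simp only: borel_prod)
      note [measurable] = this
      have "emeasure N ?H = (\<integral>\<^sup>+ y. \<integral>\<^sup>+ z. indicator D y * indicator ?H (y, z) \<partial>\<nu> \<partial>\<nu>)"
        using N(2)[of "indicator ?H"] N(1) H by (simp add: nn_integral_cmult)
      also have "\<dots> = (\<integral>\<^sup>+ z. \<integral>\<^sup>+ y. indicator D y * indicator ?H (y, z) \<partial>\<nu> \<partial>\<nu>)"
        by (rule Fubini'[symmetric]) measurable
      finally show ?thesis .
    qed
    moreover have "?h z * indicator A z \<le> (\<integral>\<^sup>+ y. indicator D y * indicator ?H (y, z) \<partial>\<nu>)" for z
    proof (cases "z \<in> A")
      case True
      have [measurable]: "(\<lambda>y. indicator ?H (y, z) :: ennreal) \<in> borel_measurable borel"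
        "(\<lambda>y. indicator G (y, z) :: ennreal) \<in> borel_measurable borel"
        by (rule measurable_compose[of "\<lambda>y. (y, z)" borel borel]; simp add: borel_prod[symmetric])+
      have "g z \<le> (\<integral>\<^sup>+ y. indicator D y * indicator ?H (y, z) + indicator (UNIV - Gx) y \<partial>\<nu>)"
        unfolding g_def using True by (intro nn_integral_mono) (auto simp: indicator_def)
      also have "\<dots> = (\<integral>\<^sup>+ y. indicator D y * indicator ?H (y, z) \<partial>\<nu>) + emeasure \<nu> (UNIV - Gx)"
        by (subst nn_integral_add) auto
      also have "\<dots> \<le> (\<integral>\<^sup>+ y. indicator D y * indicator ?H (y, z) \<partial>\<nu>) + ennreal (1 / 4)"
        by (intro add_left_mono Gx_compl)
      finally show ?thesis using True by (simp add: ennreal_minus_le_iff add.commute)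
    qed auto
    ultimately have 3: "(\<integral>\<^sup>+ z. ?h z * indicator A z \<partial>\<nu>) \<le> emeasure N ?H"
      by (simp add: nn_integral_mono)
    have "emeasure \<mu> A = ennreal (\<epsilon> / 2) * (ennreal (\<epsilon> / 2) * (\<integral>\<^sup>+ z. ?h z * indicator A z \<partial>\<nu>))"
      unfolding \<mu>_def by (subst emeasure_density) (auto simp: nn_integral_cmult mult.assoc)
    also have "\<dots> \<le> ennreal (\<epsilon> / 2) * (ennreal (\<epsilon> / 2) * emeasure N ?H)"
      by (intro mult_left_mono 3) auto
    also have "\<dots> \<le> ennreal (\<epsilon> / 2) * (\<integral>\<^sup>+ y. indicator Gx y * emeasure (U y) A \<partial>\<nu>)"
      by (intro mult_left_mono 2) auto
    also note 1
    finally show "emeasure \<mu> A \<le> (\<integral>\<^sup>+ y. emeasure (U y) A \<partial>U x)" .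
  qed
qed

section \<open>Existence of small functions\<close>

text \<open>
  The chain killed on leaving \<open>{w \<le> j}\<close>.
\<close>

definition truncated_kernel ::
    "('a::polish_space \<Rightarrow> 'a measure) \<Rightarrow> ('a \<Rightarrow> real) \<Rightarrow> nat \<Rightarrow> 'a \<Rightarrow> 'a measure" where
  "truncated_kernel P w j =
     weighted_kernel P (indicator ({x. w x \<le> real j} \<times> {y. w y \<le> real j}))"

context
  fixes P :: "'a::polish_space \<Rightarrow> 'a measure" and w :: "'a \<Rightarrow> real"
  assumes P: "transition_kernel P" and w [measurable]: "w \<in> borel_measurable borel"
begin

lemma truncation_measurable:
  "indicator ({x. w x \<le> real j} \<times> {y. w y \<le> real j}) \<in> borel_measurable borel"
proof -
  have "{x. w x \<le> real j} \<times> {y. w y \<le> real j} \<in> sets (borel \<Otimes>\<^sub>M borel)" by measurable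
  then show ?thesis by (intro borel_measurable_indicator) (simp only: borel_prod)
qed

lemma normal_operator_truncated_kernel: "normal_operator (kapply (truncated_kernel P w j))"
  unfolding truncated_kernel_def by (rule normal_operator_weighted_kernel[OF P truncation_measurable])

lemma kapply_truncated_kernel:
  assumes "f \<in> borel_measurable borel"
  shows "kapply (truncated_kernel P w j) f x =
    (\<integral>\<^sup>+ y. indicator ({x. w x \<le> real j} \<times> {y. w y \<le> real j}) (x, y) * f y \<partial>P x)"
  unfolding truncated_kernel_def by (rule kapply_weighted_kernel[OF P truncation_measurable assms])

lemma kpow_truncated_kernel_SUP:
  assumes f [measurable]: "f \<in> borel_measurable borel"
  shows "incseq (\<lambda>j. kpow (truncated_kernel P w j) n f x) \<and>
    (SUP j. kpow (truncated_kernel P w j) n f x) = kpow P n f x"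
proof (induction n arbitrary: x)
  case 0
  show ?case by (simp add: incseq_def)
next
  case (Suc n)
  note Suc = Suc[THEN conjunct1] Suc[THEN conjunct2]
  let ?a = "\<lambda>j y. kpow (truncated_kernel P w j) n f y"
  let ?k = "\<lambda>j y. indicator ({x. w x \<le> real j} \<times> {y. w y \<le> real j}) (x, y) :: ennreal"
  have a [measurable]: "?a j \<in> borel_measurable borel" for j
    by (rule measurable_kpow[OF normal_operator_truncated_kernel f])
  have k [measurable]: "?k j \<in> borel_measurable borel" for j
    by (rule measurable_borel_Pair(1)[OF truncation_measurable])
  have eq: "kpow (truncated_kernel P w j) (Suc n) f x = (\<integral>\<^sup>+ y. ?k j y * ?a j y \<partial>P x)" for j
    by (simp add: kpow_Suc kapply_truncated_kernel)
  have inc: "incseq (\<lambda>j y. ?k j y * ?a j y)"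
  proof (intro incseq_SucI le_funI mult_mono)
    show "?k j y \<le> ?k (Suc j) y" for j y by (auto simp: indicator_def)
    show "?a j y \<le> ?a (Suc j) y" for j y using Suc(1)[of y] by (auto simp: incseq_Suc_iff)
  qed auto
  have sup: "(SUP j. ?k j y * ?a j y) = kpow P n f y" for y
  proof (rule antisym)
    show "(SUP j. ?k j y * ?a j y) \<le> kpow P n f y"
      unfolding Suc(2)[of y, symmetric]
      by (intro SUP_mono) (auto simp: indicator_def)
    have "?a i y \<le> (SUP j. ?k j y * ?a j y)" for i
    proof -
      obtain j where j: "w x \<le> real j" "w y \<le> real j" using real_arch_simple[of "max (w x) (w y)"] by auto
      then have "?k (max i j) y = 1" by (auto simp: indicator_def)
      then have "?a i y \<le> ?k (max i j) y * ?a (max i j) y"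
        using incseqD[OF Suc(1)[of y], of i "max i j"] by simp
      also have "\<dots> \<le> (SUP j. ?k j y * ?a j y)" by (rule SUP_upper) simp
      finally show ?thesis .
    qed
    then show "kpow P n f y \<le> (SUP j. ?k j y * ?a j y)"
      unfolding Suc(2)[of y, symmetric] by (rule SUP_least)
  qed
  have incSuc: "incseq (\<lambda>j. kpow (truncated_kernel P w j) (Suc n) f x)"
    unfolding eq using inc by (auto simp: incseq_def le_fun_def intro!: nn_integral_mono)
  have "(SUP j. kpow (truncated_kernel P w j) (Suc n) f x) = (\<integral>\<^sup>+ y. (SUP j. ?k j y * ?a j y) \<partial>P x)"
      unfolding eq
      by (rule nn_integral_monotone_convergence_SUP[OF inc, symmetric])
        (simp add: measurable_cong_sets[OF transition_kernelD(2)[OF P] refl])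
    also have "\<dots> = kpow P (Suc n) f x" by (simp add: sup kpow_Suc kapply_def)
    finally have "(SUP j. kpow (truncated_kernel P w j) (Suc n) f x) = kpow P (Suc n) f x" .
  with incSuc show ?case ..
qed

text \<open>
  Along a killed path each factor \<open>e\<^sup>M\<close> is at least \<open>e\<^sup>-\<^sup>2\<^sup>j\<close>.
\<close>

lemma kpow_truncated_kernel_le:
  assumes M [measurable]: "M \<in> borel_measurable borel"
    and bound: "\<And>x y. \<bar>M (x, y)\<bar> \<le> w x + w y"
    and f [measurable]: "f \<in> borel_measurable borel"
  shows "kpow (truncated_kernel P w j) n f x \<le> ennreal (exp (2 * real j) ^ n) * kpow (scaled_kernel P M) n f x"
proof (induction n arbitrary: x)
  case (Suc n)
  have k: "(\<lambda>z. ennreal (exp (M z))) \<in> borel_measurable borel" by measurable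
  have K: "normal_operator (kapply (scaled_kernel P M))"
    unfolding scaled_kernel_eq by (rule normal_operator_weighted_kernel[OF P k])
  have a [measurable]: "kpow (truncated_kernel P w j) n f \<in> borel_measurable borel"
    by (rule measurable_kpow[OF normal_operator_truncated_kernel f])
  have a' [measurable]: "kpow (scaled_kernel P M) n f \<in> borel_measurable borel"
    by (rule measurable_kpow[OF K f])
  have "kpow (truncated_kernel P w j) (Suc n) f x \<le>
      (\<integral>\<^sup>+ y. ennreal (exp (M (x, y))) * (ennreal (exp (2 * real j) ^ Suc n) * kpow (scaled_kernel P M) n f y) \<partial>P x)"
    unfolding kpow_Suc kapply_truncated_kernel[OF a]
  proof (intro nn_integral_mono)
    fix y
    show "indicator ({x. w x \<le> real j} \<times> {y. w y \<le> real j}) (x, y) * kpow (truncated_kernel P w j) n f y \<le>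
      ennreal (exp (M (x, y))) * (ennreal (exp (2 * real j) ^ Suc n) * kpow (scaled_kernel P M) n f y)"
    proof (cases "w x \<le> real j \<and> w y \<le> real j")
      case True
      then have "0 \<le> M (x, y) + 2 * real j" using bound[of x y] by linarith
      then have "1 \<le> exp (M (x, y)) * exp (2 * real j)" by (simp add: exp_add[symmetric])
      then have "1 * exp (2 * real j) ^ n \<le> (exp (M (x, y)) * exp (2 * real j)) * exp (2 * real j) ^ n"
        by (intro mult_right_mono) auto
      then have "ennreal (exp (2 * real j) ^ n) \<le> ennreal (exp (M (x, y))) * ennreal (exp (2 * real j) ^ Suc n)"
        by (subst ennreal_mult[symmetric]) (auto intro!: ennreal_leI simp: mult.assoc)
      then have "ennreal (exp (2 * real j) ^ n) * kpow (scaled_kernel P M) n f y \<le>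
          ennreal (exp (M (x, y))) * ennreal (exp (2 * real j) ^ Suc n) * kpow (scaled_kernel P M) n f y"
        by (rule mult_right_mono) simp
      with Suc[of y] True show ?thesis by (simp add: mult.assoc)
    qed (auto simp: indicator_def)
  qed
  also have "\<dots> = kapply (scaled_kernel P M) (\<lambda>y. ennreal (exp (2 * real j) ^ Suc n) * kpow (scaled_kernel P M) n f y) x"
    unfolding scaled_kernel_eq by (subst kapply_weighted_kernel[OF P k]) (simp_all add: scaled_kernel_eq[symmetric])
  also have "\<dots> = ennreal (exp (2 * real j) ^ Suc n) * kpow (scaled_kernel P M) (Suc n) f x"
    by (simp add: normal_functional_cmult[OF normal_kapply[OF K]] kpow_Suc)
  finally show ?case .
qed simp

end

text \<open>
  The minorizing kernel \<open>\<Sum>\<^sub>t c\<^sub>t P\<^sup>t\<^sup>+\<^sup>n\<close> is the increasing limit of its truncations \<open>F\<^sub>j\<close>, which use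
  only \<open>t < j\<close> and paths in \<open>{w \<le> j}\<close>. On the part \<open>D\<^sub>j\<close> of \<open>C\<close> where at most \<open>\<epsilon>/8\<close> of the total mass \<open>1\<close>
  is lost, the minorization by \<open>\<epsilon> \<nu>\<close> survives up to that error, and \<open>D\<^sub>j\<close> increases to \<open>C\<close>. The
  two-step minorization applies to \<open>F\<^sub>j\<close>, and \<open>F\<^sub>j\<close> is dominated by a multiple of every resolvent
  of the scaled kernel. The small function is a resolvent of the indicator of \<open>D\<^sub>j\<close> rather than
  the indicator itself, which makes it easy to see that its \<open>\<psi>\<close>-integral is positive for large
  \<open>j\<close>.
\<close>

lemma ex_small_function_scaled_kernel:
  assumes P: "transition_kernel P" and \<psi>: "irreducible_aperiodic P \<psi>"
    and M [measurable]: "M \<in> borel_measurable borel"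
    and w [measurable]: "w \<in> borel_measurable borel"
    and bound: "\<And>x y. \<bar>M (x, y)\<bar> \<le> w x + w y"
    and C [measurable]: "C \<in> sets borel"
    and \<nu>: "sets \<nu> = sets borel" "prob_space \<nu>" "emeasure \<nu> C = 1"
    and \<epsilon>: "0 < \<epsilon>" and c: "(\<Sum>t. c t) = (1::ennreal)"
    and minor: "\<And>x A. x \<in> C \<Longrightarrow> A \<in> sets borel \<Longrightarrow>
       ennreal \<epsilon> * emeasure \<nu> A \<le> (\<Sum>t. c t * kpow P (t + n) (indicator A) x)"
    and reach: "\<And>x. \<exists>t. kpow P t (indicator C) x \<noteq> 0"
    and l: "0 < l" and fin: "\<And>x. resolvent (scaled_kernel P M) l (\<lambda>_. 1) x < \<infinity>"
  shows "\<exists>s. small_function \<psi> (scaled_kernel P M) s"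
proof -
  let ?K = "scaled_kernel P M"
  interpret irreducible_kernel \<psi> ?K by (rule irreducible_kernel_scaled[OF P \<psi> M])
  interpret \<nu>: prob_space \<nu> by (rule \<nu>(2))
  note normal_T = normal_operator_truncated_kernel[OF P w]
  let ?T = "truncated_kernel P w"
  note [measurable] = measurable_kpow[OF normal_T] measurable_R
  \<comment> \<open>The coefficients are cut to \<open>0\<close> rather than the sum restricted, so that monotone convergence in
    \<open>j\<close> can be applied term by term.\<close>
  define F where "F j x f = (\<Sum>t. (if t < j then c t else 0) * kpow (?T j) (t + n) f x)" for j x f
  have F_normal: "normal_functional (F j x)" for j x
    unfolding F_def by (intro normal_functional_weighted_suminf normal_kpow normal_T)
  have F_meas [measurable]: "(\<lambda>x. F j x f) \<in> borel_measurable borel" if [measurable]: "f \<in> borel_measurable borel" for j f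
    unfolding F_def by measurable
  have F_inc: "incseq (\<lambda>j. F j x f)" and F_SUP: "(SUP j. F j x f) = (\<Sum>t. c t * kpow P (t + n) f x)"
    if f: "f \<in> borel_measurable borel" for f x
  proof -
    note T = kpow_truncated_kernel_SUP[OF P w f, THEN conjunct1]
      kpow_truncated_kernel_SUP[OF P w f, THEN conjunct2]
    have inc: "incseq (\<lambda>j. (if t < j then c t else 0) * kpow (?T j) (t + n) f x)" for t
      using T(1)[of "t + n" x] by (auto simp: incseq_Suc_iff intro!: mult_mono)
    then show "incseq (\<lambda>j. F j x f)"
      unfolding F_def by (auto simp: incseq_Suc_iff intro!: suminf_le)
    have "(SUP j. (if t < j then c t else 0) * kpow (?T j) (t + n) f x) = c t * kpow P (t + n) f x" for t
      unfolding T(2)[symmetric] SUP_mult_left_ennreal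
    proof (rule antisym)
      show "(SUP j. (if t < j then c t else 0) * kpow (?T j) (t + n) f x) \<le> (SUP j. c t * kpow (?T j) (t + n) f x)"
        by (intro SUP_mono) auto
      show "(SUP j. c t * kpow (?T j) (t + n) f x) \<le> (SUP j. (if t < j then c t else 0) * kpow (?T j) (t + n) f x)"
      proof (rule SUP_mono)
        fix j
        show "\<exists>i\<in>UNIV. c t * kpow (?T j) (t + n) f x \<le> (if t < i then c t else 0) * kpow (?T i) (t + n) f x"
          using incseqD[OF T(1)[of "t + n" x], of j "max j (Suc t)"]
          by (intro bexI[of _ "max j (Suc t)"]) (auto intro!: mult_left_mono)
      qed
    qed
    then show "(SUP j. F j x f) = (\<Sum>t. c t * kpow P (t + n) f x)"
      unfolding F_def by (simp add: ennreal_suminf_SUP_eq[OF inc, symmetric])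
  qed
  have F_SUP_1: "(SUP j. F j x (\<lambda>_. 1)) = 1" for x
    by (simp add: F_SUP kpow_transition_kernel_1[OF P] c)
  have F_le_1: "F j x (\<lambda>_. 1) \<le> 1" for j x
    using SUP_upper[of j UNIV "\<lambda>j. F j x (\<lambda>_. 1)"] unfolding F_SUP_1 by simp
  define D where "D j = {x \<in> C. 1 \<le> F j x (\<lambda>_. 1) + ennreal (\<epsilon> / 8)}" for j
  have D [measurable]: "D j \<in> sets borel" for j unfolding D_def by measurable
  have D_inc: "incseq D"
    using F_inc[of "\<lambda>_. 1"] by (auto simp: incseq_Suc_iff D_def intro: order_trans add_right_mono)
  have D_Un: "(\<Union>j. D j) = C"
  proof
    show "C \<subseteq> (\<Union>j. D j)"
    proof
      fix x assume x: "x \<in> C"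
      have "1 - ennreal (\<epsilon> / 8) < (SUP j. F j x (\<lambda>_. 1))"
        unfolding F_SUP_1 using \<epsilon> by (intro ennreal_between) auto
      then obtain j where "1 - ennreal (\<epsilon> / 8) < F j x (\<lambda>_. 1)" by (auto simp: less_SUP_iff)
      then have "1 \<le> F j x (\<lambda>_. 1) + ennreal (\<epsilon> / 8)"
        by (intro order_trans[OF ennreal_le_diff_add add_right_mono] less_imp_le)
      with x show "x \<in> (\<Union>j. D j)" by (auto simp: D_def)
    qed
  qed (auto simp: D_def)
  have "(SUP j. emeasure \<nu> (D j)) = 1"
    using SUP_emeasure_incseq[of D \<nu>] D_inc D \<nu> by (auto simp: D_Un image_subset_iff)
  moreover have "ennreal (7 / 8) < 1" by (simp add: ennreal_less_one_iff)
  ultimately obtain j0 where j0: "ennreal (7 / 8) < emeasure \<nu> (D j0)"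
    by (metis less_SUP_iff)
  have "\<exists>i. (\<integral>\<^sup>+ x. resolvent ?K (2 * l) (indicator (D (j0 + i))) x \<partial>\<psi>) \<noteq> 0"
  proof (rule ccontr)
    assume "\<not> ?thesis"
    then have 0: "(\<integral>\<^sup>+ x. resolvent ?K (2 * l) (indicator (D (j0 + i))) x \<partial>\<psi>) = 0" for i by blast
    have inc: "incseq (\<lambda>i. indicator (D (j0 + i)) :: 'a \<Rightarrow> ennreal)"
      using D_inc by (auto simp: incseq_Suc_iff le_fun_def indicator_def)
    have "(\<lambda>x. SUP i. indicator (D (j0 + i)) x) = (indicator C :: 'a \<Rightarrow> ennreal)"
    proof
      fix x
      show "(SUP i. indicator (D (j0 + i)) x) = (indicator C x :: ennreal)"
      proof (cases "x \<in> C")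
        case True
        then obtain j where "x \<in> D j" using D_Un by blast
        then have "x \<in> D (j0 + j)" using incseqD[OF D_inc, of j "j0 + j"] by auto
        then have "1 \<le> (SUP i. indicator (D (j0 + i)) x :: ennreal)"
          by (intro SUP_upper2[of j]) auto
        moreover have "(SUP i. indicator (D (j0 + i)) x :: ennreal) \<le> 1"
          by (intro SUP_least) (auto simp: indicator_def)
        ultimately show ?thesis using True by simp
      next
        case False
        then show ?thesis by (auto simp: D_def)
      qed
    qed
    moreover have "normal_functional (\<lambda>f. \<integral>\<^sup>+ x. resolvent ?K (2 * l) f x \<partial>\<psi>)"
      by (rule normal_functional_operator[OF normal_functional_nn_integral[OF sets_psi]
            normal_operator_resolvent[OF normal]])
    from normal_functional_SUP[OF this _ inc]
    have "(\<integral>\<^sup>+ x. resolvent ?K (2 * l) (\<lambda>x. SUP i. indicator (D (j0 + i)) x) x \<partial>\<psi>) = 0"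
      by (simp add: 0)
    ultimately have "(\<integral>\<^sup>+ x. resolvent ?K (2 * l) (indicator C) x \<partial>\<psi>) = 0" by simp
    moreover have "0 < resolvent ?K (2 * l) (indicator C) x" for x
    proof -
      obtain t where "kpow P t (indicator C) x \<noteq> 0" using reach by blast
      then have "kpow ?K t (indicator C) x \<noteq> 0"
        using kpow_scaled_kernel_eq_0_iff[OF P M, of "indicator C" t x] by simp
      then have "0 < ennreal (1 / (2 * l) ^ (t + 1)) * kpow ?K t (indicator C) x"
        using l by (simp add: zero_less_iff_neq_zero ennreal_eq_0_iff not_le del: power_Suc)
      also have "\<dots> \<le> resolvent ?K (2 * l) (indicator C) x" by (rule resolvent_ge[OF normal]) simp
      finally show ?thesis .
    qed
    ultimately show False
      using nn_integral_pos[OF sets_psi psi_nonzero, of "resolvent ?K (2 * l) (indicator C)"] by simp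
  qed
  then obtain i where i: "(\<integral>\<^sup>+ x. resolvent ?K (2 * l) (indicator (D (j0 + i))) x \<partial>\<psi>) \<noteq> 0" ..
  define j where "j = j0 + i"
  have \<nu>D: "ennreal (7 / 8) \<le> emeasure \<nu> (D j)"
    using j0 emeasure_mono[of "D j0" "D j" \<nu>] incseqD[OF D_inc, of j0 j] \<nu> D
    by (auto simp: j_def intro: order_trans[OF less_imp_le])
  have "\<exists>m. sets m = sets borel \<and> (\<forall>f\<in>borel_measurable borel. (\<integral>\<^sup>+ y. f y \<partial>m) = F j x f)" for x
    by (rule normal_functional_measure[OF F_normal[of j x]]) blast
  then obtain U where U: "\<And>x. sets (U x) = sets borel"
      "\<And>x f. f \<in> borel_measurable borel \<Longrightarrow> (\<integral>\<^sup>+ y. f y \<partial>U x) = F j x f"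
    by metis
  have space_U: "space (U x) = UNIV" for x using sets_eq_imp_space_eq[OF U(1)] by simp
  have emU: "emeasure (U x) A = F j x (indicator A)" if "A \<in> sets borel" for x A
    using U(2)[of "indicator A" x] U(1) that by simp
  have U_kernel: "U \<in> borel \<rightarrow>\<^sub>M subprob_algebra borel"
  proof (rule measurable_subprob_algebra)
    fix x
    have "emeasure (U x) (space (U x)) = F j x (\<lambda>_. 1)"
      using U(2)[of "\<lambda>_. 1" x] by simp
    then show "subprob_space (U x)"
      using F_le_1[of j x] by (intro subprob_spaceI) (auto simp: space_U)
  qed (auto simp: U emU)
  have "ennreal \<epsilon> * emeasure \<nu> A \<le> emeasure (U x) A + ennreal (\<epsilon> / 8)"
    if x: "x \<in> D j" and A [measurable]: "A \<in> sets borel" for x A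
  proof -
    let ?G = "\<lambda>f. \<Sum>t. c t * kpow P (t + n) f x"
    have G: "normal_functional ?G"
      by (intro normal_functional_weighted_suminf normal_kpow normal_operator_kernel P)
    have split: "(\<lambda>_. 1) = (\<lambda>y. indicator A y + indicator (- A) y :: ennreal)"
      by (auto simp: indicator_def)
    have 1: "1 = ?G (indicator A) + ?G (indicator (- A))"
      using normal_functional_add[OF G, of "indicator A" "indicator (- A)"]
      by (simp add: split[symmetric] kpow_transition_kernel_1[OF P] c)
    have "?G (indicator A) + ?G (indicator (- A)) \<le> F j x (\<lambda>_. 1) + ennreal (\<epsilon> / 8)"
      using x unfolding 1[symmetric] by (simp add: D_def)
    also have "F j x (\<lambda>_. 1) = F j x (indicator A) + F j x (indicator (- A))"
      unfolding split by (rule normal_functional_add[OF F_normal]) auto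
    also have "F j x (indicator (- A)) \<le> ?G (indicator (- A))"
      using SUP_upper[of j UNIV "\<lambda>j. F j x (indicator (- A))"] by (subst F_SUP[symmetric]) auto
    finally have "?G (indicator A) + ?G (indicator (- A)) \<le>
        (F j x (indicator A) + ennreal (\<epsilon> / 8)) + ?G (indicator (- A))"
      by (simp add: ac_simps add_mono)
    moreover have "?G (indicator (- A)) \<noteq> \<infinity>" using 1 by (metis ennreal_add_eq_top ennreal_one_neq_top infinity_ennreal_def)
    ultimately have "?G (indicator A) \<le> F j x (indicator A) + ennreal (\<epsilon> / 8)"
      by (simp add: add.commute ennreal_add_left_cancel_le)
    then show ?thesis using minor[of x A] x by (auto simp: D_def emU)
  qed
  from two_step_minorization[OF U_kernel \<nu>(1,2) D \<nu>D \<epsilon> this]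
  obtain \<mu> where \<mu>: "sets \<mu> = sets borel" "emeasure \<mu> UNIV \<noteq> 0"
    "\<And>x A. x \<in> D j \<Longrightarrow> A \<in> sets borel \<Longrightarrow> emeasure \<mu> A \<le> (\<integral>\<^sup>+ y. emeasure (U y) A \<partial>U x)"
    by blast
  \<comment> \<open>Used at two different levels below: composing the resolvents at \<open>2 l\<close> and \<open>l\<close> gives back a
    multiple of the one at \<open>l\<close>.\<close>
  have FR: "\<exists>B>0. \<forall>x. \<forall>f\<in>borel_measurable borel. F j x f \<le> ennreal B * resolvent ?K k f x"
    if k: "0 < k" for k
  proof -
    define b where "b t = exp (2 * real j) ^ (t + n) * k ^ (t + n + 1)" for t
    define B where "B = 1 + (\<Sum>t<j. b t)"
    have b: "0 \<le> b t" for t using k by (simp add: b_def)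
    have bB: "b t \<le> B" if "t < j" for t
      unfolding B_def using b that member_le_sum[of t "{..<j}" b] by auto
    have B: "0 < B" unfolding B_def using b by (intro add_pos_nonneg sum_nonneg) auto
    have "F j x f \<le> ennreal B * resolvent ?K k f x" if f: "f \<in> borel_measurable borel" for x f
    proof -
      have "(if t < j then c t else 0) * kpow (?T j) (t + n) f x \<le> c t * (ennreal B * resolvent ?K k f x)" for t
      proof (cases "t < j")
        case True
        have "kpow (?T j) (t + n) f x \<le> ennreal (exp (2 * real j) ^ (t + n)) * kpow ?K (t + n) f x"
          by (rule kpow_truncated_kernel_le[OF P w M bound f])
        also have "kpow ?K (t + n) f x = ennreal (k ^ (t + n + 1)) * (ennreal (1 / k ^ (t + n + 1)) * kpow ?K (t + n) f x)"
          using k by (simp add: mult.assoc[symmetric] ennreal_mult[symmetric] del: power_Suc)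
        also have "\<dots> \<le> ennreal (k ^ (t + n + 1)) * resolvent ?K k f x"
          by (intro mult_left_mono resolvent_ge[OF normal f]) auto
        finally have "kpow (?T j) (t + n) f x \<le> ennreal (b t) * resolvent ?K k f x"
          using k by (simp add: b_def ennreal_mult mult.assoc mult_left_mono del: power_Suc)
        also have "\<dots> \<le> ennreal B * resolvent ?K k f x"
          by (intro mult_right_mono ennreal_leI bB True) auto
        finally show ?thesis using True by (auto intro: mult_left_mono)
      qed auto
      then have "F j x f \<le> (\<Sum>t. c t * (ennreal B * resolvent ?K k f x))"
        unfolding F_def by (intro suminf_le) auto
      also have "\<dots> = ennreal B * resolvent ?K k f x" by (simp add: ennreal_suminf_multc c)
      finally show ?thesis .
    qed
    with B show ?thesis by blast
  qed
  obtain B1 where B1: "0 < B1" "\<And>x f. f \<in> borel_measurable borel \<Longrightarrow> F j x f \<le> ennreal B1 * resolvent ?K (2 * l) f x"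
    using FR[of "2 * l"] l by auto
  obtain B2 where B2: "0 < B2" "\<And>x f. f \<in> borel_measurable borel \<Longrightarrow> F j x f \<le> ennreal B2 * resolvent ?K l f x"
    using FR[of l] l by auto
  have step1: "ennreal l * emeasure \<mu> A * indicator (D j) x \<le> ennreal (B1 * B2) * resolvent ?K l (indicator A) x"
    if A [measurable]: "A \<in> sets borel" for x A
  proof (cases "x \<in> D j")
    case True
    have "emeasure \<mu> A \<le> F j x (\<lambda>y. F j y (indicator A))"
      using \<mu>(3)[OF True A] by (simp add: emU U)
    also have "\<dots> \<le> ennreal B1 * resolvent ?K (2 * l) (\<lambda>y. F j y (indicator A)) x"
      by (rule B1) measurable
    also have "\<dots> \<le> ennreal B1 * resolvent ?K (2 * l) (\<lambda>y. ennreal B2 * resolvent ?K l (indicator A) y) x"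
      by (intro mult_left_mono normal_functional_mono[OF normal_resolvent[OF normal]] B2) auto
    also have "\<dots> = ennreal (B1 * B2) * resolvent ?K (2 * l) (resolvent ?K l (indicator A)) x"
      using B1 B2 by (simp add: normal_functional_cmult[OF normal_resolvent[OF normal]] ennreal_mult mult.assoc)
    finally have "ennreal l * emeasure \<mu> A \<le>
        ennreal (B1 * B2) * (ennreal (2 * l - l) * resolvent ?K (2 * l) (resolvent ?K l (indicator A)) x)"
      by (auto intro: order_trans[OF mult_left_mono] simp: mult.left_commute)
    also have "\<dots> \<le> ennreal (B1 * B2) * resolvent ?K l (indicator A) x"
      using l by (intro mult_left_mono resolvent_resolvent_le[OF normal]) auto
    finally show ?thesis using True by simp
  qed auto
  let ?q = "resolvent ?K (2 * l) (indicator (D j))"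
  have step2: "ennreal (l * l) * (emeasure \<mu> A * ?q x) \<le> ennreal (B1 * B2) * resolvent ?K l (indicator A) x"
    if A [measurable]: "A \<in> sets borel" for x A
  proof -
    have "ennreal l * emeasure \<mu> A * ?q x =
        resolvent ?K (2 * l) (\<lambda>x. ennreal l * emeasure \<mu> A * indicator (D j) x) x"
      by (simp add: normal_functional_cmult[OF normal_resolvent[OF normal]])
    also have "\<dots> \<le> resolvent ?K (2 * l) (\<lambda>x. ennreal (B1 * B2) * resolvent ?K l (indicator A) x) x"
      by (intro normal_functional_mono[OF normal_resolvent[OF normal]] step1) auto
    also have "\<dots> = ennreal (B1 * B2) * resolvent ?K (2 * l) (resolvent ?K l (indicator A)) x"
      by (simp add: normal_functional_cmult[OF normal_resolvent[OF normal]])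
    finally have "ennreal l * (ennreal l * emeasure \<mu> A * ?q x) \<le>
        ennreal (B1 * B2) * (ennreal (2 * l - l) * resolvent ?K (2 * l) (resolvent ?K l (indicator A)) x)"
      by (auto intro: order_trans[OF mult_left_mono] simp: mult.left_commute)
    also have "\<dots> \<le> ennreal (B1 * B2) * resolvent ?K l (indicator A) x"
      using l by (intro mult_left_mono resolvent_resolvent_le[OF normal]) auto
    finally show ?thesis using l by (simp add: ennreal_mult mult.assoc)
  qed
  have q_fin: "?q x < \<infinity>" for x
  proof -
    have "?q x \<le> resolvent ?K (2 * l) (\<lambda>_. 1) x"
      by (intro normal_functional_mono[OF normal_resolvent[OF normal]]) (auto simp: indicator_def)
    also have "\<dots> \<le> resolvent ?K l (\<lambda>_. 1) x" using l by (intro resolvent_antimono[OF normal]) auto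
    finally show ?thesis using fin by (rule le_less_trans)
  qed
  then have q_real: "ennreal (enn2real (?q x)) = ?q x" for x by simp
  let ?\<nu> = "scale_measure (ennreal (l * l / (B1 * B2))) \<mu>"
  have "small_function \<psi> ?K (\<lambda>x. enn2real (?q x))"
    unfolding small_function_def
  proof (intro conjI exI allI ballI)
    show "(\<lambda>x. enn2real (?q x)) \<in> borel_measurable borel" by measurable
    show "0 < (\<integral>\<^sup>+ x. ennreal (enn2real (?q x)) \<partial>\<psi>)"
      unfolding q_real using i by (simp add: j_def zero_less_iff_neq_zero)
    show "0 < l" by fact
    show "sets ?\<nu> = sets borel" by (simp add: \<mu>)
    show "emeasure ?\<nu> UNIV \<noteq> 0" using \<mu>(2) l B1 B2 by (simp add: ennreal_eq_0_iff not_le)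
    show "AE x in \<psi>. \<exists>B::nat \<Rightarrow> 'a set. (\<forall>n. B n \<in> sets borel) \<and> (\<Union>n. B n) = UNIV \<and>
        (\<forall>n. resolvent ?K l (indicator (B n)) x < \<infinity>)"
    proof (intro always_eventually allI exI[of _ "\<lambda>_. UNIV"] conjI)
      have "(indicator UNIV :: 'a \<Rightarrow> ennreal) = (\<lambda>_. 1)" by auto
      then show "resolvent ?K l (indicator UNIV) x < \<infinity>" for x using fin[of x] by simp
    qed auto
    fix x and A :: "'a set" assume A: "A \<in> sets borel"
    have "ennreal (enn2real (?q x)) * emeasure ?\<nu> A =
        ennreal (1 / (B1 * B2)) * (ennreal (l * l) * (emeasure \<mu> A * ?q x))"
      unfolding q_real using B1 B2
      by (simp add: ennreal_mult[symmetric] mult.assoc[symmetric]) (simp add: ac_simps)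
    also have "\<dots> \<le> ennreal (1 / (B1 * B2)) * (ennreal (B1 * B2) * resolvent ?K l (indicator A) x)"
      by (intro mult_left_mono step2 A) auto
    also have "\<dots> = resolvent ?K l (indicator A) x"
      using B1 B2 by (simp add: ennreal_mult[symmetric] mult.assoc[symmetric])
    finally show "ennreal (enn2real (?q x)) * emeasure ?\<nu> A \<le> resolvent ?K l (indicator A) x" .
  qed auto
  from exI[where P = "small_function \<psi> ?K", OF this] show ?thesis .
qed

section \<open>Consequences of the drift condition\<close>

lemma ln_ennreal_le_iff:
  "ln_ennreal z \<le> ereal r \<longleftrightarrow> z \<le> ennreal (exp r)"
proof (cases z)
  case (real a)
  show ?thesis
  proof (cases "a = 0")
    case False
    then have "0 < a" using real by simp
    then have "ln a \<le> r \<longleftrightarrow> a \<le> exp r" by (metis exp_gt_zero ln_exp ln_le_cancel_iff)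
    then show ?thesis using real \<open>0 < a\<close> by (simp add: ln_ennreal_def ennreal_le_iff)
  qed (use real in \<open>simp add: ln_ennreal_def\<close>)
qed (simp add: ln_ennreal_def top_unique)

lemma nonlinear_generator_le_iff:
  "nonlinear_generator P V x \<le> ereal r \<longleftrightarrow>
     kapply P (\<lambda>y. ennreal (exp (V y))) x \<le> ennreal (exp (V x + r))"
proof -
  let ?k = "kapply P (\<lambda>y. ennreal (exp (V y))) x"
  have "ennreal (exp (- V x)) * ?k \<le> ennreal (exp r) \<longleftrightarrow> ?k \<le> ennreal (exp (V x + r))"
  proof
    assume "ennreal (exp (- V x)) * ?k \<le> ennreal (exp r)"
    then have "ennreal (exp (V x)) * (ennreal (exp (- V x)) * ?k) \<le> ennreal (exp (V x)) * ennreal (exp r)"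
      by (rule mult_left_mono) simp
    then show "?k \<le> ennreal (exp (V x + r))"
      by (simp add: mult.assoc[symmetric] ennreal_mult[symmetric] exp_add[symmetric])
  next
    assume "?k \<le> ennreal (exp (V x + r))"
    then have "ennreal (exp (- V x)) * ?k \<le> ennreal (exp (- V x)) * ennreal (exp (V x + r))"
      by (rule mult_left_mono) simp
    then show "ennreal (exp (- V x)) * ?k \<le> ennreal (exp r)"
      by (simp add: ennreal_mult[symmetric] exp_add[symmetric])
  qed
  then show ?thesis unfolding nonlinear_generator_def ln_ennreal_le_iff .
qed

text \<open>
  If \<open>C\<close> could not be reached from \<open>x\<close>, then \<open>P\<^sup>n e\<^sup>V(x)\<close> would tend to \<open>0\<close>, although \<open>e\<^sup>V \<ge> 1\<close>.
\<close>

lemma drift_reaches: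
  assumes P: "transition_kernel P" and V [measurable]: "V \<in> borel_measurable borel"
    and V1: "\<And>x. 0 \<le> V x" and C [measurable]: "C \<in> sets borel" and \<delta>: "0 < \<delta>"
    and drift: "\<And>x. x \<notin> C \<Longrightarrow> kapply P (\<lambda>y. ennreal (exp (V y))) x \<le> ennreal (exp (V x - \<delta>))"
  shows "\<exists>t. kpow P t (indicator C) x \<noteq> 0"
proof (rule ccontr)
  assume "\<nexists>t. kpow P t (indicator C) x \<noteq> 0"
  then have 0: "kpow P t (indicator C) x = 0" for t by blast
  let ?g = "\<lambda>y. ennreal (exp (V y))"
  note K = normal_operator_kernel[OF P]
  have up: "kpow P n ?g x \<le> ennreal (exp (V x - real n * \<delta>))" for n
  proof (induction n)
    case (Suc n)
    have "kpow P (Suc n) ?g x \<le> kpow P n (\<lambda>y. ennreal (exp (- \<delta>)) * ?g y + \<infinity> * indicator C y) x"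
      unfolding kpow_Suc'
    proof (rule normal_functional_mono[OF normal_kpow[OF K]])
      show "kapply P ?g \<in> borel_measurable borel" by (rule measurable_kapply[OF K]) measurable
      fix y
      show "kapply P ?g y \<le> ennreal (exp (- \<delta>)) * ?g y + \<infinity> * indicator C y"
        using drift[of y]
        by (cases "y \<in> C") (auto simp: ennreal_mult[symmetric] exp_add[symmetric] algebra_simps)
    qed measurable
    also have "\<dots> = kpow P n (\<lambda>y. ennreal (exp (- \<delta>)) * ?g y) x + kpow P n (\<lambda>y. \<infinity> * indicator C y) x"
      by (rule normal_functional_add[OF normal_kpow[OF K]]) measurable
    also have "kpow P n (\<lambda>y. \<infinity> * indicator C y) x = 0"
      by (subst normal_functional_cmult[OF normal_kpow[OF K]]) (auto simp: 0)
    also have "kpow P n (\<lambda>y. ennreal (exp (- \<delta>)) * ?g y) x = ennreal (exp (- \<delta>)) * kpow P n ?g x"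
      by (rule normal_functional_cmult[OF normal_kpow[OF K]]) measurable
    also have "\<dots> \<le> ennreal (exp (- \<delta>)) * ennreal (exp (V x - real n * \<delta>))"
      by (intro mult_left_mono Suc) simp
    also have "\<dots> = ennreal (exp (V x - real (Suc n) * \<delta>))"
      by (simp add: ennreal_mult[symmetric] exp_add[symmetric] algebra_simps)
    finally show ?case by simp
  qed simp
  obtain n where "V x / \<delta> < real n" using reals_Archimedean2 by blast
  then have n: "V x - real n * \<delta> < 0" using \<delta> by (simp add: field_simps)
  have "1 = kpow P n (\<lambda>_. 1) x" by (simp add: kpow_transition_kernel_1[OF P])
  also have "\<dots> \<le> kpow P n ?g x"
    using V1 by (intro normal_functional_mono[OF normal_kpow[OF K]]) (auto simp: ennreal_1[symmetric] simp del: ennreal_1)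
  also have "\<dots> \<le> ennreal (exp (V x - real n * \<delta>))" by (rule up)
  also have "\<dots> < 1" using n by (simp add: ennreal_less_one_iff)
  finally show False by simp
qed

text \<open>
  The minorizing measure of a small set may live far away from it, whereas the two-step
  argument needs a measure carried by \<open>C\<close>. Since \<open>C\<close> is reached from everywhere, some \<open>\<nu> P\<^sup>n\<close>
  charges \<open>C\<close>, and its restriction to \<open>C\<close> can be used instead.
\<close>

lemma small_set_recentre:
  assumes P: "transition_kernel P" and small: "small_set P C"
    and reach: "\<And>x. \<exists>t. kpow P t (indicator C) x \<noteq> 0"
  obtains \<nu> \<epsilon> c n where "sets \<nu> = sets borel" "prob_space \<nu>" "emeasure \<nu> C = 1" "0 < \<epsilon>"
    "(\<Sum>t. c t) = (1::ennreal)"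
    "\<And>x A. x \<in> C \<Longrightarrow> A \<in> sets borel \<Longrightarrow>
       ennreal \<epsilon> * emeasure \<nu> A \<le> (\<Sum>t. c t * kpow P (t + n) (indicator A) x)"
proof -
  have C [measurable]: "C \<in> sets borel" using small by (simp add: small_set_def)
  from small obtain e \<nu>0 m where e: "0 < e" and \<nu>0: "\<nu>0 \<in> space (prob_algebra borel)"
    and m: "\<And>t. 0 \<le> m t" "summable (\<lambda>t. real t * m t)"
    and le: "\<And>x A. A \<in> sets borel \<Longrightarrow>
       ennreal e * indicator C x * emeasure \<nu>0 A \<le> (\<Sum>t. kpow P t (indicator A) x * ennreal (m t))"
    unfolding small_set_def by blast
  have sets0 [measurable_cong]: "sets \<nu>0 = sets borel" and prob0: "prob_space \<nu>0"
    using \<nu>0 by (auto simp: space_prob_algebra)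
  interpret \<nu>0: prob_space \<nu>0 by fact
  note K = normal_operator_kernel[OF P]
  note [measurable] = measurable_kpow[OF K]
  have "summable m"
  proof (rule summable_comparison_test[OF _ m(2)])
    have "norm (m t) \<le> real t * m t" if "1 \<le> t" for t
      using that m(1)[of t] mult_right_mono[of 1 "real t" "m t"] by simp
    then show "\<exists>N. \<forall>t\<ge>N. norm (m t) \<le> real t * m t" by blast
  qed
  define S where "S = (\<Sum>t. m t)"
  have S: "(\<Sum>t. ennreal (m t)) = ennreal S"
    unfolding S_def using m(1) \<open>summable m\<close> by (rule suminf_ennreal2)
  obtain x1 where x1: "x1 \<in> C"
  proof (cases "C = {}")
    case True
    obtain t where "kpow P t (indicator C) undefined \<noteq> 0" using reach by blast
    moreover have "(indicator C :: 'a \<Rightarrow> ennreal) = (\<lambda>_. 0)" using True by auto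
    ultimately show ?thesis by (simp add: kpow_transition_kernel_1[OF P])
  qed blast
  have int: "ennreal e * (\<integral>\<^sup>+ y. f y \<partial>\<nu>0) \<le> (\<Sum>t. ennreal (m t) * kpow P t f x)"
    if x: "x \<in> C" and f: "f \<in> borel_measurable borel" for x f
  proof (rule normal_functional_le_nn_integral[OF _ sets0 _ f])
    show "normal_functional (\<lambda>f. \<Sum>t. ennreal (m t) * kpow P t f x)"
      by (intro normal_functional_weighted_suminf normal_kpow K)
    show "ennreal e * emeasure \<nu>0 A \<le> (\<Sum>t. ennreal (m t) * kpow P t (indicator A) x)"
      if "A \<in> sets borel" for A
      using le[OF that, of x] x by (simp add: mult.commute)
  qed
  have "ennreal e \<le> ennreal S"
    using int[OF x1, of "\<lambda>_. 1"] by (simp add: kpow_transition_kernel_1[OF P] S \<nu>0.emeasure_space_1)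
  then have S_pos: "0 < S" using e by (cases "0 \<le> S") (auto simp: ennreal_le_iff ennreal_neg)
  have "\<exists>n. (\<integral>\<^sup>+ y. kpow P n (indicator C) y \<partial>\<nu>0) \<noteq> 0"
  proof (rule ccontr)
    assume "\<not> ?thesis"
    then have "AE y in \<nu>0. kpow P n (indicator C) y = 0" for n
      by (subst (asm) nn_integral_0_iff_AE) auto
    then have "AE y in \<nu>0. \<forall>n. kpow P n (indicator C) y = 0" by (subst AE_all_countable) auto
    then have "AE y in \<nu>0. False" by eventually_elim (use reach in blast)
    then show False by simp
  qed
  then obtain n where n: "(\<integral>\<^sup>+ y. kpow P n (indicator C) y \<partial>\<nu>0) \<noteq> 0" ..
  have "(\<integral>\<^sup>+ y. kpow P n (indicator C) y \<partial>\<nu>0) \<le> (\<integral>\<^sup>+ y. kpow P n (\<lambda>_. 1) y \<partial>\<nu>0)"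
    by (intro nn_integral_mono normal_functional_mono[OF normal_kpow[OF K]]) (auto simp: indicator_def)
  also have "\<dots> = 1" by (simp add: kpow_transition_kernel_1[OF P] \<nu>0.emeasure_space_1)
  finally have "(\<integral>\<^sup>+ y. kpow P n (indicator C) y \<partial>\<nu>0) < \<infinity>" by (rule le_less_trans) simp
  then obtain p where p: "(\<integral>\<^sup>+ y. kpow P n (indicator C) y \<partial>\<nu>0) = ennreal p" "0 \<le> p"
    by (cases "\<integral>\<^sup>+ y. kpow P n (indicator C) y \<partial>\<nu>0") auto
  then have p_pos: "0 < p" using n by (cases "p = 0") auto
  have mult_op: "normal_operator (\<lambda>f y. indicator C y * f y)"
    unfolding normal_operator_def normal_functional_def
    by (auto simp: distrib_left SUP_mult_left_ennreal mult.left_commute)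
  have "normal_functional (\<lambda>f. \<integral>\<^sup>+ y. kpow P n (\<lambda>y. indicator C y * f y) y \<partial>\<nu>0)"
    by (rule normal_functional_operator[OF normal_functional_nn_integral[OF sets0]
          normal_operator_comp[OF normal_operator_kpow[OF K] mult_op]])
  then obtain \<kappa> where \<kappa>: "sets \<kappa> = sets borel" "\<And>f. f \<in> borel_measurable borel \<Longrightarrow>
      (\<integral>\<^sup>+ y. f y \<partial>\<kappa>) = (\<integral>\<^sup>+ y. kpow P n (\<lambda>y. indicator C y * f y) y \<partial>\<nu>0)"
    by (rule normal_functional_measure) blast
  have em: "emeasure \<kappa> A = (\<integral>\<^sup>+ y. kpow P n (indicator (C \<inter> A)) y \<partial>\<nu>0)" if [measurable]: "A \<in> sets borel" for A
  proof -
    have "(\<lambda>y. indicator C y * indicator A y) = (indicator (C \<inter> A) :: 'a \<Rightarrow> ennreal)"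
      by (auto simp: indicator_def)
    then show ?thesis using \<kappa>(2)[of "indicator A"] \<kappa>(1) by simp
  qed
  let ?\<nu> = "scale_measure (ennreal (1 / p)) \<kappa>"
  let ?c = "\<lambda>t. ennreal (1 / S) * ennreal (m t)"
  show ?thesis
  proof (rule that)
    show "sets ?\<nu> = sets borel" by (simp add: \<kappa>)
    have "space \<kappa> = UNIV" using sets_eq_imp_space_eq[OF \<kappa>(1)] by simp
    then have "emeasure ?\<nu> (space ?\<nu>) = 1"
      using p p_pos by (simp add: em space_scale_measure ennreal_mult[symmetric])
    then show "prob_space ?\<nu>" by (rule prob_spaceI)
    show "emeasure ?\<nu> C = 1" using p p_pos by (simp add: em ennreal_mult[symmetric])
    show "0 < e * p / S" using e p_pos S_pos by simp
    show "(\<Sum>t. ?c t) = 1" using S_pos by (simp add: ennreal_suminf_cmult S ennreal_mult[symmetric])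
    fix x and A :: "'a set" assume x: "x \<in> C" and A [measurable]: "A \<in> sets borel"
    have "ennreal (e * p / S) * emeasure ?\<nu> A = ennreal (1 / S) * (ennreal e * emeasure \<kappa> A)"
    proof -
      have "ennreal (e * p / S) * ennreal (1 / p) = ennreal (1 / S) * ennreal e"
        using e p_pos S_pos by (simp add: ennreal_mult[symmetric])
      then show ?thesis by (simp add: mult.assoc[symmetric])
    qed
    also have "\<dots> \<le> ennreal (1 / S) * (\<Sum>t. ennreal (m t) * kpow P t (kpow P n (indicator (C \<inter> A))) x)"
      unfolding em[OF A] by (intro mult_left_mono int x) auto
    also have "\<dots> = (\<Sum>t. ?c t * kpow P (t + n) (indicator (C \<inter> A)) x)"
      unfolding ennreal_suminf_cmult[symmetric] mult.assoc kpow_add ..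
    also have "\<dots> \<le> (\<Sum>t. ?c t * kpow P (t + n) (indicator A) x)"
      by (intro suminf_le mult_left_mono normal_functional_mono[OF normal_kpow[OF K]])
        (auto simp: indicator_def)
    finally show "ennreal (e * p / S) * emeasure ?\<nu> A \<le> (\<Sum>t. ?c t * kpow P (t + n) (indicator A) x)" .
  qed
qed

lemma weighted_Linf2_iff:
  assumes W0: "\<And>x. 1 \<le> W0 x"
  shows "M \<in> weighted_Linf2 W0 \<longleftrightarrow>
    M \<in> borel_measurable borel \<and> (\<exists>c\<ge>0. \<forall>x y. \<bar>M (x, y)\<bar> \<le> c * (W0 x + W0 y))"
proof -
  have pos: "0 < W0 x + W0 y" for x y using W0[of x] W0[of y] by linarith
  let ?S = "SUP (x, y). ennreal (\<bar>M (x, y)\<bar> / (W0 x + W0 y))"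
  have "?S < \<infinity> \<longleftrightarrow> (\<exists>c\<ge>0. \<forall>x y. \<bar>M (x, y)\<bar> \<le> c * (W0 x + W0 y))"
  proof
    assume "?S < \<infinity>"
    then obtain c where c: "?S = ennreal c" "0 \<le> c" by (cases ?S) auto
    have "\<bar>M (x, y)\<bar> \<le> c * (W0 x + W0 y)" for x y
    proof -
      have "ennreal (\<bar>M (x, y)\<bar> / (W0 x + W0 y)) \<le> ?S"
        by (rule SUP_upper2[of "(x, y)"]) auto
      then have "\<bar>M (x, y)\<bar> / (W0 x + W0 y) \<le> c" using c by (simp add: ennreal_le_iff)
      then show ?thesis using pos[of x y] by (simp add: field_simps)
    qed
    with c show "\<exists>c\<ge>0. \<forall>x y. \<bar>M (x, y)\<bar> \<le> c * (W0 x + W0 y)" by blast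
  next
    assume "\<exists>c\<ge>0. \<forall>x y. \<bar>M (x, y)\<bar> \<le> c * (W0 x + W0 y)"
    then obtain c where c: "\<And>x y. \<bar>M (x, y)\<bar> \<le> c * (W0 x + W0 y)" by blast
    have "\<bar>M (x, y)\<bar> / (W0 x + W0 y) \<le> c" for x y using c[of x y] pos[of x y] by (simp add: field_simps)
    then have "?S \<le> ennreal c" by (intro SUP_least) (auto intro!: ennreal_leI)
    then show "?S < \<infinity>" by (rule le_less_trans) simp
  qed
  then show ?thesis by (simp add: weighted_Linf2_def)
qed

text \<open>
  In other words \<open>W\<^sub>0 = o(W)\<close>, with the bounded part absorbed in a constant.
\<close>

lemma admissible_weight_le:
  assumes adm: "admissible_weight W W0" and W: "\<And>x. 1 \<le> W x" and \<epsilon>: "0 < \<epsilon>"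
  obtains A where "0 \<le> A" "\<And>x. W0 x \<le> \<epsilon> * W x + A"
proof -
  have W0: "1 \<le> W0 x" for x using adm by (simp add: admissible_weight_def)
  let ?S = "SUP x. ennreal (\<bar>W0 x\<bar> / W x)"
  have "?S < \<infinity>" using adm by (simp add: admissible_weight_def weighted_Linf_def)
  then obtain c where c: "?S = ennreal c" "0 \<le> c" by (cases ?S) auto
  have c_le: "W0 x \<le> c * W x" for x
  proof -
    have "ennreal (\<bar>W0 x\<bar> / W x) \<le> ?S" by (rule SUP_upper) simp
    then have "\<bar>W0 x\<bar> / W x \<le> c" using c by (simp add: ennreal_le_iff)
    then show ?thesis using W[of x] by (simp add: field_simps)
  qed
  have "((\<lambda>r::real. SUP x. ennreal (W0 x / W x * indicator {x. r < W x} x)) \<longlongrightarrow> 0) at_top"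
    using adm by (simp add: admissible_weight_def)
  then have "\<forall>\<^sub>F r in at_top. (SUP x. ennreal (W0 x / W x * indicator {x. (r::real) < W x} x)) < ennreal \<epsilon>"
    using \<epsilon> by (intro order_tendstoD(2)) auto
  then obtain r where r: "(SUP x. ennreal (W0 x / W x * indicator {x. (r::real) < W x} x)) < ennreal \<epsilon>"
    unfolding eventually_at_top_linorder by blast
  have "W0 x \<le> \<epsilon> * W x + c * max r 0" for x
  proof (cases "r < W x")
    case True
    have "ennreal (W0 x / W x) = ennreal (W0 x / W x * indicator {x. r < W x} x)" using True by simp
    also have "\<dots> \<le> (SUP x. ennreal (W0 x / W x * indicator {x. r < W x} x))" by (rule SUP_upper) simp
    also note r
    finally have "W0 x / W x < \<epsilon>" using W[of x] W0[of x] \<epsilon> by (simp add: ennreal_less_iff)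
    then have "W0 x \<le> \<epsilon> * W x" using W[of x] by (simp add: field_simps)
    then show ?thesis using c(2) by (simp add: add_increasing2)
  next
    case False
    then have "c * W x \<le> c * max r 0" using c(2) by (intro mult_left_mono) auto
    then show ?thesis using c_le[of x] W[of x] \<epsilon> by (simp add: add_increasing)
  qed
  moreover have "0 \<le> c * max r 0" using c(2) by simp
  ultimately show ?thesis by (rule that[rotated])
qed

locale dv3_chain =
  fixes P :: "'a::polish_space \<Rightarrow> 'a measure" and \<psi> :: "'a measure" and V W W0 :: "'a \<Rightarrow> real"
  assumes kernel: "transition_kernel P"
    and dv3plus: "DV3_plus P \<psi> V W"
    and weight: "admissible_weight W W0"
begin

lemma irreducible_psi: "irreducible_aperiodic P \<psi>"
  using dv3plus by (simp add: DV3_plus_def maximal_irreducibility_measure_def)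

lemma W0_ge_1: "1 \<le> W0 x" and W0_measurable [measurable]: "W0 \<in> borel_measurable borel"
  using weight by (auto simp: admissible_weight_def weighted_Linf_def)

lemma W_ge_1: "1 \<le> W x" and V_ge_1: "1 \<le> V x" and V_measurable [measurable]: "V \<in> borel_measurable borel"
  using dv3plus by (auto simp: DV3_plus_def DV3_def)

lemma scaled_irreducible: "M \<in> borel_measurable borel \<Longrightarrow> irreducible_kernel \<psi> (scaled_kernel P M)"
  by (rule irreducible_kernel_scaled[OF kernel irreducible_psi])

lemma drift:
  obtains C \<delta> b where "small_set P C" "0 < \<delta>" "0 \<le> b"
    "\<And>x. kapply P (\<lambda>y. ennreal (exp (V y))) x \<le> ennreal (exp (V x - \<delta> * W x + b * indicator C x))"
proof -
  obtain C \<delta> b where C: "small_set P C" "0 < \<delta>" and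
    gen: "\<And>x. nonlinear_generator P V x \<le> ereal (- \<delta> * W x + b * indicator C x)"
    using dv3plus unfolding DV3_plus_def DV3_def by blast
  have "kapply P (\<lambda>y. ennreal (exp (V y))) x \<le> ennreal (exp (V x + (- \<delta> * W x + b * indicator C x)))" for x
    using gen[of x] unfolding nonlinear_generator_le_iff .
  then have "kapply P (\<lambda>y. ennreal (exp (V y))) x \<le> ennreal (exp (V x - \<delta> * W x + \<bar>b\<bar> * indicator C x))" for x
    by (rule order_trans) (auto intro!: ennreal_leI simp: indicator_def)
  with C show ?thesis by (intro that[of C \<delta> "\<bar>b\<bar>"]) auto
qed

text \<open>
  With \<open>g = exp (V - c W\<^sub>0)\<close> the factor \<open>exp (c W\<^sub>0(y))\<close> cancels against \<open>g(y)\<close>, and \<open>2 c W\<^sub>0(x)\<close> is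
  absorbed by \<open>\<delta> W(x)\<close>. The function \<open>g\<close> is bounded away from \<open>0\<close> because \<open>P e\<^sup>V \<ge> 1\<close> forces
  \<open>\<delta> W \<le> V + b\<close>.
\<close>

lemma scaled_drift:
  assumes c: "0 \<le> c"
  obtains g \<eta> \<rho> where "g \<in> borel_measurable borel" "0 < \<eta>" "\<And>x. \<eta> \<le> g x" "0 < \<rho>"
    "\<And>M x. M \<in> borel_measurable borel \<Longrightarrow> (\<And>x y. M (x, y) \<le> c * (W0 x + W0 y)) \<Longrightarrow>
       kapply (scaled_kernel P M) (\<lambda>y. ennreal (g y)) x \<le> ennreal \<rho> * ennreal (g x)"
proof -
  obtain C \<delta> b where C: "small_set P C" "0 < \<delta>" "0 \<le> b" and
    dr: "\<And>x. kapply P (\<lambda>y. ennreal (exp (V y))) x \<le> ennreal (exp (V x - \<delta> * W x + b * indicator C x))"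
    by (rule drift) blast
  \<comment> \<open>The denominator is \<open>2 c + 1\<close> so that \<open>c = 0\<close> is allowed.\<close>
  obtain A where A: "0 \<le> A" "\<And>x. W0 x \<le> \<delta> / (2 * c + 1) * W x + A"
    using admissible_weight_le[OF weight W_ge_1, of "\<delta> / (2 * c + 1)"] C c by auto
  have W0_le: "2 * c * W0 x \<le> \<delta> * W x + 2 * c * A" "c * W0 x \<le> \<delta> * W x + c * A" for x
  proof -
    have "2 * c * W0 x \<le> 2 * c * (\<delta> / (2 * c + 1) * W x + A)"
      using c by (intro mult_left_mono A) auto
    moreover have "2 * c * (\<delta> / (2 * c + 1)) * W x \<le> \<delta> * W x"
      using c C W_ge_1[of x] by (intro mult_right_mono) (auto simp: field_simps)
    ultimately show "2 * c * W0 x \<le> \<delta> * W x + 2 * c * A" by (simp add: algebra_simps)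
    have "c * W0 x \<le> c * (\<delta> / (2 * c + 1) * W x + A)"
      using c by (intro mult_left_mono A) auto
    moreover have "c * (\<delta> / (2 * c + 1)) * W x \<le> \<delta> * W x"
      using c C W_ge_1[of x] by (intro mult_right_mono) (auto simp: field_simps)
    ultimately show "c * W0 x \<le> \<delta> * W x + c * A" by (simp add: algebra_simps)
  qed
  have V_ge: "\<delta> * W x - b \<le> V x" for x
  proof -
    have "1 = kpow P 1 (\<lambda>_. 1) x" by (simp add: kpow_transition_kernel_1[OF kernel])
    also have "\<dots> \<le> kapply P (\<lambda>y. ennreal (exp (V y))) x"
      using V_ge_1 unfolding kpow_def
      by (simp, intro normal_functional_mono[OF normal_kapply[OF normal_operator_kernel[OF kernel]]])
        (auto simp: ennreal_1[symmetric] simp del: ennreal_1 intro!: ennreal_leI order_trans[OF _ V_ge_1])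
    also note dr
    finally have "0 \<le> V x - \<delta> * W x + b * indicator C x" by (simp add: ennreal_1[symmetric] del: ennreal_1)
    moreover have "b * indicator C x \<le> b" using C by (auto simp: indicator_def)
    ultimately show ?thesis by linarith
  qed
  let ?g = "\<lambda>x. exp (V x - c * W0 x)"
  show ?thesis
  proof (rule that[of ?g "exp (- b - c * A)" "exp (2 * c * A + b)"])
    show "?g \<in> borel_measurable borel" by measurable
    show "exp (- b - c * A) \<le> ?g x" for x using W0_le(2)[of x] V_ge[of x] by simp
    fix M :: "'a \<times> 'a \<Rightarrow> real" and x
    assume M [measurable]: "M \<in> borel_measurable borel" and bound: "\<And>x y. M (x, y) \<le> c * (W0 x + W0 y)"
    have k: "(\<lambda>z. ennreal (exp (M z))) \<in> borel_measurable borel" by measurable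
    have "kapply (scaled_kernel P M) (\<lambda>y. ennreal (?g y)) x = (\<integral>\<^sup>+ y. ennreal (exp (M (x, y))) * ennreal (?g y) \<partial>P x)"
      unfolding scaled_kernel_eq by (rule kapply_weighted_kernel[OF kernel k]) measurable
    also have "\<dots> \<le> (\<integral>\<^sup>+ y. ennreal (exp (c * W0 x)) * ennreal (exp (V y)) \<partial>P x)"
    proof (rule nn_integral_mono)
      fix y
      show "ennreal (exp (M (x, y))) * ennreal (?g y) \<le> ennreal (exp (c * W0 x)) * ennreal (exp (V y))"
        using bound[of x y] by (simp add: ennreal_mult[symmetric] exp_add[symmetric] algebra_simps)
    qed
    also have "\<dots> = ennreal (exp (c * W0 x)) * kapply P (\<lambda>y. ennreal (exp (V y))) x"
      unfolding kapply_def
      by (rule nn_integral_cmult) (simp add: measurable_cong_sets[OF transition_kernelD(2)[OF kernel] refl])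
    also have "\<dots> \<le> ennreal (exp (c * W0 x)) * ennreal (exp (V x - \<delta> * W x + b * indicator C x))"
      by (intro mult_left_mono dr) simp
    also have "\<dots> = ennreal (exp (c * W0 x + (V x - \<delta> * W x + b * indicator C x)))"
      by (simp add: ennreal_mult[symmetric] exp_add)
    also have "\<dots> \<le> ennreal (exp ((2 * c * A + b) + (V x - c * W0 x)))"
    proof -
      have "b * indicator C x \<le> b" using C by (auto simp: indicator_def)
      then show ?thesis using W0_le(1)[of x] by (intro ennreal_leI) (simp add: algebra_simps)
    qed
    also have "\<dots> = ennreal (exp (2 * c * A + b)) * ennreal (?g x)"
      by (simp add: ennreal_mult[symmetric] exp_add[symmetric])
    finally show "kapply (scaled_kernel P M) (\<lambda>y. ennreal (?g y)) x \<le> ennreal (exp (2 * c * A + b)) * ennreal (?g x)" .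
  qed simp_all
qed

lemma ex_small_function:
  assumes M: "M \<in> weighted_Linf2 W0"
  shows "\<exists>s. small_function \<psi> (scaled_kernel P M) s"
proof -
  from M obtain c where c: "0 \<le> c" "\<And>x y. \<bar>M (x, y)\<bar> \<le> c * (W0 x + W0 y)"
    and M_meas [measurable]: "M \<in> borel_measurable borel"
    by (auto simp: weighted_Linf2_iff[OF W0_ge_1])
  interpret irreducible_kernel \<psi> "scaled_kernel P M" by (rule scaled_irreducible) fact
  obtain g \<eta> \<rho> where g [measurable]: "g \<in> borel_measurable borel" and \<eta>: "0 < \<eta>" "\<And>x. \<eta> \<le> g x" and \<rho>: "0 < \<rho>" and
    super: "\<And>M x. M \<in> borel_measurable borel \<Longrightarrow> (\<And>x y. M (x, y) \<le> c * (W0 x + W0 y)) \<Longrightarrow>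
       kapply (scaled_kernel P M) (\<lambda>y. ennreal (g y)) x \<le> ennreal \<rho> * ennreal (g x)"
    using scaled_drift[OF c(1)] by blast
  have superM: "kapply (scaled_kernel P M) (\<lambda>y. ennreal (g y)) x \<le> ennreal \<rho> * ennreal (g x)" for x
    by (rule super[OF M_meas order_trans[OF abs_ge_self c(2)]])
  have fin: "resolvent (scaled_kernel P M) (\<rho> + 1) (\<lambda>_. 1) x < \<infinity>" for x
  proof -
    have "resolvent (scaled_kernel P M) (\<rho> + 1) (\<lambda>_. 1) x \<le> ennreal (1 / (\<eta> * (\<rho> + 1 - \<rho>))) * ennreal (g x)"
      using \<eta> \<rho> superM by (intro resolvent_1_le[OF normal]) (auto intro!: ennreal_leI)
    then show ?thesis by (rule le_less_trans) (simp add: ennreal_mult_less_top)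
  qed
  obtain C \<delta> b where C: "small_set P C" "0 < \<delta>" "0 \<le> b" and
    dr: "\<And>x. kapply P (\<lambda>y. ennreal (exp (V y))) x \<le> ennreal (exp (V x - \<delta> * W x + b * indicator C x))"
    by (rule drift) blast
  have C_meas: "C \<in> sets borel" using C by (simp add: small_set_def)
  have reach: "\<exists>t. kpow P t (indicator C) x \<noteq> 0" for x
  proof (rule drift_reaches[OF kernel V_measurable _ C_meas C(2)])
    show "0 \<le> V x" for x using V_ge_1[of x] by simp
    show "kapply P (\<lambda>y. ennreal (exp (V y))) x \<le> ennreal (exp (V x - \<delta>))" if "x \<notin> C" for x
    proof -
      have "\<delta> * 1 \<le> \<delta> * W x" using C W_ge_1[of x] by (intro mult_left_mono) auto
      then show ?thesis using that by (intro order_trans[OF dr]) (auto intro!: ennreal_leI)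
    qed
  qed
  obtain \<nu> \<epsilon> a n where centred: "sets \<nu> = sets borel" "prob_space \<nu>" "emeasure \<nu> C = 1" "0 < \<epsilon>"
    "(\<Sum>t. a t) = (1::ennreal)"
    "\<And>x A. x \<in> C \<Longrightarrow> A \<in> sets borel \<Longrightarrow>
       ennreal \<epsilon> * emeasure \<nu> A \<le> (\<Sum>t. a t * kpow P (t + n) (indicator A) x)"
    by (rule small_set_recentre[OF kernel C(1) reach]) blast
  show ?thesis
  proof (rule ex_small_function_scaled_kernel[OF kernel irreducible_psi M_meas _ _ C_meas centred reach _ fin])
    show "(\<lambda>x. c * W0 x) \<in> borel_measurable borel" by measurable
    show "\<bar>M (x, y)\<bar> \<le> c * W0 x + c * W0 y" for x y using c(2)[of x y] by (simp add: distrib_left)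
    show "0 < \<rho> + 1" using \<rho> by simp
  qed
qed

lemma Lam_le:
  assumes M: "M \<in> weighted_Linf2 W0"
    and g: "g \<in> borel_measurable borel" and \<eta>: "0 < \<eta>" "\<And>x. ennreal \<eta> \<le> g x"
    and \<rho>: "0 < \<rho>" "\<And>x. kapply (scaled_kernel P M) g x \<le> ennreal \<rho> * g x" and fin: "g x0 < \<infinity>"
  shows "Lam P \<psi> M \<le> ereal (ln \<rho>)"
proof -
  from M have "M \<in> borel_measurable borel" by (simp add: weighted_Linf2_def)
  then interpret irreducible_kernel \<psi> "scaled_kernel P M" by (rule scaled_irreducible)
  from ex_small_function[OF M] obtain s where s: "small_function \<psi> (scaled_kernel P M) s" by blast
  show ?thesis
    unfolding Lam_def ln_ennreal_le_iff
    using principal_eigenvalue_le[OF s g \<eta> \<rho> fin] \<rho>(1) by simp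
qed

lemma Lam_bounded:
  assumes c: "0 \<le> c"
  obtains B where "\<And>M. M \<in> borel_measurable borel \<Longrightarrow> (\<And>x y. \<bar>M (x, y)\<bar> \<le> c * (W0 x + W0 y)) \<Longrightarrow>
    Lam P \<psi> M \<le> ereal B"
proof -
  obtain g \<eta> \<rho> where g [measurable]: "g \<in> borel_measurable borel" and \<eta>: "0 < \<eta>" "\<And>x. \<eta> \<le> g x" and \<rho>: "0 < \<rho>" and
    super: "\<And>M x. M \<in> borel_measurable borel \<Longrightarrow> (\<And>x y. M (x, y) \<le> c * (W0 x + W0 y)) \<Longrightarrow>
       kapply (scaled_kernel P M) (\<lambda>y. ennreal (g y)) x \<le> ennreal \<rho> * ennreal (g x)"
    using scaled_drift[OF c] by blast
  show ?thesis
  proof (rule that)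
    fix M :: "'a \<times> 'a \<Rightarrow> real"
    assume M: "M \<in> borel_measurable borel" "\<And>x y. \<bar>M (x, y)\<bar> \<le> c * (W0 x + W0 y)"
    then have "M \<in> weighted_Linf2 W0" using c by (auto simp: weighted_Linf2_iff[OF W0_ge_1])
    moreover have "kapply (scaled_kernel P M) (\<lambda>y. ennreal (g y)) x \<le> ennreal \<rho> * ennreal (g x)" for x
      by (rule super[OF M(1) order_trans[OF abs_ge_self M(2)]])
    ultimately show "Lam P \<psi> M \<le> ereal (ln \<rho>)"
      using \<eta> \<rho> by (intro Lam_le[of M "\<lambda>x. ennreal (g x)" \<eta> \<rho> undefined]) (auto intro!: ennreal_leI)
  qed
qed

lemma Lam_finite:
  assumes M: "M \<in> weighted_Linf2 W0"
  shows "\<bar>Lam P \<psi> M\<bar> \<noteq> \<infinity>"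
proof -
  from M obtain c where c: "0 \<le> c" "\<And>x y. \<bar>M (x, y)\<bar> \<le> c * (W0 x + W0 y)"
    and M_meas [measurable]: "M \<in> borel_measurable borel"
    by (auto simp: weighted_Linf2_iff[OF W0_ge_1])
  interpret irreducible_kernel \<psi> "scaled_kernel P M" by (rule scaled_irreducible) fact
  from ex_small_function[OF M] obtain s where s: "small_function \<psi> (scaled_kernel P M) s" by blast
  obtain B where "Lam P \<psi> M \<le> ereal B" using Lam_bounded[OF c(1)] c(2) M_meas by metis
  then have "Lam P \<psi> M \<noteq> \<infinity>" by auto
  moreover have "Lam P \<psi> M \<noteq> -\<infinity>"
    using principal_eigenvalue_pos[OF s] by (auto simp: Lam_def ln_ennreal_def)
  ultimately show ?thesis by auto
qed

lemma Lam_supersolution: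
  assumes M: "M \<in> weighted_Linf2 W0" and L: "Lam P \<psi> M < ereal r"
  obtains u where "u \<in> borel_measurable borel" "\<And>x. 0 < u x" "\<exists>x. u x < \<infinity>"
    "\<And>x. (\<integral>\<^sup>+ y. ennreal (exp (M (x, y))) * u y \<partial>P x) \<le> ennreal (exp r) * u x"
proof -
  from M have M_meas [measurable]: "M \<in> borel_measurable borel" by (simp add: weighted_Linf2_def)
  interpret irreducible_kernel \<psi> "scaled_kernel P M" by (rule scaled_irreducible) fact
  from ex_small_function[OF M] obtain s where s: "small_function \<psi> (scaled_kernel P M) s" by blast
  have sm [measurable]: "(\<lambda>x. ennreal (s x)) \<in> borel_measurable borel" and s_pos: "0 < (\<integral>\<^sup>+ x. ennreal (s x) \<partial>\<psi>)"
    using s by (auto simp: small_function_def)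
  have less: "principal_eigenvalue \<psi> (scaled_kernel P M) < ennreal (exp r)"
  proof (rule ccontr)
    assume "\<not> ?thesis"
    then have le: "ennreal (exp r) \<le> principal_eigenvalue \<psi> (scaled_kernel P M)" by simp
    show False
    proof (cases "principal_eigenvalue \<psi> (scaled_kernel P M)")
      case (real a)
      then have a: "exp r \<le> a" using le by (simp add: ennreal_le_iff2)
      then have a0: "0 < a" using exp_gt_zero[of r] by linarith
      then have "r \<le> ln a" using a by (simp add: ln_ge_iff)
      then show False using L real a0 by (simp add: Lam_def ln_ennreal_def)
    next
      case top
      then show False using L by (simp add: Lam_def ln_ennreal_def)
    qed
  qed
  let ?u = "resolvent (scaled_kernel P M) (exp r) (\<lambda>x. ennreal (s x))"
  have k: "(\<lambda>z. ennreal (exp (M z))) \<in> borel_measurable borel" by measurable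
  have u: "?u \<in> borel_measurable borel" by (rule measurable_R[OF sm])
  show ?thesis
  proof (rule that[OF u])
    show "0 < ?u x" for x using s_pos by (intro resolvent_pos) auto
    show "\<exists>x. ?u x < \<infinity>" using principal_eigenvalue_finite[OF s s less] by (rule ex_of_AE)
    have "kapply (scaled_kernel P M) ?u x \<le> ennreal (exp r) * ?u x" for x
      by (rule kapply_resolvent_le[OF normal sm]) simp
    moreover have "kapply (scaled_kernel P M) ?u x = (\<integral>\<^sup>+ y. ennreal (exp (M (x, y))) * ?u y \<partial>P x)" for x
      using kapply_weighted_kernel[OF kernel k u, of x] by (simp add: scaled_kernel_eq)
    ultimately show "(\<integral>\<^sup>+ y. ennreal (exp (M (x, y))) * ?u y \<partial>P x) \<le> ennreal (exp r) * ?u x" for x by simp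
  qed
qed

end

section \<open>Relative entropy and cohomologous functions\<close>

text \<open>
  The difference of two random variables with the same law has mean \<open>0\<close> as soon as its
  positive part is integrable, even if the variables themselves are not integrable. For
  truncations at level \<open>n\<close> the mean is \<open>0\<close>, so the negative part has the same integral as the
  positive part; truncation decreases the positive part, and the bound on the negative part
  survives by Fatou's lemma.
\<close>

lemma integral_diff_same_distribution:
  fixes X Y G :: "'b \<Rightarrow> real"
  assumes "prob_space \<Gamma>"
    and [measurable]: "X \<in> borel_measurable \<Gamma>" "Y \<in> borel_measurable \<Gamma>"
    and eq: "distr \<Gamma> borel X = distr \<Gamma> borel Y"
    and G: "integrable \<Gamma> G" and le: "AE z in \<Gamma>. Y z - X z \<le> G z"
  shows "integrable \<Gamma> (\<lambda>z. Y z - X z)" and "(\<integral>z. Y z - X z \<partial>\<Gamma>) = 0"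
proof -
  interpret prob_space \<Gamma> by fact
  note [measurable] = borel_measurable_integrable[OF G]
  define c where "c n t = max (- real n) (min (real n) t)" for n t
  have [measurable]: "c n \<in> borel_measurable borel" for n unfolding c_def by measurable
  have c_bound: "\<bar>c n t\<bar> \<le> real n" for n t by (auto simp: c_def)
  have c_lip: "\<bar>c n s - c n t\<bar> \<le> \<bar>s - t\<bar>" for n s t by (auto simp: c_def)
  have c_pos: "c n s - c n t \<le> max 0 (s - t)" for n s t by (auto simp: c_def)
  have c_ev: "\<forall>\<^sub>F n in sequentially. c n t = t" for t
  proof -
    obtain N where "\<bar>t\<bar> \<le> real N" using real_arch_simple by blast
    then have "c n t = t" if "N \<le> n" for n
      using that by (auto simp: c_def max_def min_def)
    then show ?thesis unfolding eventually_sequentially by blast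
  qed
  define d where "d n z = c n (Y z) - c n (X z)" for n z
  have [measurable]: "d n \<in> borel_measurable \<Gamma>" for n unfolding d_def by measurable
  have int_c: "integrable \<Gamma> (\<lambda>z. c n (X z))" "integrable \<Gamma> (\<lambda>z. c n (Y z))" for n
    using c_bound by (auto intro!: integrable_const_bound[where B = "real n"])
  have d_int: "integrable \<Gamma> (d n)" for n unfolding d_def using int_c by simp
  have d_0: "(\<integral>z. d n z \<partial>\<Gamma>) = 0" for n
  proof -
    have "(\<integral>z. c n (X z) \<partial>\<Gamma>) = (\<integral>t. c n t \<partial>distr \<Gamma> borel X)" by (simp add: integral_distr)
    also have "\<dots> = (\<integral>z. c n (Y z) \<partial>\<Gamma>)" unfolding eq by (simp add: integral_distr)
    finally show ?thesis unfolding d_def using int_c by simp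
  qed
  have d_lim: "\<forall>\<^sub>F n in sequentially. d n z = Y z - X z" for z
    using c_ev[of "Y z"] c_ev[of "X z"] by eventually_elim (simp add: d_def)
  define B where "B = (\<integral>z. max 0 (G z) \<partial>\<Gamma>)"
  have G_int: "integrable \<Gamma> (\<lambda>z. max 0 (G z))" using G by simp
  have neg: "(\<integral>\<^sup>+ z. ennreal (max 0 (- d n z)) \<partial>\<Gamma>) \<le> ennreal B" for n
  proof -
    have int: "integrable \<Gamma> (\<lambda>z. max 0 (- d n z))" "integrable \<Gamma> (\<lambda>z. max 0 (d n z))"
      using d_int[of n] by auto
    have "(\<integral>z. max 0 (- d n z) \<partial>\<Gamma>) = (\<integral>z. max 0 (d n z) - d n z \<partial>\<Gamma>)"
      by (intro Bochner_Integration.integral_cong) auto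
    also have "\<dots> = (\<integral>z. max 0 (d n z) \<partial>\<Gamma>)" using int d_int[of n] d_0[of n] by simp
    also have "\<dots> \<le> B"
      unfolding B_def
    proof (intro integral_mono_AE int G_int)
      show "AE z in \<Gamma>. max 0 (d n z) \<le> max 0 (G z)"
        using le by eventually_elim (use c_pos in \<open>auto simp: d_def intro: order_trans[OF c_pos]\<close>)
    qed
    finally show ?thesis using int by (subst nn_integral_eq_integral) (auto intro!: ennreal_leI)
  qed
  have "(\<integral>\<^sup>+ z. ennreal (max 0 (- (Y z - X z))) \<partial>\<Gamma>) \<le> (\<integral>\<^sup>+ z. liminf (\<lambda>n. ennreal (max 0 (- d n z))) \<partial>\<Gamma>)"
  proof (intro nn_integral_mono)
    fix z
    have "(\<lambda>n. ennreal (max 0 (- d n z))) \<longlonglongrightarrow> ennreal (max 0 (- (Y z - X z)))"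
      by (rule tendsto_eventually) (use d_lim[of z] in \<open>eventually_elim, simp\<close>)
    then show "ennreal (max 0 (- (Y z - X z))) \<le> liminf (\<lambda>n. ennreal (max 0 (- d n z)))"
      by (simp add: lim_imp_Liminf)
  qed
  also have "\<dots> \<le> liminf (\<lambda>n. \<integral>\<^sup>+ z. ennreal (max 0 (- d n z)) \<partial>\<Gamma>)"
    by (intro nn_integral_liminf) measurable
  also have "\<dots> \<le> ennreal B"
    by (intro Liminf_le always_eventually allI neg) simp
  finally have fin: "(\<integral>\<^sup>+ z. ennreal (max 0 (- (Y z - X z))) \<partial>\<Gamma>) < \<infinity>" by (rule le_less_trans) simp
  have neg_int: "integrable \<Gamma> (\<lambda>z. max 0 (- (Y z - X z)))"
    using fin by (intro integrableI_nonneg) auto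
  show int: "integrable \<Gamma> (\<lambda>z. Y z - X z)"
  proof (rule Bochner_Integration.integrable_bound)
    show "integrable \<Gamma> (\<lambda>z. max 0 (G z) + max 0 (- (Y z - X z)))" using G_int neg_int by simp
    show "AE z in \<Gamma>. norm (Y z - X z) \<le> norm (max 0 (G z) + max 0 (- (Y z - X z)))"
      using le by eventually_elim auto
  qed measurable
  have "(\<lambda>n. \<integral>z. d n z \<partial>\<Gamma>) \<longlonglongrightarrow> (\<integral>z. Y z - X z \<partial>\<Gamma>)"
  proof (rule integral_dominated_convergence[where w = "\<lambda>z. \<bar>Y z - X z\<bar>"])
    show "AE z in \<Gamma>. (\<lambda>n. d n z) \<longlonglongrightarrow> Y z - X z"
      by (intro always_eventually allI tendsto_eventually d_lim)
    show "AE z in \<Gamma>. norm (d n z) \<le> \<bar>Y z - X z\<bar>" for n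
      using c_lip by (auto simp: d_def)
  qed (use int in auto)
  then show "(\<integral>z. Y z - X z \<partial>\<Gamma>) = 0" unfolding d_0 by (simp add: LIMSEQ_const_iff)
qed

lemma log_exp_1: "log (exp 1) x = ln x"
  by (simp add: log_def)

lemma entropy_density_exp_1: "entropy_density (exp 1) \<mu> \<Gamma> z = ln (enn2real (RN_deriv \<mu> \<Gamma> z))"
  by (simp add: entropy_density_def log_exp_1)

lemma AE_RN_deriv_pos:
  assumes "prob_space \<mu>" "prob_space \<Gamma>" "sets \<Gamma> = sets \<mu>" "absolutely_continuous \<mu> \<Gamma>"
  shows "AE z in \<mu>. RN_deriv \<mu> \<Gamma> z = ennreal (enn2real (RN_deriv \<mu> \<Gamma> z))"
    and "AE z in \<Gamma>. 0 < enn2real (RN_deriv \<mu> \<Gamma> z)"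
proof -
  interpret \<mu>: prob_space \<mu> by fact
  interpret \<Gamma>: prob_space \<Gamma> by fact
  have fin: "AE z in \<mu>. RN_deriv \<mu> \<Gamma> z \<noteq> \<infinity>"
    by (rule \<mu>.RN_deriv_finite[OF \<Gamma>.sigma_finite_measure_axioms assms(4,3)])
  then show "AE z in \<mu>. RN_deriv \<mu> \<Gamma> z = ennreal (enn2real (RN_deriv \<mu> \<Gamma> z))"
    by eventually_elim (simp add: less_top)
  have dens: "density \<mu> (RN_deriv \<mu> \<Gamma>) = \<Gamma>" by (rule \<mu>.density_RN_deriv[OF assms(4,3)])
  have "AE z in density \<mu> (RN_deriv \<mu> \<Gamma>). 0 < enn2real (RN_deriv \<mu> \<Gamma> z)"
    using fin by (subst AE_density) (auto simp: enn2real_positive_iff less_top)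
  then show "AE z in \<Gamma>. 0 < enn2real (RN_deriv \<mu> \<Gamma> z)" unfolding dens .
qed

lemma nn_integral_RN_deriv:
  assumes "prob_space \<mu>" "prob_space \<Gamma>" "sets \<Gamma> = sets \<mu>" "absolutely_continuous \<mu> \<Gamma>"
    and [measurable]: "f \<in> borel_measurable \<mu>"
  shows "(\<integral>\<^sup>+ z. f z \<partial>\<Gamma>) = (\<integral>\<^sup>+ z. ennreal (enn2real (RN_deriv \<mu> \<Gamma> z)) * f z \<partial>\<mu>)"
proof -
  interpret \<mu>: prob_space \<mu> by fact
  have "(\<integral>\<^sup>+ z. f z \<partial>\<Gamma>) = (\<integral>\<^sup>+ z. RN_deriv \<mu> \<Gamma> z * f z \<partial>\<mu>)"
    by (rule \<mu>.RN_deriv_nn_integral[OF assms(4,3)]) measurable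
  also have "\<dots> = (\<integral>\<^sup>+ z. ennreal (enn2real (RN_deriv \<mu> \<Gamma> z)) * f z \<partial>\<mu>)"
    using AE_RN_deriv_pos(1)[OF assms(1-4)] by (intro nn_integral_cong_AE) (auto elim!: eventually_mono)
  finally show ?thesis .
qed

text \<open>
  The test functions are truncations \<open>f\<^sub>n\<close> of the logarithm of the density \<open>h\<close>, set to \<open>- n\<close> where
  \<open>h = 0\<close> (there \<open>ln h\<close> has the default value \<open>0\<close>). They satisfy \<open>\<integral>exp f\<^sub>n d\<mu> \<le> 1 + e\<^sup>-\<^sup>n\<close>, and the
  negative part of \<open>ln h\<close> is always \<open>\<Gamma>\<close>-integrable.
\<close>

lemma Donsker_Varadhan_bound:
  assumes pm: "prob_space \<mu>" "prob_space \<Gamma>" and sets: "sets \<Gamma> = sets \<mu>" and ac: "absolutely_continuous \<mu> \<Gamma>"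
    and bound: "\<And>f b. f \<in> borel_measurable \<mu> \<Longrightarrow> (\<And>z. \<bar>f z\<bar> \<le> b) \<Longrightarrow>
       (\<integral>z. f z \<partial>\<Gamma>) \<le> S + ln (\<integral>z. exp (f z) \<partial>\<mu>)"
  shows "integrable \<Gamma> (entropy_density (exp 1) \<mu> \<Gamma>)" and "KL_divergence (exp 1) \<mu> \<Gamma> \<le> S"
proof -
  interpret \<mu>: prob_space \<mu> by fact
  interpret \<Gamma>: prob_space \<Gamma> by fact
  note mc = measurable_cong_sets[OF sets refl]
  define h where "h z = enn2real (RN_deriv \<mu> \<Gamma> z)" for z
  have h [measurable]: "h \<in> borel_measurable \<mu>" unfolding h_def by measurable
  have h' [measurable]: "h \<in> borel_measurable \<Gamma>" by (simp add: mc h)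
  have h_nn: "0 \<le> h z" for z by (simp add: h_def)
  have h_pos: "AE z in \<Gamma>. 0 < h z" unfolding h_def by (rule AE_RN_deriv_pos(2)[OF pm sets ac])
  have nn: "(\<integral>\<^sup>+ z. f z \<partial>\<Gamma>) = (\<integral>\<^sup>+ z. ennreal (h z) * f z \<partial>\<mu>)" if "f \<in> borel_measurable \<mu>" for f
    unfolding h_def by (rule nn_integral_RN_deriv[OF pm sets ac that])
  define D where "D z = ln (h z)" for z
  have D [measurable]: "D \<in> borel_measurable \<mu>" "D \<in> borel_measurable \<Gamma>" unfolding D_def by measurable
  have ed: "entropy_density (exp 1) \<mu> \<Gamma> = D" by (auto simp: entropy_density_exp_1 D_def h_def)
  define f where "f n z = (if h z = 0 then - real n else max (- real n) (min (real n) (D z)))" for n z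
  have f [measurable]: "f n \<in> borel_measurable \<mu>" "f n \<in> borel_measurable \<Gamma>" for n
    unfolding f_def by measurable
  have f_bound: "\<bar>f n z\<bar> \<le> real n" for n z by (auto simp: f_def)
  have f_int: "integrable \<Gamma> (f n)" for n
    using f_bound by (intro \<Gamma>.integrable_const_bound[where B = "real n"]) auto
  have f_D: "\<bar>f n z\<bar> \<le> \<bar>D z\<bar>" if "0 < h z" for n z using that by (auto simp: f_def)
  have f_le: "(\<integral>z. f n z \<partial>\<Gamma>) \<le> S + exp (- real n)" for n
  proof -
    have exp_f: "exp (f n z) \<le> h z + exp (- real n)" for z
    proof (cases "h z = 0")
      case False
      then have hz: "0 < h z" using h_nn[of z] by simp
      have "f n z \<le> max (- real n) (D z)" using False by (auto simp: f_def)
      then have "exp (f n z) \<le> exp (max (- real n) (D z))" by simp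
      also have "\<dots> \<le> exp (D z) + exp (- real n)" by (simp add: max_def)
      finally show ?thesis using hz by (simp add: D_def)
    qed (simp add: f_def)
    have int_h: "integrable \<mu> h" "(\<integral>z. h z \<partial>\<mu>) = 1"
    proof -
      have *: "(\<integral>\<^sup>+ z. ennreal (h z) \<partial>\<mu>) = ennreal 1"
        using nn[of "\<lambda>_. 1"] \<Gamma>.emeasure_space_1 by simp
      show "integrable \<mu> h" by (rule integrableI_nn_integral_finite[OF h _ *]) (simp_all add: h_nn)
      show "(\<integral>z. h z \<partial>\<mu>) = 1" by (rule integral_eq_nn_integral[THEN trans]) (simp_all add: h_nn *)
    qed
    have int_e: "integrable \<mu> (\<lambda>z. exp (f n z))"
      using f_bound by (intro \<mu>.integrable_const_bound[where B = "exp (real n)"]) (auto simp: abs_le_iff)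
    have pos: "0 < (\<integral>z. exp (f n z) \<partial>\<mu>)"
    proof -
      have "exp (- real n) \<le> (\<integral>z. exp (f n z) \<partial>\<mu>)"
        using \<mu>.integral_ge_const[OF int_e, of "exp (- real n)"] f_bound by (auto simp: abs_le_iff minus_le_iff)
      then show ?thesis using exp_gt_zero[of "- real n"] by linarith
    qed
    have "(\<integral>z. exp (f n z) \<partial>\<mu>) \<le> (\<integral>z. h z + exp (- real n) \<partial>\<mu>)"
      using int_h int_e exp_f by (intro integral_mono) auto
    also have "\<dots> = 1 + exp (- real n)" using int_h \<mu>.prob_space by simp
    finally have "ln (\<integral>z. exp (f n z) \<partial>\<mu>) \<le> ln (1 + exp (- real n))" using pos by simp
    also have "\<dots> \<le> exp (- real n)" by (rule ln_add_one_self_le_self) simp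
    finally show ?thesis using bound[OF f(1)[of n] f_bound] by linarith
  qed
  have neg: "(\<integral>\<^sup>+ z. ennreal (max 0 (- D z)) \<partial>\<Gamma>) \<le> 1"
  proof -
    have "(\<integral>\<^sup>+ z. ennreal (max 0 (- D z)) \<partial>\<Gamma>) = (\<integral>\<^sup>+ z. ennreal (h z) * ennreal (max 0 (- D z)) \<partial>\<mu>)"
      by (rule nn) measurable
    also have "\<dots> \<le> (\<integral>\<^sup>+ z. 1 \<partial>\<mu>)"
    proof (rule nn_integral_mono)
      fix z
      have "h z * max 0 (- D z) \<le> 1"
      proof (cases "h z = 0")
        case False
        then have hz: "0 < h z" using h_nn[of z] by simp
        have "- D z \<le> 1 / h z" using ln_le_minus_one[of "1 / h z"] hz by (simp add: D_def ln_div)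
        then have "max 0 (- D z) \<le> 1 / h z" using hz by simp
        then have "h z * max 0 (- D z) \<le> h z * (1 / h z)" using hz by (intro mult_left_mono) auto
        then show ?thesis using hz by simp
      qed simp
      moreover have "ennreal (h z) * ennreal (max 0 (- D z)) = ennreal (h z * max 0 (- D z))"
        by (rule ennreal_mult[symmetric]) (simp_all add: h_nn)
      ultimately show "ennreal (h z) * ennreal (max 0 (- D z)) \<le> 1"
        by (simp only: ennreal_le_1)
    qed
    finally show ?thesis using \<mu>.emeasure_space_1 by simp
  qed
  have neg_int: "integrable \<Gamma> (\<lambda>z. max 0 (- D z))"
    by (intro integrableI_nonneg) (use neg in \<open>auto elim: le_less_trans\<close>)
  have neg_le: "(\<integral>z. max 0 (- D z) \<partial>\<Gamma>) \<le> 1"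
    using neg neg_int by (subst (asm) nn_integral_eq_integral) (auto simp: ennreal_le_1)
  have pos: "(\<integral>\<^sup>+ z. ennreal (max 0 (min (real n) (D z))) \<partial>\<Gamma>) \<le> ennreal (S + 2)" for n
  proof -
    have int: "integrable \<Gamma> (\<lambda>z. max 0 (min (real n) (D z)))"
      by (intro \<Gamma>.integrable_const_bound[where B = "real n"]) auto
    have "(\<integral>z. max 0 (min (real n) (D z)) \<partial>\<Gamma>) \<le> (\<integral>z. f n z + max 0 (- D z) \<partial>\<Gamma>)"
    proof (intro integral_mono_AE int Bochner_Integration.integrable_add f_int neg_int)
      show "AE z in \<Gamma>. max 0 (min (real n) (D z)) \<le> f n z + max 0 (- D z)"
        using h_pos by eventually_elim (auto simp: f_def max_def min_def)
    qed
    also have "\<dots> = (\<integral>z. f n z \<partial>\<Gamma>) + (\<integral>z. max 0 (- D z) \<partial>\<Gamma>)" using f_int neg_int by simp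
    also have "\<dots> \<le> S + 2"
    proof -
      have "exp (- real n) \<le> 1" by simp
      then show ?thesis using f_le[of n] neg_le by linarith
    qed
    finally show ?thesis using int by (subst nn_integral_eq_integral) (auto intro!: ennreal_leI)
  qed
  have "(\<integral>\<^sup>+ z. ennreal (max 0 (D z)) \<partial>\<Gamma>) = (\<integral>\<^sup>+ z. (SUP n. ennreal (max 0 (min (real n) (D z)))) \<partial>\<Gamma>)"
  proof (rule nn_integral_cong)
    fix z
    obtain n where n: "D z \<le> real n" using real_arch_simple by blast
    show "ennreal (max 0 (D z)) = (SUP n. ennreal (max 0 (min (real n) (D z))))"
    proof (rule antisym)
      show "ennreal (max 0 (D z)) \<le> (SUP n. ennreal (max 0 (min (real n) (D z))))"
        using n by (intro SUP_upper2[of n]) auto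
      show "(SUP n. ennreal (max 0 (min (real n) (D z)))) \<le> ennreal (max 0 (D z))"
        by (intro SUP_least ennreal_leI) auto
    qed
  qed
  also have "\<dots> = (SUP n. \<integral>\<^sup>+ z. ennreal (max 0 (min (real n) (D z))) \<partial>\<Gamma>)"
    by (intro nn_integral_monotone_convergence_SUP) (auto simp: incseq_def le_fun_def intro!: ennreal_leI)
  also have "\<dots> \<le> ennreal (S + 2)" by (intro SUP_least pos)
  finally have "(\<integral>\<^sup>+ z. ennreal (max 0 (D z)) \<partial>\<Gamma>) < \<infinity>" by (rule le_less_trans) simp
  then have pos_int: "integrable \<Gamma> (\<lambda>z. max 0 (D z))" by (intro integrableI_nonneg) auto
  have "D = (\<lambda>z. max 0 (D z) - max 0 (- D z))" by auto
  then have D_int: "integrable \<Gamma> D" using pos_int neg_int by (metis Bochner_Integration.integrable_diff)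
  then show "integrable \<Gamma> (entropy_density (exp 1) \<mu> \<Gamma>)" by (simp add: ed)
  have "(\<lambda>n. \<integral>z. f n z \<partial>\<Gamma>) \<longlonglongrightarrow> (\<integral>z. D z \<partial>\<Gamma>)"
  proof (rule integral_dominated_convergence[where w = "\<lambda>z. \<bar>D z\<bar>"])
    show "AE z in \<Gamma>. (\<lambda>n. f n z) \<longlonglongrightarrow> D z"
      using h_pos
    proof eventually_elim
      case (elim z)
      obtain N where "\<bar>D z\<bar> \<le> real N" using real_arch_simple by blast
      then have "f n z = D z" if "N \<le> n" for n
        using that elim by (auto simp: f_def max_def min_def)
      then show ?case by (intro tendsto_eventually) (auto simp: eventually_sequentially)
    qed
    show "AE z in \<Gamma>. norm (f n z) \<le> \<bar>D z\<bar>" for n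
      using h_pos by eventually_elim (simp add: f_D)
  qed (use D_int in auto)
  moreover have "(\<lambda>n. S + exp (- real n)) \<longlonglongrightarrow> S + 0"
    by (intro tendsto_add tendsto_const filterlim_compose[OF exp_at_bot])
      (simp add: filterlim_uminus_at_bot filterlim_real_sequentially)
  ultimately have "(\<integral>z. D z \<partial>\<Gamma>) \<le> S + 0"
    by (rule LIMSEQ_le) (use f_le in blast)
  then show "KL_divergence (exp 1) \<mu> \<Gamma> \<le> S" by (simp add: KL_divergence_def ed)
qed

section \<open>Signed measures\<close>

lemma signed_measure_Un:
  assumes \<gamma>: "signed_measure N \<gamma>" and AB: "A \<in> sets N" "B \<in> sets N" "A \<inter> B = {}"
  shows "\<gamma> (A \<union> B) = \<gamma> A + \<gamma> B"
proof -
  let ?A = "binaryset A B"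
  have "range ?A \<subseteq> sets N" "disjoint_family ?A"
    using AB by (auto simp: binaryset_def disjoint_family_on_def)
  then have "(\<lambda>i. \<gamma> (?A i)) sums \<gamma> (\<Union>i. ?A i)"
    using \<gamma> unfolding signed_measure_def by blast
  moreover have "(\<lambda>i. \<gamma> (?A i)) sums (\<gamma> A + \<gamma> B)"
    using \<gamma> by (intro binaryset_sums) (simp add: signed_measure_def)
  ultimately show ?thesis by (simp add: UN_binaryset_eq sums_iff)
qed

lemma signed_measure_uminus:
  "signed_measure N \<gamma> \<Longrightarrow> signed_measure N (\<lambda>A. - \<gamma> A)"
  by (auto simp: signed_measure_def intro!: sums_minus)

lemma sets_upper_variation [simp, measurable_cong]: "sets (upper_variation N \<gamma>) = sets N"
  by (simp add: upper_variation_def)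

text \<open>
  The supremum is superadditive because subsets of disjoint sets can be united, and
  countably subadditive because a subset of a countable union can be split.
\<close>

lemma emeasure_upper_variation:
  assumes \<gamma>: "signed_measure N \<gamma>" and A: "A \<in> sets N"
  shows "emeasure (upper_variation N \<gamma>) A = (SUP B\<in>{B \<in> sets N. B \<subseteq> A}. ennreal (\<gamma> B))"
proof -
  let ?u = "\<lambda>A. SUP B\<in>{B \<in> sets N. B \<subseteq> A}. ennreal (\<gamma> B)"
  have empty: "\<gamma> {} = 0" using \<gamma> by (simp add: signed_measure_def)
  have "countably_additive (sets N) ?u"
  proof (rule countably_additiveI)
    fix A :: "nat \<Rightarrow> 'a set" assume A: "range A \<subseteq> sets N" and disj: "disjoint_family A" and U: "(\<Union>i. A i) \<in> sets N"
    have Ai: "A i \<in> sets N" for i using A by auto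
    show "(\<Sum>i. ?u (A i)) = ?u (\<Union>i. A i)"
    proof (rule antisym)
      have fin: "(\<Sum>i<n. ?u (A i)) \<le> ?u (\<Union>i<n. A i)" for n
      proof (induction n)
        case (Suc n)
        have "?u C + ?u D \<le> ?u (C \<union> D)" if "C \<in> sets N" "D \<in> sets N" "C \<inter> D = {}" for C D
        proof -
          have "?u C + ?u D = (SUP B\<in>{B \<in> sets N. B \<subseteq> C}. ennreal (\<gamma> B) + ?u D)"
            by (subst ennreal_SUP_add_left) auto
          also have "\<dots> = (SUP B\<in>{B \<in> sets N. B \<subseteq> C}. SUP E\<in>{E \<in> sets N. E \<subseteq> D}. ennreal (\<gamma> B) + ennreal (\<gamma> E))"
            by (subst ennreal_SUP_add_right) auto
          also have "\<dots> \<le> ?u (C \<union> D)"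
          proof (intro SUP_least)
            fix B E assume B: "B \<in> {B \<in> sets N. B \<subseteq> C}" and E: "E \<in> {E \<in> sets N. E \<subseteq> D}"
            consider "0 \<le> \<gamma> B" "0 \<le> \<gamma> E" | "\<gamma> B < 0" | "\<gamma> E < 0" by linarith
            then show "ennreal (\<gamma> B) + ennreal (\<gamma> E) \<le> ?u (C \<union> D)"
            proof cases
              case 1
              have "B \<inter> E = {}" using B E that by auto
              then have "ennreal (\<gamma> B) + ennreal (\<gamma> E) = ennreal (\<gamma> (B \<union> E))"
                using 1 B E by (subst signed_measure_Un[OF \<gamma>]) (auto simp: ennreal_plus)
              also have "\<dots> \<le> ?u (C \<union> D)" using B E by (intro SUP_upper) auto
              finally show ?thesis .
            next
              case 2
              then show ?thesis using E by (auto simp: ennreal_neg intro!: SUP_upper)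
            next
              case 3
              then show ?thesis using B by (auto simp: ennreal_neg intro!: SUP_upper)
            qed
          qed
          finally show ?thesis .
        qed
        moreover have "(\<Union>i<n. A i) \<in> sets N" using Ai by auto
        moreover have "A i \<inter> A n = {}" if "i < n" for i
          using disj that by (auto simp: disjoint_family_on_def)
        then have "(\<Union>i<n. A i) \<inter> A n = {}" by blast
        ultimately have "?u (\<Union>i<n. A i) + ?u (A n) \<le> ?u ((\<Union>i<n. A i) \<union> A n)"
          using Ai by simp
        also have "(\<Union>i<n. A i) \<union> A n = (\<Union>i<Suc n. A i)" by (auto simp: less_Suc_eq)
        finally show ?case
          unfolding sum.lessThan_Suc by (rule order_trans[OF add_right_mono[OF Suc]])
      qed simp
      show "(\<Sum>i. ?u (A i)) \<le> ?u (\<Union>i. A i)"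
        unfolding suminf_eq_SUP
      proof (rule SUP_least)
        fix n
        have "?u (\<Union>i<n. A i) \<le> ?u (\<Union>i. A i)" by (intro SUP_subset_mono) auto
        with fin[of n] show "(\<Sum>i<n. ?u (A i)) \<le> ?u (\<Union>i. A i)" by (rule order_trans)
      qed
    next
      show "?u (\<Union>i. A i) \<le> (\<Sum>i. ?u (A i))"
      proof (rule SUP_least)
        fix B assume B: "B \<in> {B \<in> sets N. B \<subseteq> (\<Union>i. A i)}"
        have "range (\<lambda>i. B \<inter> A i) \<subseteq> sets N" "disjoint_family (\<lambda>i. B \<inter> A i)"
          using B Ai disj by (auto simp: disjoint_family_on_def)
        then have "(\<lambda>i. \<gamma> (B \<inter> A i)) sums \<gamma> (\<Union>i. B \<inter> A i)"
          using \<gamma> unfolding signed_measure_def by blast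
        moreover have "(\<Union>i. B \<inter> A i) = B" using B by auto
        ultimately have sums: "(\<lambda>i. \<gamma> (B \<inter> A i)) sums \<gamma> B" by simp
        have "(\<lambda>n. ennreal (\<Sum>i<n. \<gamma> (B \<inter> A i))) \<longlonglongrightarrow> ennreal (\<gamma> B)"
          using sums unfolding sums_def by (intro tendsto_ennrealI)
        moreover have "ennreal (\<Sum>i<n. \<gamma> (B \<inter> A i)) \<le> (\<Sum>i. ?u (A i))" for n
        proof -
          have "ennreal (\<Sum>i<n. \<gamma> (B \<inter> A i)) \<le> ennreal (\<Sum>i<n. max 0 (\<gamma> (B \<inter> A i)))"
            by (intro ennreal_leI sum_mono) auto
          also have "\<dots> = (\<Sum>i<n. ennreal (max 0 (\<gamma> (B \<inter> A i))))" by (rule sum_ennreal[symmetric]) simp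
          also have "\<dots> \<le> (\<Sum>i<n. ?u (A i))"
          proof (rule sum_mono)
            fix i
            have "ennreal (max 0 (\<gamma> (B \<inter> A i))) = ennreal (\<gamma> (B \<inter> A i))"
              by (simp add: max_def ennreal_neg)
            also have "\<dots> \<le> ?u (A i)" using B Ai by (intro SUP_upper) auto
            finally show "ennreal (max 0 (\<gamma> (B \<inter> A i))) \<le> ?u (A i)" .
          qed
          also have "\<dots> \<le> (\<Sum>i. ?u (A i))" by (intro sum_le_suminf summableI) auto
          finally show ?thesis .
        qed
        ultimately show "ennreal (\<gamma> B) \<le> (\<Sum>i. ?u (A i))"
          by (intro LIMSEQ_le_const2) auto
      qed
    qed
  qed
  moreover have "positive (sets N) ?u"
  proof -
    have "{B \<in> sets N. B \<subseteq> {}} = {{}}" by auto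
    then show ?thesis by (simp add: positive_def empty)
  qed
  ultimately show ?thesis
    unfolding upper_variation_def using A
    by (intro emeasure_measure_of_sigma) (auto intro: sets.sigma_algebra_axioms)
qed

lemma upper_variation_measure:
  assumes "finite_measure \<Gamma>"
  shows "signed_measure \<Gamma> (measure \<Gamma>)"
    and "upper_variation \<Gamma> (measure \<Gamma>) = \<Gamma>"
    and "upper_variation \<Gamma> (\<lambda>A. - measure \<Gamma> A) = null_measure \<Gamma>"
proof -
  interpret finite_measure \<Gamma> by fact
  show sm: "signed_measure \<Gamma> (measure \<Gamma>)"
    unfolding signed_measure_def
    by (intro conjI allI impI finite_measure_UNION) (simp_all add: measure_notin_sets)
  show "upper_variation \<Gamma> (measure \<Gamma>) = \<Gamma>"
  proof (rule measure_eqI)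
    fix A assume "A \<in> sets (upper_variation \<Gamma> (measure \<Gamma>))"
    then have A: "A \<in> sets \<Gamma>" by simp
    have "(SUP B\<in>{B \<in> sets \<Gamma>. B \<subseteq> A}. ennreal (measure \<Gamma> B)) = ennreal (measure \<Gamma> A)"
      using A by (intro antisym SUP_least SUP_upper) (auto intro!: ennreal_leI finite_measure_mono)
    then show "emeasure (upper_variation \<Gamma> (measure \<Gamma>)) A = emeasure \<Gamma> A"
      by (simp add: emeasure_upper_variation[OF sm A] emeasure_eq_measure)
  qed simp
  show "upper_variation \<Gamma> (\<lambda>A. - measure \<Gamma> A) = null_measure \<Gamma>"
  proof (rule measure_eqI)
    fix A assume "A \<in> sets (upper_variation \<Gamma> (\<lambda>A. - measure \<Gamma> A))"
    then have A: "A \<in> sets \<Gamma>" by simp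
    have "(SUP B\<in>{B \<in> sets \<Gamma>. B \<subseteq> A}. ennreal (- measure \<Gamma> B)) \<le> 0"
      by (intro SUP_least) (auto simp: ennreal_neg)
    then show "emeasure (upper_variation \<Gamma> (\<lambda>A. - measure \<Gamma> A)) A = emeasure (null_measure \<Gamma>) A"
      by (simp add: emeasure_upper_variation[OF signed_measure_uminus[OF sm] A])
  qed simp
qed

lemma upper_variation_cong_sets:
  "sets N = sets N' \<Longrightarrow> upper_variation N \<gamma> = upper_variation N' \<gamma>"
  using sets_eq_imp_space_eq[of N N'] by (simp add: upper_variation_def)

lemma upper_variation_borel:
  assumes "prob_space \<Gamma>" "sets \<Gamma> = sets borel"
  shows "upper_variation borel (measure \<Gamma>) = \<Gamma>"
    and "upper_variation borel (\<lambda>A. - measure \<Gamma> A) = null_measure \<Gamma>"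
  using upper_variation_measure(2,3)[of \<Gamma>] assms upper_variation_cong_sets[OF assms(2)]
  by (auto simp: prob_space_def)

text \<open>
  If both variations are finite then \<open>\<gamma>\<close> is their difference, and a Hahn decomposition of the
  variations as a pair of finite measures is one of \<open>\<gamma>\<close>.
\<close>

lemma signed_measure_Hahn:
  assumes \<gamma>: "signed_measure N \<gamma>"
    and fin: "emeasure (upper_variation N \<gamma>) (space N) < \<infinity>"
      "emeasure (upper_variation N (\<lambda>A. - \<gamma> A)) (space N) < \<infinity>"
  obtains Y where "Y \<in> sets N" "emeasure (upper_variation N \<gamma>) (space N - Y) = 0"
    "emeasure (upper_variation N (\<lambda>A. - \<gamma> A)) Y = 0"
proof -
  let ?p = "upper_variation N \<gamma>" and ?m = "upper_variation N (\<lambda>A. - \<gamma> A)"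
  note \<gamma>' = signed_measure_uminus[OF \<gamma>]
  have space: "space ?p = space N" "space ?m = space N" by (rule sets_eq_imp_space_eq[OF sets_upper_variation])+
  interpret p: finite_measure ?p by (rule finite_measureI) (use fin space in auto)
  interpret m: finite_measure ?m by (rule finite_measureI) (use fin space in auto)
  \<comment> \<open>Complementing inside \<open>A\<close> turns the supremum of \<open>- \<gamma>\<close> into that of \<open>\<gamma>\<close> shifted by \<open>\<gamma>(A)\<close>.\<close>
  have shift: "measure (upper_variation N (\<lambda>A. - \<kappa> A)) A \<le> measure (upper_variation N \<kappa>) A - \<kappa> A"
    if \<kappa>: "signed_measure N \<kappa>" and A: "A \<in> sets N"
      and f1: "emeasure (upper_variation N \<kappa>) A < \<infinity>" and f2: "emeasure (upper_variation N (\<lambda>A. - \<kappa> A)) A < \<infinity>" for \<kappa> A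
  proof -
    have ge: "\<kappa> B \<le> measure (upper_variation N \<kappa>) A" if "B \<in> sets N" "B \<subseteq> A" for B
    proof -
      have "ennreal (\<kappa> B) \<le> emeasure (upper_variation N \<kappa>) A"
        unfolding emeasure_upper_variation[OF \<kappa> A] using that by (intro SUP_upper) auto
      then show ?thesis
        using f1 measure_nonneg[of "upper_variation N \<kappa>" A]
        by (auto simp: emeasure_eq_ennreal_measure less_top ennreal_le_iff2 intro: order_trans)
    qed
    have "emeasure (upper_variation N (\<lambda>A. - \<kappa> A)) A \<le> ennreal (measure (upper_variation N \<kappa>) A - \<kappa> A)"
      unfolding emeasure_upper_variation[OF signed_measure_uminus[OF \<kappa>] A]
    proof (rule SUP_least)
      fix B assume B: "B \<in> {B \<in> sets N. B \<subseteq> A}"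
      have "\<kappa> (B \<union> (A - B)) = \<kappa> B + \<kappa> (A - B)" using B A by (intro signed_measure_Un[OF \<kappa>]) auto
      moreover have "B \<union> (A - B) = A" using B by auto
      ultimately have "- \<kappa> B = \<kappa> (A - B) - \<kappa> A" by simp
      also have "\<dots> \<le> measure (upper_variation N \<kappa>) A - \<kappa> A" using ge[of "A - B"] A B by auto
      finally show "ennreal (- \<kappa> B) \<le> ennreal (measure (upper_variation N \<kappa>) A - \<kappa> A)" by (rule ennreal_leI)
    qed
    moreover have "0 \<le> measure (upper_variation N \<kappa>) A - \<kappa> A" using ge[OF A] by simp
    ultimately show ?thesis using f2 by (simp add: emeasure_eq_ennreal_measure less_top)
  qed
  have jordan: "\<gamma> A = measure ?p A - measure ?m A" if A: "A \<in> sets N" for A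
  proof -
    have f: "emeasure ?p A < \<infinity>" "emeasure ?m A < \<infinity>"
      by (simp_all add: top.not_eq_extremum[symmetric])
    show ?thesis using shift[OF \<gamma> A f] shift[OF \<gamma>' A f(2)] f by simp
  qed
  from finite_unsigned_Hahn_decomposition[OF p.finite_measure_axioms m.finite_measure_axioms]
  obtain Y where Y: "Y \<in> sets N"
    "\<And>X. X \<in> sets N \<Longrightarrow> X \<subseteq> Y \<Longrightarrow> emeasure ?m X \<le> emeasure ?p X"
    "\<And>X. X \<in> sets N \<Longrightarrow> X \<inter> Y = {} \<Longrightarrow> emeasure ?p X \<le> emeasure ?m X"
    by auto
  show ?thesis
  proof (rule that[OF Y(1)])
    have "emeasure ?p (space N - Y) = (SUP B\<in>{B \<in> sets N. B \<subseteq> space N - Y}. ennreal (\<gamma> B))"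
      using Y by (intro emeasure_upper_variation[OF \<gamma>]) auto
    also have "\<dots> \<le> 0"
    proof (rule SUP_least)
      fix B assume B: "B \<in> {B \<in> sets N. B \<subseteq> space N - Y}"
      then have "measure ?p B \<le> measure ?m B"
        using Y(3)[of B] by (auto simp: p.emeasure_eq_measure m.emeasure_eq_measure ennreal_le_iff)
      then show "ennreal (\<gamma> B) \<le> 0" using B by (simp add: jordan ennreal_neg)
    qed
    finally show "emeasure ?p (space N - Y) = 0" by simp
    have "emeasure ?m Y = (SUP B\<in>{B \<in> sets N. B \<subseteq> Y}. ennreal (- \<gamma> B))"
      using Y by (intro emeasure_upper_variation[OF \<gamma>']) auto
    also have "\<dots> \<le> 0"
    proof (rule SUP_least)
      fix B assume B: "B \<in> {B \<in> sets N. B \<subseteq> Y}"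
      then have "measure ?m B \<le> measure ?p B"
        using Y(2)[of B] by (auto simp: p.emeasure_eq_measure m.emeasure_eq_measure ennreal_le_iff)
      then show "ennreal (- \<gamma> B) \<le> 0" using B by (simp add: jordan ennreal_neg)
    qed
    finally show "emeasure ?m Y = 0" by simp
  qed
qed

section \<open>The measure \<open>\<mu> \<odot> K\<close>\<close>

lemma measurable_fst_snd_borel:
  "fst \<in> borel_measurable (borel :: ('a::second_countable_topology \<times> 'b::second_countable_topology) measure)"
  "snd \<in> borel_measurable (borel :: ('a::second_countable_topology \<times> 'b::second_countable_topology) measure)"
  by (auto intro!: borel_measurable_continuous_onI continuous_intros)

context
  fixes \<mu> :: "'a::polish_space measure" and K :: "'a \<Rightarrow> 'a measure"
  assumes \<mu>: "\<mu> \<in> space (prob_algebra borel)" and K: "transition_kernel K"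
begin

lemma odot_kernel_measurable:
  "(\<lambda>x. K x \<bind> (\<lambda>y. return borel (x, y))) \<in> borel \<rightarrow>\<^sub>M subprob_algebra (borel :: ('a \<times> 'a) measure)"
proof (rule measurable_bind'[OF transition_kernelD(1)[OF K]])
  have "return (borel :: ('a \<times> 'a) measure) \<in> borel \<Otimes>\<^sub>M borel \<rightarrow>\<^sub>M subprob_algebra borel"
    unfolding borel_prod by (rule return_measurable)
  then show "(\<lambda>(x, y). return (borel :: ('a \<times> 'a) measure) (x, y)) \<in> borel \<Otimes>\<^sub>M borel \<rightarrow>\<^sub>M subprob_algebra borel"
    by simp
qed

lemma sets_odot: "sets (odot \<mu> K) = sets borel"
proof -
  have "space \<mu> = UNIV" "sets \<mu> = sets borel"
    using \<mu> sets_eq_imp_space_eq[of \<mu> borel] by (auto simp: space_prob_algebra)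
  then show ?thesis
    unfolding odot_def
    by (subst sets_bind[where N = borel]) (auto simp: transition_kernelD[OF K] sets_bind[where N = borel])
qed

lemma nn_integral_odot:
  assumes f: "f \<in> borel_measurable borel"
  shows "(\<integral>\<^sup>+ z. f z \<partial>odot \<mu> K) = (\<integral>\<^sup>+ x. \<integral>\<^sup>+ y. f (x, y) \<partial>K x \<partial>\<mu>)"
proof -
  have sets: "sets \<mu> = sets borel" using \<mu> by (simp add: space_prob_algebra)
  have "(\<lambda>x. K x \<bind> (\<lambda>y. return borel (x, y))) \<in> \<mu> \<rightarrow>\<^sub>M subprob_algebra (borel :: ('a \<times> 'a) measure)"
    using odot_kernel_measurable by (simp add: measurable_cong_sets[OF sets refl])
  then have "(\<integral>\<^sup>+ z. f z \<partial>odot \<mu> K) = (\<integral>\<^sup>+ x. \<integral>\<^sup>+ z. f z \<partial>(K x \<bind> (\<lambda>y. return borel (x, y))) \<partial>\<mu>)"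
    unfolding odot_def by (rule nn_integral_bind[OF f])
  also have "\<dots> = (\<integral>\<^sup>+ x. \<integral>\<^sup>+ y. f (x, y) \<partial>K x \<partial>\<mu>)"
  proof (rule nn_integral_cong)
    fix x :: 'a
    have "Pair x \<in> borel_measurable (borel :: 'a measure)"
      by (intro borel_measurable_continuous_onI continuous_intros)
    then have "(\<lambda>y. return borel (x, y)) \<in> borel \<rightarrow>\<^sub>M subprob_algebra (borel :: ('a \<times> 'a) measure)"
      using measurable_compose return_measurable by blast
    then have "(\<lambda>y. return borel (x, y)) \<in> K x \<rightarrow>\<^sub>M subprob_algebra (borel :: ('a \<times> 'a) measure)"
      by (simp add: measurable_cong_sets[OF transition_kernelD(2)[OF K] refl])
    then have "(\<integral>\<^sup>+ z. f z \<partial>(K x \<bind> (\<lambda>y. return borel (x, y)))) = (\<integral>\<^sup>+ y. \<integral>\<^sup>+ z. f z \<partial>return borel (x, y) \<partial>K x)"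
      by (rule nn_integral_bind[OF f])
    also have "\<dots> = (\<integral>\<^sup>+ y. f (x, y) \<partial>K x)" using f by (simp add: nn_integral_return)
    finally show "(\<integral>\<^sup>+ z. f z \<partial>(K x \<bind> (\<lambda>y. return borel (x, y)))) = (\<integral>\<^sup>+ y. f (x, y) \<partial>K x)" .
  qed
  finally show ?thesis .
qed

lemma prob_space_odot: "prob_space (odot \<mu> K)"
proof (rule prob_spaceI)
  interpret prob_space \<mu> using \<mu> by (simp add: space_prob_algebra)
  have "(\<integral>\<^sup>+ z. 1 \<partial>odot \<mu> K) = 1"
    using prob_space.emeasure_space_1[OF transition_kernelD(3)[OF K]] emeasure_space_1
    by (subst nn_integral_odot) simp_all
  then show "emeasure (odot \<mu> K) (space (odot \<mu> K)) = 1" by simp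
qed

end

text \<open>
  The density \<open>h\<close> of \<open>\<Gamma>\<close> with respect to \<open>\<pi> \<odot> P\<close> gives \<open>Q(x,dy) = h(x,y) P(x,dy)\<close> for the \<open>x\<close> with
  \<open>\<integral>h(x,y) P(x,dy) = 1\<close>, which are \<open>\<pi>\<close>-almost all, and \<open>Q = P\<close> elsewhere.
\<close>

lemma disintegration:
  fixes \<Gamma> :: "('a::polish_space \<times> 'a) measure"
  assumes \<Gamma>: "\<Gamma> \<in> space (prob_algebra borel)" and P: "transition_kernel P"
    and ac: "absolutely_continuous (odot (marginal1 \<Gamma>) P) \<Gamma>"
  shows "\<exists>Q. transition_kernel Q \<and> \<Gamma> = odot (marginal1 \<Gamma>) Q \<and> marginal1 \<Gamma> \<bind> Q = marginal2 \<Gamma>"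
proof -
  let ?\<pi> = "marginal1 \<Gamma>" and ?\<mu> = "odot (marginal1 \<Gamma>) P"
  have sets_\<Gamma>: "sets \<Gamma> = sets borel" and "prob_space \<Gamma>" using \<Gamma> by (auto simp: space_prob_algebra)
  interpret \<Gamma>: prob_space \<Gamma> by fact
  have fst_\<Gamma>: "fst \<in> borel_measurable \<Gamma>" and snd_\<Gamma>: "snd \<in> borel_measurable \<Gamma>"
    using measurable_fst_snd_borel by (simp_all add: measurable_cong_sets[OF sets_\<Gamma> refl])
  have \<pi>: "?\<pi> \<in> space (prob_algebra borel)"
    using fst_\<Gamma> by (auto simp: space_prob_algebra marginal1_def intro!: \<Gamma>.prob_space_distr)
  have sets_\<pi>: "sets ?\<pi> = sets borel" by (simp add: marginal1_def)
  have space_\<pi>: "space ?\<pi> = UNIV" by (simp add: marginal1_def)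
  interpret \<pi>: prob_space ?\<pi> using \<pi> by (simp add: space_prob_algebra)
  interpret \<mu>: prob_space ?\<mu> by (rule prob_space_odot[OF \<pi> P])
  note sets_\<mu> = sets_odot[OF \<pi> P]
  note nn\<mu> = nn_integral_odot[OF \<pi> P]
  note mc = measurable_cong_sets[OF transition_kernelD(2)[OF P] refl]
  define h where "h = RN_deriv ?\<mu> \<Gamma>"
  have h [measurable]: "h \<in> borel_measurable borel"
    using borel_measurable_RN_deriv[of ?\<mu> \<Gamma>] by (simp add: h_def measurable_cong_sets[OF sets_\<mu> refl])
  have \<Gamma>_nn: "(\<integral>\<^sup>+ z. f z \<partial>\<Gamma>) = (\<integral>\<^sup>+ x. \<integral>\<^sup>+ y. h (x, y) * f (x, y) \<partial>P x \<partial>?\<pi>)"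
    if [measurable]: "f \<in> borel_measurable borel" for f
  proof -
    have "(\<integral>\<^sup>+ z. f z \<partial>\<Gamma>) = (\<integral>\<^sup>+ z. h z * f z \<partial>?\<mu>)"
      unfolding h_def using that
      by (intro \<mu>.RN_deriv_nn_integral ac) (simp_all add: sets_\<Gamma> sets_\<mu> measurable_cong_sets[OF sets_\<mu> refl])
    then show ?thesis by (simp add: nn\<mu>)
  qed
  define m where "m x = (\<integral>\<^sup>+ y. h (x, y) \<partial>P x)" for x
  have m [measurable]: "m \<in> borel_measurable borel"
    unfolding m_def by (rule borel_measurable_nn_integral_kernel[OF h transition_kernelD(1)[OF P]])
  have m_\<pi>: "m \<in> borel_measurable ?\<pi>" using m by (simp add: measurable_cong_sets[OF sets_\<pi> refl])
  have "density ?\<pi> m = density ?\<pi> (\<lambda>_. 1)"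
  proof (rule measure_eqI)
    fix A assume "A \<in> sets (density ?\<pi> m)"
    then have A [measurable]: "A \<in> sets borel" by (simp add: sets_\<pi>)
    have "emeasure (density ?\<pi> m) A = (\<integral>\<^sup>+ x. m x * indicator A x \<partial>?\<pi>)"
      using A by (intro emeasure_density m_\<pi>) (simp add: sets_\<pi>)
    also have "\<dots> = (\<integral>\<^sup>+ x. \<integral>\<^sup>+ y. h (x, y) * indicator A x \<partial>P x \<partial>?\<pi>)"
      unfolding m_def using measurable_borel_Pair(1)[OF h] by (simp add: nn_integral_multc mc)
    also have "\<dots> = (\<integral>\<^sup>+ z. indicator A (fst z) \<partial>\<Gamma>)"
      using measurable_compose[OF measurable_fst_snd_borel(1) borel_measurable_indicator[OF A]]
      by (subst \<Gamma>_nn) simp_all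
    also have "\<dots> = (\<integral>\<^sup>+ x. indicator A x \<partial>?\<pi>)"
      unfolding marginal1_def using fst_\<Gamma> A nn_integral_distr[of fst \<Gamma> borel "indicator A"] by simp
    finally show "emeasure (density ?\<pi> m) A = emeasure (density ?\<pi> (\<lambda>_. 1)) A"
      using A by (simp add: emeasure_density sets_\<pi>)
  qed simp
  then have m1: "AE x in ?\<pi>. m x = 1"
    using m_\<pi> by (subst (asm) \<pi>.density_unique_iff) simp_all
  define Q where "Q x = (if m x = 1 then density (P x) (\<lambda>y. h (x, y)) else P x)" for x
  have nnQ: "(\<integral>\<^sup>+ y. f y \<partial>Q x) = (if m x = 1 then \<integral>\<^sup>+ y. h (x, y) * f y \<partial>P x else \<integral>\<^sup>+ y. f y \<partial>P x)"
    if "f \<in> borel_measurable borel" for f x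
    using that measurable_borel_Pair(1)[OF h, of x] by (simp add: Q_def nn_integral_density mc)
  have sets_Q: "sets (Q x) = sets borel" for x by (simp add: Q_def transition_kernelD[OF P])
  have prob_Q: "prob_space (Q x)" for x
  proof (rule prob_spaceI)
    have "(\<integral>\<^sup>+ y. 1 \<partial>Q x) = 1"
      using nnQ[of "\<lambda>_. 1" x] prob_space.emeasure_space_1[OF transition_kernelD(3)[OF P, of x]]
      by (simp add: m_def)
    then show "emeasure (Q x) (space (Q x)) = 1" by simp
  qed
  have Q: "transition_kernel Q"
    unfolding transition_kernel_def
  proof (rule measurable_prob_algebraI)
    show "Q \<in> borel \<rightarrow>\<^sub>M subprob_algebra borel"
    proof (rule measurable_subprob_algebra)
      fix A :: "'a set" assume A [measurable]: "A \<in> sets borel"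
      have "emeasure (Q x) A = (if m x = 1 then \<integral>\<^sup>+ y. h (x, y) * indicator A y \<partial>P x else emeasure (P x) A)" for x
        using nnQ[of "indicator A" x] A by (simp add: sets_Q transition_kernelD[OF P] split: if_splits)
      moreover have "(\<lambda>x. \<integral>\<^sup>+ y. h (x, y) * indicator A y \<partial>P x) \<in> borel_measurable borel"
        using borel_measurable_nn_integral_kernel[OF measurable_section_product[OF h borel_measurable_indicator[OF A]]
            transition_kernelD(1)[OF P]] by simp
      moreover have "(\<lambda>x. emeasure (P x) A) \<in> borel_measurable borel"
        by (rule measurable_emeasure_kernel[OF transition_kernelD(1)[OF P] A])
      ultimately show "(\<lambda>x. emeasure (Q x) A) \<in> borel_measurable borel" by simp
    qed (auto simp: sets_Q intro: prob_space_imp_subprob_space prob_Q)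
  qed (rule prob_Q)
  have \<Gamma>_Q: "(\<integral>\<^sup>+ z. f z \<partial>\<Gamma>) = (\<integral>\<^sup>+ x. \<integral>\<^sup>+ y. f (x, y) \<partial>Q x \<partial>?\<pi>)"
    if f: "f \<in> borel_measurable borel" for f
  proof -
    have "(\<integral>\<^sup>+ x. \<integral>\<^sup>+ y. f (x, y) \<partial>Q x \<partial>?\<pi>) = (\<integral>\<^sup>+ x. \<integral>\<^sup>+ y. h (x, y) * f (x, y) \<partial>P x \<partial>?\<pi>)"
      using m1 by (intro nn_integral_cong_AE) (auto simp: nnQ measurable_borel_Pair(1)[OF f] elim!: eventually_mono)
    then show ?thesis using \<Gamma>_nn[OF f] by simp
  qed
  have "\<Gamma> = odot ?\<pi> Q"
  proof (rule measure_eqI)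
    show "sets \<Gamma> = sets (odot ?\<pi> Q)" using sets_odot[OF \<pi> Q] sets_\<Gamma> by simp
    fix A assume A: "A \<in> sets \<Gamma>"
    then have "indicator A \<in> borel_measurable (borel :: ('a \<times> 'a) measure)" by (simp add: sets_\<Gamma>)
    from \<Gamma>_Q[OF this] nn_integral_odot[OF \<pi> Q this] A sets_odot[OF \<pi> Q]
    show "emeasure \<Gamma> A = emeasure (odot ?\<pi> Q) A" by (simp add: sets_\<Gamma>)
  qed
  moreover have "?\<pi> \<bind> Q = marginal2 \<Gamma>"
  proof (rule measure_eqI)
    have Q_\<pi>: "Q \<in> ?\<pi> \<rightarrow>\<^sub>M subprob_algebra borel"
      using transition_kernelD(1)[OF Q] by (simp add: measurable_cong_sets[OF sets_\<pi> refl])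
    show sets: "sets (?\<pi> \<bind> Q) = sets (marginal2 \<Gamma>)"
      using space_\<pi> by (subst sets_bind[where N = borel]) (auto simp: sets_Q marginal2_def)
    fix A assume "A \<in> sets (?\<pi> \<bind> Q)"
    then have A: "A \<in> sets borel" unfolding sets by (simp add: marginal2_def)
    have "emeasure (?\<pi> \<bind> Q) A = (\<integral>\<^sup>+ x. emeasure (Q x) A \<partial>?\<pi>)"
      by (rule emeasure_bind[OF _ Q_\<pi> A]) (simp add: space_\<pi>)
    also have "\<dots> = (\<integral>\<^sup>+ z. indicator A (snd z) \<partial>\<Gamma>)"
      using measurable_compose[OF measurable_fst_snd_borel(2) borel_measurable_indicator[OF A]] A
      by (subst \<Gamma>_Q) (simp_all add: sets_Q)
    also have "\<dots> = emeasure (marginal2 \<Gamma>) A"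
      using snd_\<Gamma> A nn_integral_distr[of snd \<Gamma> borel "indicator A"] by (simp add: marginal2_def)
    finally show "emeasure (?\<pi> \<bind> Q) A = emeasure (marginal2 \<Gamma>) A" .
  qed
  ultimately show ?thesis using Q by blast
qed

section \<open>Measures of finite rate\<close>

lemma nonpos_if_multiples_bounded:
  fixes a S :: real
  assumes "\<And>n::nat. real n * a \<le> S"
  shows "a \<le> 0"
proof (rule ccontr)
  assume "\<not> a \<le> 0"
  then have "0 < a" by simp
  obtain n where "S / a < real n" using reals_Archimedean2 by blast
  then show False using assms[of n] \<open>0 < a\<close> by (simp add: field_simps)
qed

text \<open>
  A probability measure \<open>\<Gamma>\<close> with \<open>\<Lambda>\<^sup>*(\<Gamma>) \<le> S\<close>, in the form in which this is used.
\<close>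

locale finite_rate = dv3_chain P \<psi> V W W0
  for P :: "'a::polish_space \<Rightarrow> 'a measure" and \<psi> :: "'a measure" and V W W0 :: "'a \<Rightarrow> real" +
  fixes \<Gamma> :: "('a \<times> 'a) measure" and S :: real
  assumes \<Gamma>: "\<Gamma> \<in> space (prob_algebra borel)"
    and W0_integrable: "integrable \<Gamma> (\<lambda>z. W0 (fst z) + W0 (snd z))"
    and rate: "\<And>M b. M \<in> weighted_Linf2 W0 \<Longrightarrow> Lam P \<psi> M \<le> ereal b \<Longrightarrow> (\<integral>z. M z \<partial>\<Gamma>) \<le> S + b"
begin

lemma sets_\<Gamma>: "sets \<Gamma> = sets borel" and prob_space_\<Gamma>: "prob_space \<Gamma>"
  using \<Gamma> by (auto simp: space_prob_algebra)

sublocale \<Gamma>: prob_space \<Gamma> by (rule prob_space_\<Gamma>)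

lemma measurable_\<Gamma>: "f \<in> measurable borel N \<Longrightarrow> f \<in> measurable \<Gamma> N"
  by (simp add: measurable_cong_sets[OF sets_\<Gamma> refl])

lemmas fst_\<Gamma> [measurable] = measurable_\<Gamma>[OF measurable_fst_snd_borel(1)]
lemmas snd_\<Gamma> [measurable] = measurable_\<Gamma>[OF measurable_fst_snd_borel(2)]

abbreviation "\<pi> \<equiv> marginal1 \<Gamma>"
abbreviation "\<mu> \<equiv> odot (marginal1 \<Gamma>) P"

lemma sets_\<pi>: "sets \<pi> = sets borel" and space_\<pi>: "space \<pi> = UNIV"
  by (simp_all add: marginal1_def)

lemma \<pi>: "\<pi> \<in> space (prob_algebra borel)"
  using fst_\<Gamma> by (auto simp: space_prob_algebra marginal1_def intro!: \<Gamma>.prob_space_distr)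

sublocale \<pi>: prob_space \<pi> using \<pi> by (simp add: space_prob_algebra)
sublocale \<mu>: prob_space \<mu> by (rule prob_space_odot[OF \<pi> kernel])

lemmas sets_\<mu> = sets_odot[OF \<pi> kernel]
lemmas nn_integral_\<mu> = nn_integral_odot[OF \<pi> kernel]

lemma nn_integral_\<pi>:
  "f \<in> borel_measurable borel \<Longrightarrow> (\<integral>\<^sup>+ x. f x \<partial>\<pi>) = (\<integral>\<^sup>+ z. f (fst z) \<partial>\<Gamma>)"
  unfolding marginal1_def by (simp add: nn_integral_distr)

lemma bounded_in_Linf2:
  assumes "M \<in> borel_measurable borel" "\<And>z. \<bar>M z\<bar> \<le> b"
  shows "M \<in> weighted_Linf2 W0"
  unfolding weighted_Linf2_iff[OF W0_ge_1]
proof (intro conjI exI[of _ "\<bar>b\<bar>"] allI)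
  fix x y
  have "\<bar>b\<bar> * 1 \<le> \<bar>b\<bar> * (W0 x + W0 y)"
    using W0_ge_1[of x] W0_ge_1[of y] by (intro mult_left_mono) linarith+
  then show "\<bar>M (x, y)\<bar> \<le> \<bar>b\<bar> * (W0 x + W0 y)" using assms(2)[of "(x, y)"] by linarith
qed (use assms in auto)

text \<open>
  The form in which the three families of test functions \<open>M\<close> with \<open>\<Lambda>(M) \<le> 0\<close> enter.
\<close>

lemma rate_supersolution:
  assumes M: "M \<in> borel_measurable borel" "\<And>z. \<bar>M z\<bar> \<le> b"
    and g: "g \<in> borel_measurable borel" "0 < \<eta>" "\<And>x. ennreal \<eta> \<le> g x" "g x0 < \<infinity>"
    and super: "\<And>x. (\<integral>\<^sup>+ y. ennreal (exp (M (x, y))) * g y \<partial>P x) \<le> g x"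
  shows "(\<integral>z. M z \<partial>\<Gamma>) \<le> S"
proof -
  note M' = bounded_in_Linf2[OF M]
  have k: "(\<lambda>z. ennreal (exp (M z))) \<in> borel_measurable borel" using M(1) by measurable
  have "Lam P \<psi> M \<le> ereal (ln 1)"
  proof (rule Lam_le[where g = g, OF M' g(1-3) _ _ g(4)])
    show "kapply (scaled_kernel P M) g x \<le> ennreal 1 * g x" for x
      using super[of x] unfolding scaled_kernel_eq kapply_weighted_kernel[OF kernel k g(1)] by simp
  qed simp
  from rate[OF M' this] show ?thesis by simp
qed

text \<open>
  For \<open>M(x,y) = n (1\<^sub>A(y) - 1\<^sub>A(x))\<close> the function \<open>exp (- n 1\<^sub>A)\<close> is an eigenfunction with
  eigenvalue \<open>1\<close>, so \<open>n (\<Gamma>\<^sub>2(A) - \<Gamma>\<^sub>1(A)) \<le> S\<close> for all \<open>n\<close>.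
\<close>

lemma marginals_eq: "marginal1 \<Gamma> = marginal2 \<Gamma>"
proof -
  have le: "measure \<Gamma> (snd -` A) \<le> measure \<Gamma> (fst -` A)" if A [measurable]: "A \<in> sets borel" for A
  proof -
    have [measurable]: "fst -` A \<in> sets \<Gamma>" "snd -` A \<in> sets \<Gamma>"
      using measurable_sets[OF fst_\<Gamma> A] measurable_sets[OF snd_\<Gamma> A] sets_eq_imp_space_eq[OF sets_\<Gamma>] by auto
    have *: "real n * (measure \<Gamma> (snd -` A) - measure \<Gamma> (fst -` A)) \<le> S" for n :: nat
    proof -
      let ?a = "indicator A :: 'a \<Rightarrow> real"
      let ?M = "\<lambda>z. real n * ?a (snd z) - real n * ?a (fst z)"
      have [measurable]: "(\<lambda>z::'a\<times>'a. ?a (snd z)) \<in> borel_measurable borel" "(\<lambda>z::'a\<times>'a. ?a (fst z)) \<in> borel_measurable borel"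
        using measurable_compose[OF measurable_fst_snd_borel(1) borel_measurable_indicator[OF A]]
          measurable_compose[OF measurable_fst_snd_borel(2) borel_measurable_indicator[OF A]] by auto
      let ?g = "\<lambda>x. ennreal (exp (- real n * ?a x))"
      have "(\<integral>z. ?M z \<partial>\<Gamma>) \<le> S"
      proof (rule rate_supersolution[where g = ?g and \<eta> = "exp (- real n)" and b = "real n"])
        show "?M \<in> borel_measurable borel" by measurable
        show "ennreal (exp (- real n)) \<le> ?g x" for x by (auto intro!: ennreal_leI simp: indicator_def)
        show "(\<integral>\<^sup>+ y. ennreal (exp (?M (x, y))) * ?g y \<partial>P x) \<le> ?g x" for x
        proof -
          have "ennreal (exp (?M (x, y))) * ?g y = ?g x" for y
            by (simp add: ennreal_mult[symmetric] exp_add[symmetric])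
          then show ?thesis
            using prob_space.emeasure_space_1[OF transition_kernelD(3)[OF kernel, of x]] by simp
        qed
      qed (auto simp: indicator_def)
      also have "(\<integral>z. ?M z \<partial>\<Gamma>) = real n * (measure \<Gamma> (snd -` A) - measure \<Gamma> (fst -` A))"
      proof -
        have M_eq: "?M = (\<lambda>z. real n * indicator (snd -` A) z - real n * indicator (fst -` A) z)"
          by (auto simp: indicator_def)
        have "integrable \<Gamma> (indicator (snd -` A) :: _ \<Rightarrow> real)" "integrable \<Gamma> (indicator (fst -` A) :: _ \<Rightarrow> real)"
          by (auto intro!: integrable_real_indicator simp: \<Gamma>.emeasure_eq_measure)
        then show ?thesis unfolding M_eq by (simp add: right_diff_distrib)
      qed
      finally show ?thesis .
    qed
    from nonpos_if_multiples_bounded[OF this] show ?thesis by simp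
  qed
  show ?thesis
  proof (rule measure_eqI)
    fix A assume "A \<in> sets (marginal1 \<Gamma>)"
    then have A [measurable]: "A \<in> sets borel" by (simp add: marginal1_def)
    have space: "space \<Gamma> = UNIV" using sets_eq_imp_space_eq[OF sets_\<Gamma>] by simp
    have s: "fst -` A \<in> sets \<Gamma>" "snd -` A \<in> sets \<Gamma>"
      using measurable_sets[OF fst_\<Gamma> A] measurable_sets[OF snd_\<Gamma> A] space by auto
    have "measure \<Gamma> (snd -` (- A)) = 1 - measure \<Gamma> (snd -` A)" "measure \<Gamma> (fst -` (- A)) = 1 - measure \<Gamma> (fst -` A)"
      using \<Gamma>.prob_compl[OF s(1)] \<Gamma>.prob_compl[OF s(2)] by (simp_all add: space vimage_Diff Compl_eq_Diff_UNIV)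
    then have "measure \<Gamma> (fst -` A) = measure \<Gamma> (snd -` A)"
      using le[OF A] le[of "- A"] A by simp
    then show "emeasure (marginal1 \<Gamma>) A = emeasure (marginal2 \<Gamma>) A"
      using A by (simp add: marginal1_def marginal2_def emeasure_distr space \<Gamma>.emeasure_eq_measure)
  qed (simp add: marginal1_def marginal2_def)
qed

text \<open>
  Normalizing \<open>e\<^sup>f P\<close> by \<open>Z(x) = \<integral>exp f(x,y) P(x,dy)\<close> gives a transition kernel, for which the
  constant \<open>1\<close> is an eigenfunction. Jensen's inequality for \<open>ln Z\<close> appears as
  \<open>ln t \<le> t/a - 1 + ln a\<close>.
\<close>

lemma rate_bounded_function:
  assumes f [measurable]: "f \<in> borel_measurable borel" and b: "\<And>z. \<bar>f z\<bar> \<le> b"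
  shows "(\<integral>z. f z \<partial>\<Gamma>) \<le> S + ln (\<integral>z. exp (f z) \<partial>\<mu>)"
proof -
  let ?e = "\<lambda>z. ennreal (exp (f z))"
  have e: "?e \<in> borel_measurable borel" by measurable
  define Z where "Z x = enn2real (\<integral>\<^sup>+ y. ?e (x, y) \<partial>P x)" for x
  have Z_meas [measurable]: "Z \<in> borel_measurable borel"
    unfolding Z_def using borel_measurable_nn_integral_kernel[OF e transition_kernelD(1)[OF kernel]] by measurable
  have b': "- b \<le> f z" "f z \<le> b" for z using b[of z] by (auto simp: abs_le_iff)
  have Z_bounds: "exp (- b) \<le> Z x" "Z x \<le> exp b" and Z_nn: "(\<integral>\<^sup>+ y. ?e (x, y) \<partial>P x) = ennreal (Z x)" for x
  proof -
    interpret Px: prob_space "P x" by (rule transition_kernelD(3)[OF kernel])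
    have lo: "ennreal (exp (- b)) \<le> (\<integral>\<^sup>+ y. ?e (x, y) \<partial>P x)"
      using nn_integral_mono[of "P x" "\<lambda>_. ennreal (exp (- b))" "\<lambda>y. ?e (x, y)"] b'
      by (simp add: Px.emeasure_space_1 ennreal_leI)
    have hi: "(\<integral>\<^sup>+ y. ?e (x, y) \<partial>P x) \<le> ennreal (exp b)"
      using nn_integral_mono[of "P x" "\<lambda>y. ?e (x, y)" "\<lambda>_. ennreal (exp b)"] b'
      by (simp add: Px.emeasure_space_1 ennreal_leI)
    show eq: "(\<integral>\<^sup>+ y. ?e (x, y) \<partial>P x) = ennreal (Z x)"
      unfolding Z_def using hi by (intro ennreal_enn2real[symmetric]) (auto elim: le_less_trans)
    have "0 \<le> Z x" by (simp add: Z_def)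
    then show "exp (- b) \<le> Z x" "Z x \<le> exp b" using lo hi unfolding eq by (simp_all add: ennreal_le_iff)
  qed
  have Z_pos: "0 < Z x" for x using Z_bounds(1)[of x] exp_gt_zero[of "- b"] by linarith
  have ln_Z: "\<bar>ln (Z x)\<bar> \<le> b" for x
  proof -
    have "ln (exp (- b)) \<le> ln (Z x)" "ln (Z x) \<le> ln (exp b)"
      using Z_bounds[of x] Z_pos[of x] by (subst ln_le_cancel_iff; simp)+
    then show ?thesis by simp
  qed
  have Zfst [measurable]: "(\<lambda>z::'a\<times>'a. Z (fst z)) \<in> borel_measurable borel"
    by (rule measurable_compose[OF measurable_fst_snd_borel(1) Z_meas])
  let ?M = "\<lambda>z. f z - ln (Z (fst z))"
  have M_le: "(\<integral>z. ?M z \<partial>\<Gamma>) \<le> S"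
  proof (rule rate_supersolution[where g = "\<lambda>_. 1" and \<eta> = 1 and b = "2 * b"])
    show "\<bar>?M z\<bar> \<le> 2 * b" for z using b[of z] ln_Z[of "fst z"] by linarith
    show "(\<integral>\<^sup>+ y. ennreal (exp (?M (x, y))) * 1 \<partial>P x) \<le> 1" for x
    proof -
      have "(\<integral>\<^sup>+ y. ennreal (exp (?M (x, y))) * 1 \<partial>P x) = (\<integral>\<^sup>+ y. ennreal (1 / Z x) * ?e (x, y) \<partial>P x)"
        using Z_pos[of x] by (intro nn_integral_cong) (simp add: exp_diff ennreal_mult[symmetric])
      also have "\<dots> = ennreal (1 / Z x) * ennreal (Z x)"
        unfolding Z_nn[symmetric] using measurable_borel_Pair(1)[OF e, of x]
        by (intro nn_integral_cmult) (simp add: measurable_cong_sets[OF transition_kernelD(2)[OF kernel] refl])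
      also have "\<dots> = 1" using Z_pos[of x] by (simp add: ennreal_mult[symmetric])
      finally show ?thesis by simp
    qed
  qed auto
  have f_int: "integrable \<Gamma> f"
    using b by (intro \<Gamma>.integrable_const_bound[where B = b]) (auto intro: measurable_\<Gamma>)
  have lnZ_int: "integrable \<Gamma> (\<lambda>z. ln (Z (fst z)))"
    using ln_Z by (intro \<Gamma>.integrable_const_bound[where B = b]) (auto intro!: measurable_\<Gamma>)
  have Z_int: "integrable \<Gamma> (\<lambda>z. Z (fst z))"
    using Z_bounds Z_pos by (intro \<Gamma>.integrable_const_bound[where B = "exp b"])
      (auto intro!: measurable_\<Gamma> simp: less_imp_le)
  define a where "a = (\<integral>z. Z (fst z) \<partial>\<Gamma>)"
  have "exp (- b) \<le> a"
    unfolding a_def using Z_bounds(1) by (intro \<Gamma>.integral_ge_const[OF Z_int]) auto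
  then have a_pos: "0 < a" using exp_gt_zero[of "- b"] by linarith
  have a_eq: "(\<integral>z. exp (f z) \<partial>\<mu>) = a"
  proof -
    have "(\<integral>\<^sup>+ z. ?e z \<partial>\<mu>) = (\<integral>\<^sup>+ x. ennreal (Z x) \<partial>\<pi>)"
      by (simp add: nn_integral_\<mu>[OF e] Z_nn)
    also have "\<dots> = (\<integral>\<^sup>+ z. ennreal (Z (fst z)) \<partial>\<Gamma>)" by (rule nn_integral_\<pi>) measurable
    also have "\<dots> = ennreal a"
      unfolding a_def using Z_pos by (intro nn_integral_eq_integral Z_int) (auto simp: less_imp_le)
    finally have "(\<integral>\<^sup>+ z. ?e z \<partial>\<mu>) = ennreal a" .
    then show ?thesis
      using a_pos e by (subst integral_eq_nn_integral) (auto simp: measurable_cong_sets[OF sets_\<mu> refl])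
  qed
  have "(\<integral>z. f z \<partial>\<Gamma>) = (\<integral>z. ?M z \<partial>\<Gamma>) + (\<integral>z. ln (Z (fst z)) \<partial>\<Gamma>)"
    using f_int lnZ_int by simp
  also have "\<dots> \<le> S + (\<integral>z. ln (Z (fst z)) \<partial>\<Gamma>)" using M_le by simp
  also have "(\<integral>z. ln (Z (fst z)) \<partial>\<Gamma>) \<le> (\<integral>z. Z (fst z) / a - 1 + ln a \<partial>\<Gamma>)"
  proof (intro integral_mono lnZ_int)
    show "integrable \<Gamma> (\<lambda>z. Z (fst z) / a - 1 + ln a)" using Z_int by simp
    show "ln (Z (fst z)) \<le> Z (fst z) / a - 1 + ln a" for z
      using ln_le_minus_one[of "Z (fst z) / a"] Z_pos[of "fst z"] a_pos by (simp add: ln_div)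
  qed
  also have "(\<integral>z. Z (fst z) / a - 1 + ln a \<partial>\<Gamma>) = ln a"
    using Z_int a_pos by (simp add: a_def[symmetric] \<Gamma>.prob_space)
  finally show ?thesis by (simp add: a_eq)
qed

lemma absolutely_continuous_odot: "absolutely_continuous \<mu> \<Gamma>"
  unfolding absolutely_continuous_def
proof
  fix N assume N: "N \<in> null_sets \<mu>"
  then have N_meas: "N \<in> sets borel" using sets_\<mu> by auto
  then have N_\<Gamma>: "N \<in> sets \<Gamma>" by (simp add: sets_\<Gamma>)
  have "real n * measure \<Gamma> N \<le> S" for n :: nat
  proof -
    let ?f = "\<lambda>z. real n * indicator N z"
    have "(\<integral>z. ?f z \<partial>\<Gamma>) \<le> S + ln (\<integral>z. exp (?f z) \<partial>\<mu>)"
      using N_meas by (intro rate_bounded_function[where b = "real n"]) (auto simp: indicator_def)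
    also have "(\<integral>z. exp (?f z) \<partial>\<mu>) = (\<integral>z. 1 \<partial>\<mu>)"
    proof (rule integral_cong_AE)
      show "(\<lambda>z. exp (?f z)) \<in> borel_measurable \<mu>"
        using N_meas by (simp add: measurable_cong_sets[OF sets_\<mu> refl])
      show "AE z in \<mu>. exp (?f z) = 1" using AE_not_in[OF N] by eventually_elim simp
    qed simp
    finally show ?thesis using N_\<Gamma> by (simp add: \<mu>.prob_space)
  qed
  from nonpos_if_multiples_bounded[OF this] have "measure \<Gamma> N = 0"
    using measure_nonneg[of \<Gamma> N] by linarith
  then show "N \<in> null_sets \<Gamma>" using N_\<Gamma> by (auto simp: \<Gamma>.emeasure_eq_measure)
qed

lemma entropy_finite: "integrable \<Gamma> (entropy_density (exp 1) \<mu> \<Gamma>)"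
  and entropy_le: "KL_divergence (exp 1) \<mu> \<Gamma> \<le> S"
proof -
  have *: "(\<integral>z. f z \<partial>\<Gamma>) \<le> S + ln (\<integral>z. exp (f z) \<partial>\<mu>)"
    if "f \<in> borel_measurable \<mu>" "\<And>z. \<bar>f z\<bar> \<le> b" for f b
    using that by (intro rate_bounded_function) (simp_all add: measurable_cong_sets[OF sets_\<mu> refl])
  have sets: "sets \<Gamma> = sets \<mu>" by (simp add: sets_\<Gamma> sets_\<mu>)
  note DV = Donsker_Varadhan_bound[OF \<mu>.prob_space_axioms prob_space_\<Gamma> sets absolutely_continuous_odot]
  show "integrable \<Gamma> (entropy_density (exp 1) \<mu> \<Gamma>)" by (rule DV(1)) (rule *)
  show "KL_divergence (exp 1) \<mu> \<Gamma> \<le> S" by (rule DV(2)) (rule *)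
qed

text \<open>
  If \<open>M(x,y)\<close> is \<open>n\<close> for \<open>x \<notin> F\<close> and \<open>0\<close> for \<open>x \<in> F\<close>, then the function that is \<open>1\<close> on \<open>F\<close> and \<open>\<infinity>\<close> off \<open>F\<close> is
  a supersolution: the eigenvalue does not see the values of \<open>M\<close> off an absorbing set.
\<close>

lemma absorbing_set_full:
  assumes F [measurable]: "F \<in> sets borel" and ne: "F \<noteq> {}"
    and absorbing: "\<And>x. x \<in> F \<Longrightarrow> AE y in P x. y \<in> F"
  shows "AE z in \<Gamma>. fst z \<in> F"
proof -
  have ind: "(\<lambda>z::'a\<times>'a. indicator (- F) (fst z) :: real) \<in> borel_measurable borel"
    by (rule measurable_compose[OF measurable_fst_snd_borel(1)]) measurable
  have space: "space \<Gamma> = UNIV" using sets_eq_imp_space_eq[OF sets_\<Gamma>] by simp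
  have s: "fst -` (- F) \<in> sets \<Gamma>"
    using measurable_sets[OF fst_\<Gamma>, of "- F"] F space by auto
  obtain x0 where x0: "x0 \<in> F" using ne by blast
  have "real n * measure \<Gamma> (fst -` (- F)) \<le> S" for n :: nat
  proof -
    let ?M = "\<lambda>z::'a \<times> 'a. real n * indicator (- F) (fst z)"
    let ?g = "\<lambda>x. if x \<in> F then 1 else \<infinity> :: ennreal"
    have "(\<integral>z. ?M z \<partial>\<Gamma>) \<le> S"
    proof (rule rate_supersolution[where g = ?g and \<eta> = 1 and b = "real n" and ?x0.0 = x0])
      show "?M \<in> borel_measurable borel" by (intro borel_measurable_times borel_measurable_const ind)
      show "(\<integral>\<^sup>+ y. ennreal (exp (?M (x, y))) * ?g y \<partial>P x) \<le> ?g x" for x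
      proof (cases "x \<in> F")
        case True
        have "(\<integral>\<^sup>+ y. ennreal (exp (?M (x, y))) * ?g y \<partial>P x) = (\<integral>\<^sup>+ y. 1 \<partial>P x)"
          using absorbing[OF True] True by (intro nn_integral_cong_AE) (auto elim!: eventually_mono)
        then show ?thesis
          using True prob_space.emeasure_space_1[OF transition_kernelD(3)[OF kernel, of x]] by simp
      qed simp
    qed (use x0 in \<open>auto simp: indicator_def\<close>)
    also have "(\<integral>z. ?M z \<partial>\<Gamma>) = real n * measure \<Gamma> (fst -` (- F))"
    proof -
      have M_eq: "?M = (\<lambda>z. real n * indicator (fst -` (- F)) z)" by (auto simp: indicator_def)
      show ?thesis unfolding M_eq using s by simp
    qed
    finally show ?thesis .
  qed
  from nonpos_if_multiples_bounded[OF this] have "measure \<Gamma> (fst -` (- F)) = 0"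
    using measure_nonneg[of \<Gamma> "fst -` (- F)"] by linarith
  then show ?thesis using s by (intro AE_I[of _ _ "fst -` (- F)"]) (auto simp: \<Gamma>.emeasure_eq_measure)
qed

text \<open>
  With \<open>\<phi> = ln u\<close>, \<open>D\<close> the logarithm of the density of \<open>\<Gamma>\<close>, and \<open>L = M(x,y) + \<phi>(y) - \<phi>(x) - r - D\<close>,
  the function \<open>e\<^sup>L\<close> has \<open>\<Gamma>\<close>-integral at most \<open>1\<close>. Then \<open>L \<le> e\<^sup>L - 1\<close> bounds \<open>\<phi>(y) - \<phi>(x)\<close> by an
  integrable function, so that it integrates to \<open>0\<close>, and also shows \<open>\<integral>L d\<Gamma> \<le> 0\<close>.
\<close>

lemma integral_le_entropy:
  assumes M: "M \<in> weighted_Linf2 W0" and r: "Lam P \<psi> M < ereal r"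
  shows "(\<integral>z. M z \<partial>\<Gamma>) - r \<le> KL_divergence (exp 1) \<mu> \<Gamma>"
proof -
  obtain u where u [measurable]: "u \<in> borel_measurable borel" and u_pos: "\<And>x. 0 < u x" and u_fin: "\<exists>x. u x < \<infinity>"
    and super: "\<And>x. (\<integral>\<^sup>+ y. ennreal (exp (M (x, y))) * u y \<partial>P x) \<le> ennreal (exp r) * u x"
    by (rule Lam_supersolution[OF M r]) blast
  have M_meas [measurable]: "M \<in> borel_measurable borel" using M by (simp add: weighted_Linf2_def)
  have mcP: "f \<in> borel_measurable (P x)" if "f \<in> borel_measurable borel" for f :: "'a \<Rightarrow> ennreal" and x
    using that by (simp add: measurable_cong_sets[OF transition_kernelD(2)[OF kernel] refl])
  have k: "(\<lambda>z. ennreal (exp (M z))) \<in> borel_measurable borel" by measurable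
  have ku: "(\<lambda>y. ennreal (exp (M (x, y))) * u y) \<in> borel_measurable borel" for x
    using measurable_borel_Pair(1)[OF k, of x] by measurable
  define F where "F = {x. u x < \<infinity>}"
  have F [measurable]: "F \<in> sets borel" unfolding F_def by measurable
  have absorbing: "AE y in P x. y \<in> F" if x: "x \<in> F" for x
  proof -
    have "(\<integral>\<^sup>+ y. ennreal (exp (M (x, y))) * u y \<partial>P x) \<noteq> \<infinity>"
      using super[of x] x by (auto simp: F_def ennreal_mult_eq_top_iff top_unique dest: order_trans)
    then have "AE y in P x. ennreal (exp (M (x, y))) * u y \<noteq> \<infinity>"
      by (intro nn_integral_PInf_AE mcP ku)
    then show ?thesis
      by eventually_elim (auto simp: F_def ennreal_mult_eq_top_iff less_top)
  qed
  have fst_F: "AE z in \<Gamma>. fst z \<in> F"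
    using u_fin absorbing by (intro absorbing_set_full F) (auto simp: F_def)
  have \<pi>_F: "AE x in \<pi>. x \<in> F"
    using fst_F F unfolding marginal1_def by (subst AE_distr_iff) (auto intro: fst_\<Gamma>)
  define \<phi> where "\<phi> x = ln (enn2real (u x))" for x
  have \<phi> [measurable]: "\<phi> \<in> borel_measurable borel" unfolding \<phi>_def by measurable
  have exp_\<phi>: "ennreal (exp (\<phi> x)) = u x" if "x \<in> F" for x
    using that u_pos[of x] by (simp add: \<phi>_def F_def enn2real_positive_iff)
  have sets: "sets \<Gamma> = sets \<mu>" by (simp add: sets_\<Gamma> sets_\<mu>)
  note pm = \<mu>.prob_space_axioms prob_space_\<Gamma> sets absolutely_continuous_odot
  define h where "h z = enn2real (RN_deriv \<mu> \<Gamma> z)" for z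
  have h [measurable]: "h \<in> borel_measurable borel"
    unfolding h_def using borel_measurable_RN_deriv[of \<mu> \<Gamma>] by (simp add: measurable_cong_sets[OF sets_\<mu> refl])
  have h_nn: "0 \<le> h z" for z by (simp add: h_def)
  have h_pos: "AE z in \<Gamma>. 0 < h z" unfolding h_def by (rule AE_RN_deriv_pos(2)[OF pm])
  define D where "D z = ln (h z)" for z
  have D [measurable]: "D \<in> borel_measurable borel" unfolding D_def by measurable
  have ed: "entropy_density (exp 1) \<mu> \<Gamma> = D" by (auto simp: entropy_density_exp_1 D_def h_def)
  have D_int: "integrable \<Gamma> D" using entropy_finite by (simp add: ed)
  have \<phi>fst [measurable]: "(\<lambda>z::'a\<times>'a. \<phi> (fst z)) \<in> borel_measurable borel"
    and \<phi>snd [measurable]: "(\<lambda>z::'a\<times>'a. \<phi> (snd z)) \<in> borel_measurable borel"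
    by (rule measurable_compose[OF measurable_fst_snd_borel(1) \<phi>] measurable_compose[OF measurable_fst_snd_borel(2) \<phi>])+
  let ?E = "\<lambda>z. M z + \<phi> (snd z) - \<phi> (fst z) - r"
  let ?L = "\<lambda>z. ?E z - D z"
  let ?Z = "\<lambda>z. exp (?L z)"
  have Z_le: "(\<integral>\<^sup>+ z. ennreal (?Z z) \<partial>\<Gamma>) \<le> 1"
  proof -
    have "(\<integral>\<^sup>+ z. ennreal (?Z z) \<partial>\<Gamma>) = (\<integral>\<^sup>+ z. ennreal (h z) * ennreal (?Z z) \<partial>\<mu>)"
      unfolding h_def by (rule nn_integral_RN_deriv[OF pm]) (simp add: measurable_cong_sets[OF sets_\<mu> refl])
    also have "\<dots> \<le> (\<integral>\<^sup>+ z. ennreal (exp (?E z)) \<partial>\<mu>)"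
    proof (rule nn_integral_mono)
      fix z
      have "h z * ?Z z \<le> exp (?E z)"
      proof (cases "h z = 0")
        case False
        then have "0 < h z" using h_nn[of z] by simp
        then have "exp (?L z) = exp (?E z) / h z" by (simp add: exp_diff D_def)
        then show ?thesis using \<open>0 < h z\<close> by simp
      qed simp
      then show "ennreal (h z) * ennreal (?Z z) \<le> ennreal (exp (?E z))"
        using h_nn[of z] by (simp add: ennreal_mult[symmetric] ennreal_leI)
    qed
    also have "\<dots> = (\<integral>\<^sup>+ x. \<integral>\<^sup>+ y. ennreal (exp (?E (x, y))) \<partial>P x \<partial>\<pi>)"
      by (rule nn_integral_\<mu>) measurable
    also have "\<dots> \<le> (\<integral>\<^sup>+ x. 1 \<partial>\<pi>)"
    proof (rule nn_integral_mono_AE)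
      show "AE x in \<pi>. (\<integral>\<^sup>+ y. ennreal (exp (?E (x, y))) \<partial>P x) \<le> 1"
        using \<pi>_F
      proof eventually_elim
        case (elim x)
        have "(\<integral>\<^sup>+ y. ennreal (exp (?E (x, y))) \<partial>P x) =
            (\<integral>\<^sup>+ y. ennreal (exp (- \<phi> x - r)) * (ennreal (exp (M (x, y))) * u y) \<partial>P x)"
        proof (rule nn_integral_cong_AE)
          show "AE y in P x. ennreal (exp (?E (x, y))) =
              ennreal (exp (- \<phi> x - r)) * (ennreal (exp (M (x, y))) * u y)"
            using absorbing[OF elim]
          proof eventually_elim
            case (elim y)
            show ?case
              unfolding exp_\<phi>[OF elim, symmetric]
              by (simp add: ennreal_mult[symmetric] exp_add[symmetric] algebra_simps)
          qed
        qed
        also have "\<dots> = ennreal (exp (- \<phi> x - r)) * (\<integral>\<^sup>+ y. ennreal (exp (M (x, y))) * u y \<partial>P x)"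
          by (intro nn_integral_cmult mcP ku)
        also have "\<dots> \<le> ennreal (exp (- \<phi> x - r)) * (ennreal (exp r) * ennreal (exp (\<phi> x)))"
          unfolding exp_\<phi>[OF elim] by (intro mult_left_mono super) simp
        also have "\<dots> = 1" by (simp add: ennreal_mult[symmetric] exp_add[symmetric])
        finally show ?case .
      qed
    qed
    finally show ?thesis using \<pi>.emeasure_space_1 by simp
  qed
  have Z_int: "integrable \<Gamma> ?Z"
  proof (rule integrableI_nonneg)
    show "?Z \<in> borel_measurable \<Gamma>" by (rule measurable_\<Gamma>) measurable
    show "(\<integral>\<^sup>+ z. ennreal (?Z z) \<partial>\<Gamma>) < \<infinity>" using Z_le by (rule le_less_trans) simp
  qed simp
  have Z_int_le: "(\<integral>z. ?Z z \<partial>\<Gamma>) \<le> 1"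
    using Z_le Z_int by (subst (asm) nn_integral_eq_integral) (auto simp: ennreal_le_1)
  have M_int: "integrable \<Gamma> M"
  proof -
    from M obtain c where c: "\<And>x y. \<bar>M (x, y)\<bar> \<le> c * (W0 x + W0 y)" "0 \<le> c"
      by (auto simp: weighted_Linf2_iff[OF W0_ge_1])
    show ?thesis
    proof (rule Bochner_Integration.integrable_bound)
      show "integrable \<Gamma> (\<lambda>z. c * (W0 (fst z) + W0 (snd z)))"
        using W0_integrable by simp
      show "M \<in> borel_measurable \<Gamma>" by (rule measurable_\<Gamma>) measurable
      have "norm (M z) \<le> norm (c * (W0 (fst z) + W0 (snd z)))" for z
        using c(1)[of "fst z" "snd z"] by simp
      then show "AE z in \<Gamma>. norm (M z) \<le> norm (c * (W0 (fst z) + W0 (snd z)))" by simp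
    qed
  qed
  let ?G = "\<lambda>z. ?Z z - 1 - M z + r + D z"
  have same: "distr \<Gamma> borel (\<lambda>z. \<phi> (fst z)) = distr \<Gamma> borel (\<lambda>z. \<phi> (snd z))"
    using marginals_eq distr_distr[OF \<phi> fst_\<Gamma>] distr_distr[OF \<phi> snd_\<Gamma>]
    by (simp add: marginal1_def marginal2_def comp_def)
  have L_le: "?L z \<le> ?Z z - 1" for z using exp_ge_add_one_self[of "?L z"] by linarith
  have \<phi>_int: "integrable \<Gamma> (\<lambda>z. \<phi> (snd z) - \<phi> (fst z))" and \<phi>_0: "(\<integral>z. \<phi> (snd z) - \<phi> (fst z) \<partial>\<Gamma>) = 0"
  proof -
    have "integrable \<Gamma> ?G" using Z_int M_int D_int by simp
    moreover have "\<phi> (snd z) - \<phi> (fst z) \<le> ?G z" for z using L_le[of z] by linarith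
    ultimately show "integrable \<Gamma> (\<lambda>z. \<phi> (snd z) - \<phi> (fst z))" "(\<integral>z. \<phi> (snd z) - \<phi> (fst z) \<partial>\<Gamma>) = 0"
      using integral_diff_same_distribution[OF prob_space_\<Gamma> measurable_\<Gamma>[OF \<phi>fst] measurable_\<Gamma>[OF \<phi>snd] same, of ?G]
      by auto
  qed
  have "(\<integral>z. M z \<partial>\<Gamma>) - r - (\<integral>z. D z \<partial>\<Gamma>) = (\<integral>z. M z + (\<phi> (snd z) - \<phi> (fst z)) - r - D z \<partial>\<Gamma>)"
    using M_int \<phi>_int \<phi>_0 D_int by (simp add: \<Gamma>.prob_space)
  also have "\<dots> \<le> (\<integral>z. ?Z z - 1 \<partial>\<Gamma>)"
  proof (rule integral_mono)
    show "integrable \<Gamma> (\<lambda>z. M z + (\<phi> (snd z) - \<phi> (fst z)) - r - D z)"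
      using M_int \<phi>_int D_int by simp
    show "integrable \<Gamma> (\<lambda>z. ?Z z - 1)" using Z_int by simp
    show "M z + (\<phi> (snd z) - \<phi> (fst z)) - r - D z \<le> ?Z z - 1" for z using L_le[of z] by linarith
  qed
  also have "\<dots> \<le> 0" using Z_int Z_int_le by (simp add: \<Gamma>.prob_space)
  finally show ?thesis by (simp add: KL_divergence_def ed)
qed

end

section \<open>Duality with relative entropy\<close>

context dv3_chain
begin

lemma finite_rate_Lam_star:
  assumes \<Gamma>: "\<Gamma> \<in> space (prob_algebra borel)" and W: "measure \<Gamma> \<in> weighted_measures W0"
    and fin: "Lam_star P \<psi> W0 (measure \<Gamma>) < \<infinity>"
  obtains S where "Lam_star P \<psi> W0 (measure \<Gamma>) = ereal S" "finite_rate P \<psi> V W W0 \<Gamma> S"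
proof -
  have sets: "sets \<Gamma> = sets borel" and "prob_space \<Gamma>" using \<Gamma> by (auto simp: space_prob_algebra)
  interpret \<Gamma>: prob_space \<Gamma> by fact
  note uv = upper_variation_borel[OF \<open>prob_space \<Gamma>\<close> sets]
  have int: "signed_integral borel (measure \<Gamma>) M = (\<integral>z. M z \<partial>\<Gamma>)" for M
    by (simp add: signed_integral_def uv)
  have W0': "(\<lambda>z. W0 (fst z) + W0 (snd z)) \<in> borel_measurable borel"
    using measurable_compose[OF measurable_fst_snd_borel(1) W0_measurable]
      measurable_compose[OF measurable_fst_snd_borel(2) W0_measurable] by measurable
  let ?\<Lambda> = "Lam_star P \<psi> W0 (measure \<Gamma>)"
  have upper: "ereal (\<integral>z. M z \<partial>\<Gamma>) - Lam P \<psi> M \<le> ?\<Lambda>" if "M \<in> weighted_Linf2 W0" for M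
    unfolding Lam_star_def int[symmetric] using that by (rule SUP_upper)
  have 0: "(\<lambda>_. 0) \<in> weighted_Linf2 W0"
    by (auto simp: weighted_Linf2_iff[OF W0_ge_1] intro!: exI[of _ 0])
  have "?\<Lambda> \<noteq> -\<infinity>" using upper[OF 0] Lam_finite[OF 0] by (cases "Lam P \<psi> (\<lambda>_. 0)") auto
  then obtain S where S: "?\<Lambda> = ereal S" using fin by (cases ?\<Lambda>) auto
  have "finite_rate P \<psi> V W W0 \<Gamma> S"
  proof
    show "\<Gamma> \<in> space (prob_algebra borel)" by fact
    have "(\<integral>\<^sup>+ z. ennreal (W0 (fst z) + W0 (snd z)) \<partial>\<Gamma>) < \<infinity>"
      using W by (simp add: weighted_measures_def weighted_norm_def uv split_beta')
    moreover have "0 \<le> W0 (fst z) + W0 (snd z)" for z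
      using W0_ge_1[of "fst z"] W0_ge_1[of "snd z"] by linarith
    ultimately show "integrable \<Gamma> (\<lambda>z. W0 (fst z) + W0 (snd z))"
      using W0' by (intro integrableI_nonneg) (auto simp: measurable_cong_sets[OF sets refl])
    fix M b assume M: "M \<in> weighted_Linf2 W0" and b: "Lam P \<psi> M \<le> ereal b"
    show "(\<integral>z. M z \<partial>\<Gamma>) \<le> S + b"
      using upper[OF M] Lam_finite[OF M] b unfolding S by (cases "Lam P \<psi> M") auto
  qed
  with S show ?thesis by (rule that)
qed

text \<open>
  With signs chosen by the Hahn decomposition, pairing \<open>\<gamma>\<close> with \<open>\<plusminus>(W\<^sub>0(x) + W\<^sub>0(y))\<close> gives the
  weighted norm, while \<open>\<Lambda>\<close> is bounded on all such functions by one constant.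
\<close>

lemma rate_bounded:
  obtains B :: real where "\<And>c \<gamma>. \<gamma> \<in> weighted_measures W0 \<Longrightarrow>
    Lam_star P \<psi> W0 \<gamma> \<le> ereal c \<Longrightarrow> weighted_norm W0 \<gamma> \<le> ennreal (c + B)"
proof -
  obtain B where B: "\<And>M. M \<in> borel_measurable borel \<Longrightarrow> (\<And>x y. \<bar>M (x, y)\<bar> \<le> 1 * (W0 x + W0 y)) \<Longrightarrow>
    Lam P \<psi> M \<le> ereal B"
    by (rule Lam_bounded[of 1]) (simp, blast)
  show ?thesis
  proof (rule that[of B])
    fix c \<gamma> assume \<gamma>: "\<gamma> \<in> weighted_measures W0" and c: "Lam_star P \<psi> W0 \<gamma> \<le> ereal c"
    let ?p = "upper_variation borel \<gamma>" and ?m = "upper_variation borel (\<lambda>A. - \<gamma> A)"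
    let ?w = "\<lambda>z. W0 (fst z) + W0 (snd z)"
    have sp: "sets ?p = sets borel" and sm: "sets ?m = sets borel" by simp_all
    have spp: "space ?p = UNIV" "space ?m = UNIV"
      using sets_eq_imp_space_eq[OF sp] sets_eq_imp_space_eq[OF sm] by auto
    have w [measurable]: "?w \<in> borel_measurable borel"
      using measurable_compose[OF measurable_fst_snd_borel(1) W0_measurable]
        measurable_compose[OF measurable_fst_snd_borel(2) W0_measurable] by measurable
    have w1: "1 \<le> ?w z" for z using W0_ge_1[of "fst z"] W0_ge_1[of "snd z"] by linarith
    have norm: "weighted_norm W0 \<gamma> = (\<integral>\<^sup>+ z. ennreal (?w z) \<partial>?p) + (\<integral>\<^sup>+ z. ennreal (?w z) \<partial>?m)"
      by (simp add: weighted_norm_def split_beta')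
    have fin: "(\<integral>\<^sup>+ z. ennreal (?w z) \<partial>?p) < \<infinity>" "(\<integral>\<^sup>+ z. ennreal (?w z) \<partial>?m) < \<infinity>"
      using \<gamma> by (auto simp: weighted_measures_def norm ennreal_add_eq_top less_top)
    have int_w: "integrable ?p ?w" "integrable ?m ?w"
      using fin w1 by (auto intro!: integrableI_nonneg order_trans[OF zero_le_one w1]
          simp: measurable_cong_sets[OF sp refl] measurable_cong_sets[OF sm refl])
    have "emeasure ?p UNIV \<le> (\<integral>\<^sup>+ z. ennreal (?w z) \<partial>?p)" "emeasure ?m UNIV \<le> (\<integral>\<^sup>+ z. ennreal (?w z) \<partial>?m)"
      using nn_integral_mono[of ?p "\<lambda>_. 1" "\<lambda>z. ennreal (?w z)"] nn_integral_mono[of ?m "\<lambda>_. 1" "\<lambda>z. ennreal (?w z)"]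
        w1 ennreal_leI[OF w1] by (simp_all add: spp)
    then have "emeasure ?p (space borel) < \<infinity>" "emeasure ?m (space borel) < \<infinity>"
      using fin by (auto elim: le_less_trans)
    moreover have "signed_measure borel \<gamma>" using \<gamma> by (simp add: weighted_measures_def)
    ultimately obtain Y where Y [measurable]: "Y \<in> sets borel" and Y0: "emeasure ?p (UNIV - Y) = 0" "emeasure ?m Y = 0"
      using signed_measure_Hahn[of borel \<gamma>] by auto
    define M where "M z = (if z \<in> Y then ?w z else - ?w z)" for z
    have M_meas: "M \<in> borel_measurable borel" unfolding M_def by measurable
    have M_le: "\<bar>M (x, y)\<bar> \<le> 1 * (W0 x + W0 y)" for x y using w1[of "(x, y)"] by (auto simp: M_def)
    have M: "M \<in> weighted_Linf2 W0"
      unfolding weighted_Linf2_iff[OF W0_ge_1] using M_meas M_le by (intro conjI exI[of _ 1]) auto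
    have "(\<integral>z. M z \<partial>?p) = (\<integral>z. ?w z \<partial>?p)"
    proof (rule integral_cong_AE)
      show "M \<in> borel_measurable ?p" "?w \<in> borel_measurable ?p"
        using M_meas w by (simp_all add: measurable_cong_sets[OF sp refl])
      show "AE z in ?p. M z = ?w z"
        using Y0(1) by (intro AE_I[of _ _ "UNIV - Y"]) (auto simp: M_def)
    qed
    moreover have "(\<integral>z. M z \<partial>?m) = - (\<integral>z. ?w z \<partial>?m)"
      unfolding Bochner_Integration.integral_minus[symmetric]
    proof (rule integral_cong_AE)
      show "M \<in> borel_measurable ?m" "(\<lambda>z. - ?w z) \<in> borel_measurable ?m"
        by (simp_all only: measurable_cong_sets[OF sm refl] M_meas borel_measurable_uminus[OF w])
      show "AE z in ?m. M z = - ?w z"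
        using Y0(2) by (intro AE_I[of _ _ Y]) (auto simp: M_def)
    qed
    ultimately have sint: "signed_integral borel \<gamma> M = (\<integral>z. ?w z \<partial>?p) + (\<integral>z. ?w z \<partial>?m)"
      by (simp only: signed_integral_def diff_minus_eq_add)
    have "ereal (signed_integral borel \<gamma> M) - Lam P \<psi> M \<le> Lam_star P \<psi> W0 \<gamma>"
      unfolding Lam_star_def using M by (rule SUP_upper)
    also note c
    finally have "signed_integral borel \<gamma> M \<le> c + B"
      using B[OF M_meas M_le] Lam_finite[OF M] by (cases "Lam P \<psi> M") auto
    moreover have "weighted_norm W0 \<gamma> = ennreal (signed_integral borel \<gamma> M)"
    proof -
      have nn: "0 \<le> ?w z" for z using w1[of z] by linarith
      have "0 \<le> (\<integral>z. ?w z \<partial>?p)" "0 \<le> (\<integral>z. ?w z \<partial>?m)" using nn by (auto intro!: integral_nonneg_AE)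
      then show ?thesis
        unfolding norm sint using int_w nn by (simp add: nn_integral_eq_integral ennreal_plus)
    qed
    ultimately show "weighted_norm W0 \<gamma> \<le> ennreal (c + B)" by (simp add: ennreal_leI)
  qed
qed

end

theorem theorem4p2:
  fixes P :: "'a::polish_space \<Rightarrow> 'a measure"
    and \<psi> :: "'a measure"
    and V W W0 :: "'a \<Rightarrow> real"
  assumes kernel: "transition_kernel P"
    and dv3plus: "DV3_plus P \<psi> V W"
    and unbounded: "\<not> bdd_above (range W)"
    and weight: "admissible_weight W W0"
  shows
    "(\<forall>\<Gamma>\<in>space (prob_algebra borel).
        measure \<Gamma> \<in> weighted_measures W0 \<longrightarrow> Lam_star P \<psi> W0 (measure \<Gamma>) < \<infinity> \<longrightarrow>
          marginal1 \<Gamma> = marginal2 \<Gamma> \<and>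
          (\<exists>Q. transition_kernel Q \<and> \<Gamma> = odot (marginal1 \<Gamma>) Q \<and>
               marginal1 \<Gamma> \<bind> Q = marginal1 \<Gamma>))
     \<and> (\<forall>\<Gamma>\<in>space (prob_algebra borel).
        measure \<Gamma> \<in> weighted_measures W0 \<longrightarrow> Lam_star P \<psi> W0 (measure \<Gamma>) < \<infinity> \<longrightarrow>
          Lam_star P \<psi> W0 (measure \<Gamma>) = relative_entropy \<Gamma> (odot (marginal1 \<Gamma>) P))
     \<and> (\<forall>c>0. \<exists>B::real. \<forall>\<gamma>\<in>weighted_measures W0.
          Lam_star P \<psi> W0 \<gamma> \<le> ereal c \<longrightarrow> weighted_norm W0 \<gamma> \<le> ennreal B)"
proof -
  interpret dv3_chain P \<psi> V W W0 by (rule dv3_chain.intro[OF kernel dv3plus weight])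
  have "marginal1 \<Gamma> = marginal2 \<Gamma> \<and>
      (\<exists>Q. transition_kernel Q \<and> \<Gamma> = odot (marginal1 \<Gamma>) Q \<and> marginal1 \<Gamma> \<bind> Q = marginal1 \<Gamma>) \<and>
      Lam_star P \<psi> W0 (measure \<Gamma>) = relative_entropy \<Gamma> (odot (marginal1 \<Gamma>) P)"
    if \<Gamma>: "\<Gamma> \<in> space (prob_algebra borel)" and W: "measure \<Gamma> \<in> weighted_measures W0"
      and fin: "Lam_star P \<psi> W0 (measure \<Gamma>) < \<infinity>" for \<Gamma>
  proof -
    obtain S where S: "Lam_star P \<psi> W0 (measure \<Gamma>) = ereal S" and "finite_rate P \<psi> V W W0 \<Gamma> S"
      by (rule finite_rate_Lam_star[OF \<Gamma> W fin])
    then interpret finite_rate P \<psi> V W W0 \<Gamma> S by simp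
    let ?H = "KL_divergence (exp 1) (odot (marginal1 \<Gamma>) P) \<Gamma>"
    have H: "relative_entropy \<Gamma> (odot (marginal1 \<Gamma>) P) = ereal ?H"
      using absolutely_continuous_odot entropy_finite by (simp add: relative_entropy_def)
    have "Lam_star P \<psi> W0 (measure \<Gamma>) \<le> ereal ?H"
      unfolding Lam_star_def
    proof (rule SUP_least)
      fix M assume M: "M \<in> weighted_Linf2 W0"
      obtain l where l: "Lam P \<psi> M = ereal l" using Lam_finite[OF M] by (cases "Lam P \<psi> M") auto
      have "(\<integral>z. M z \<partial>\<Gamma>) - l \<le> ?H"
      proof (rule field_le_epsilon)
        fix e :: real assume "0 < e"
        then show "(\<integral>z. M z \<partial>\<Gamma>) - l \<le> ?H + e"
          using integral_le_entropy[OF M, of "l + e"] l by simp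
      qed
      then show "ereal (signed_integral borel (measure \<Gamma>) M) - Lam P \<psi> M \<le> ereal ?H"
        by (simp add: l signed_integral_def upper_variation_borel[OF prob_space_\<Gamma> sets_\<Gamma>])
    qed
    then have "Lam_star P \<psi> W0 (measure \<Gamma>) = relative_entropy \<Gamma> (odot (marginal1 \<Gamma>) P)"
      using entropy_le by (simp add: S H)
    then show ?thesis
      using disintegration[OF \<Gamma> kernel absolutely_continuous_odot] marginals_eq by auto
  qed
  moreover have "\<forall>c>0. \<exists>B::real. \<forall>\<gamma>\<in>weighted_measures W0.
      Lam_star P \<psi> W0 \<gamma> \<le> ereal c \<longrightarrow> weighted_norm W0 \<gamma> \<le> ennreal B"
    by (rule rate_bounded) blast
  ultimately show ?thesis by blast
qed

end
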